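(* Let $p$ be a prime, let $k$ be a field with $\operatorname{char}(k)=p$ (not necessarily algebraically closed), and let $H$ be a finite-dimensional connected Hopf algebra over $k$ with counit $\varepsilon$. Let $\mathfrak g$ be the space of primitive elements of $H$, and let $K$ be the Hopf subalgebra of $H$ generated by $\mathfrak g$. Then the following are equivalent: (1) $H$ is semisimple. (2) $\varepsilon(\int_H^r)\neq 0$. (3) $\varepsilon(\int_H^l)\neq 0$. (4) $K$ is semisimple. (5) $\mathfrak g$ is abelian and $\mathfrak g=k\mathfrak g^p$. (6) $\varepsilon(\int_K^r)\neq 0$. (7) $\varepsilon(\int_K^l)\neq 0$.
   Context: The coradical $H_0$ of a Hopf algebra $H$ over $k$ is the sum of all simple subcoalgebras of $H$; $H$ is connected if $H_0$ is one-dimensional. An element $x\in H$ is primitive if $\Delta(x)=x\otimes 1+1\otimes x$. The primitive space $\mathfrak g$ is a restricted Lie algebra under the commutator $[x,y]=xy-yx$ and the restricted map $x\mapsto x^p$ (the $p$-th power in $H$); abelian means $[x,y]=0$ for all $x,y\in\mathfrak g$, and $k\mathfrak g^p$ denotes the $k$-linear span of $\{x^p : x\in\mathfrak g\}$. For a finite-dimensional Hopf algebra $A$, $\int_A^l=\{t\in A: at=\varepsilon(a)t \text{ for all } a\in A\}$ is the space of left integrals and $\int_A^r=\{t\in A: ta=\varepsilon(a)t\text{ for all } a\in A\}$ is the space of right integrals in $A$; $\varepsilon(\int)\ne 0$ means $\varepsilon$ is not identically zero on that space. A Hopf algebra is semisimple if it is semisimple as an algebra. *)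

theory Defs
  imports
    Complex_Main
    "HOL-Library.Poly_Mapping"
    "HOL-Computational_Algebra.Primes"
begin

section \<open>Tensor powers over a field\<close>

text \<open>
  The tensor powers \<open>V \<otimes> V\<close> and \<open>V \<otimes> V \<otimes> V\<close> are presented in the usual way: the free vector space
  on the pairs (triples) of elements of \<open>V\<close>, i.e. the finitely supported functions on \<open>V \<times> V\<close>
  (\<open>V \<times> V \<times> V\<close>), modulo the subspace spanned by the relations of additivity and homogeneity in each
  factor. We do not form the quotient as a type, since it depends on the scalar multiplication;
  tensors are given by representatives in the free space, and equality of tensors is the congruence
  modulo the relations.
\<close>

definition fscale :: "'k::field \<Rightarrow> ('b \<Rightarrow>\<^sub>0 'k) \<Rightarrow> ('b \<Rightarrow>\<^sub>0 'k)"
  where "fscale c f = Poly_Mapping.map ((*) c) f"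

lemma lookup_fscale: "Poly_Mapping.lookup (fscale c f) b = c * Poly_Mapping.lookup f b"
  by (cases "Poly_Mapping.lookup f b = 0") (simp_all add: fscale_def Poly_Mapping.map.rep_eq)

lemma vector_space_fscale: "vector_space (fscale :: 'k::field \<Rightarrow> ('b \<Rightarrow>\<^sub>0 'k) \<Rightarrow> _)"
  by unfold_locales
    (auto intro!: poly_mapping_eqI simp: lookup_fscale lookup_add algebra_simps)

abbreviation gen :: "'b \<Rightarrow> ('b \<Rightarrow>\<^sub>0 'k::field)"
  where "gen b \<equiv> Poly_Mapping.single b 1"

text \<open>The linear extension, along \<open>s\<close>, of a map \<open>\<phi>\<close> given on the basis of a free vector space.\<close>

definition lin_ext ::
    "('k::field \<Rightarrow> 'c \<Rightarrow> 'c::comm_monoid_add) \<Rightarrow> ('b \<Rightarrow> 'c) \<Rightarrow> ('b \<Rightarrow>\<^sub>0 'k) \<Rightarrow> 'c"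
  where "lin_ext s \<phi> f = (\<Sum>b\<in>Poly_Mapping.keys f. s (Poly_Mapping.lookup f b) (\<phi> b))"

text \<open>
  The relations making \<open>v \<mapsto> gen (\<iota> v)\<close> linear; \<open>\<iota>\<close> inserts \<open>v\<close> into one of the slots of a tuple
  whose other entries are fixed.
\<close>

definition slot_relations ::
    "('k::field \<Rightarrow> 'v \<Rightarrow> 'v::ab_group_add) \<Rightarrow> ('v \<Rightarrow> 'b) \<Rightarrow> ('b \<Rightarrow>\<^sub>0 'k) set"
  where "slot_relations s \<iota> =
      {gen (\<iota> (v + w)) - gen (\<iota> v) - gen (\<iota> w) | v w. True} \<union>
      {gen (\<iota> (s c v)) - fscale c (gen (\<iota> v)) | c v. True}"

definition tensor2_relations ::
    "('k::field \<Rightarrow> 'v \<Rightarrow> 'v::ab_group_add) \<Rightarrow> ('v \<times> 'v \<Rightarrow>\<^sub>0 'k) set"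
  where "tensor2_relations s = module.span fscale
      ((\<Union>y. slot_relations s (\<lambda>v. (v, y))) \<union>
       (\<Union>x. slot_relations s (\<lambda>v. (x, v))))"

definition tensor3_relations ::
    "('k::field \<Rightarrow> 'v \<Rightarrow> 'v::ab_group_add) \<Rightarrow> ('v \<times> 'v \<times> 'v \<Rightarrow>\<^sub>0 'k) set"
  where "tensor3_relations s = module.span fscale
      ((\<Union>y z. slot_relations s (\<lambda>v. (v, y, z))) \<union>
       (\<Union>x z. slot_relations s (\<lambda>v. (x, v, z))) \<union>
       (\<Union>x y. slot_relations s (\<lambda>v. (x, y, v))))"


section \<open>Algebras\<close>

text \<open>
  An associative unital algebra over a field, on a whole type. The class \<open>ring_1\<close> includes \<open>0 \<noteq> 1\<close>,
  which holds in every Hopf algebra because the counit maps \<open>1\<close> to \<open>1\<close>.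
\<close>

locale k_algebra = vector_space scale
  for scale :: "'k::field \<Rightarrow> 'h::ring_1 \<Rightarrow> 'h" (infixr \<open>*s\<close> 75) +
  assumes scale_mult_left: "(c *s x) * y = c *s (x * y)"
    and scale_mult_right: "x * (c *s y) = c *s (x * y)"
begin

definition finite_dimensional :: bool
  where "finite_dimensional \<longleftrightarrow> (\<exists>B. finite B \<and> span B = UNIV)"

definition subalgebra :: "'h set \<Rightarrow> bool"
  where "subalgebra A \<longleftrightarrow> subspace A \<and> 1 \<in> A \<and> (\<forall>x\<in>A. \<forall>y\<in>A. x * y \<in> A)"

text \<open>
  The following notions concern a subalgebra \<open>A\<close> (possibly the whole algebra) as an algebra in its
  own right: \<open>A\<close> is semisimple if, as a left module over itself, it is the sum of its simple
  submodules.
\<close>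

definition left_ideal :: "'h set \<Rightarrow> 'h set \<Rightarrow> bool"
  where "left_ideal A L \<longleftrightarrow> L \<subseteq> A \<and> subspace L \<and> (\<forall>a\<in>A. \<forall>x\<in>L. a * x \<in> L)"

definition simple_left_ideal :: "'h set \<Rightarrow> 'h set \<Rightarrow> bool"
  where "simple_left_ideal A L \<longleftrightarrow>
      left_ideal A L \<and> L \<noteq> {0} \<and> (\<forall>M. left_ideal A M \<and> M \<subseteq> L \<longrightarrow> M = {0} \<or> M = L)"

definition semisimple :: "'h set \<Rightarrow> bool"
  where "semisimple A \<longleftrightarrow> span (\<Union>{L. simple_left_ideal A L}) = A"

definition left_integrals :: "('h \<Rightarrow> 'k) \<Rightarrow> 'h set \<Rightarrow> 'h set"
  where "left_integrals \<epsilon> A = {t\<in>A. \<forall>a\<in>A. a * t = \<epsilon> a *s t}"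

definition right_integrals :: "('h \<Rightarrow> 'k) \<Rightarrow> 'h set \<Rightarrow> 'h set"
  where "right_integrals \<epsilon> A = {t\<in>A. \<forall>a\<in>A. t * a = \<epsilon> a *s t}"

definition teq2 :: "('h \<times> 'h \<Rightarrow>\<^sub>0 'k) \<Rightarrow> ('h \<times> 'h \<Rightarrow>\<^sub>0 'k) \<Rightarrow> bool" (infix \<open>\<approx>\<^sub>2\<close> 50)
  where "f \<approx>\<^sub>2 g \<longleftrightarrow> f - g \<in> tensor2_relations scale"

definition teq3 :: "('h \<times> 'h \<times> 'h \<Rightarrow>\<^sub>0 'k) \<Rightarrow> ('h \<times> 'h \<times> 'h \<Rightarrow>\<^sub>0 'k) \<Rightarrow> bool" (infix \<open>\<approx>\<^sub>3\<close> 50)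
  where "f \<approx>\<^sub>3 g \<longleftrightarrow> f - g \<in> tensor3_relations scale"

text \<open>The product of \<open>H \<otimes> H\<close>, given by \<open>(a \<otimes> b) (c \<otimes> d) = a c \<otimes> b d\<close>.\<close>

definition tmult :: "('h \<times> 'h \<Rightarrow>\<^sub>0 'k) \<Rightarrow> ('h \<times> 'h \<Rightarrow>\<^sub>0 'k) \<Rightarrow> ('h \<times> 'h \<Rightarrow>\<^sub>0 'k)"
  where "tmult f g =
      lin_ext fscale (\<lambda>(a, b). lin_ext fscale (\<lambda>(c, d). gen (a * c, b * d)) g) f"

end


section \<open>Hopf algebras\<close>

text \<open>
  \<open>\<Delta> x\<close> is a representative of the comultiplication of \<open>x\<close> in \<open>H \<otimes> H\<close>. Every condition below
  depends only on the class of \<open>\<Delta> x\<close> modulo \<open>\<approx>\<^sub>2\<close>, so the choice of representatives is immaterial.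
\<close>

locale hopf_algebra = k_algebra scale
  for scale :: "'k::field \<Rightarrow> 'h::ring_1 \<Rightarrow> 'h" (infixr \<open>*s\<close> 75) +
  fixes \<Delta> :: "'h \<Rightarrow> ('h \<times> 'h \<Rightarrow>\<^sub>0 'k)"
    and \<epsilon> :: "'h \<Rightarrow> 'k"
    and S :: "'h \<Rightarrow> 'h"
  assumes comult_add: "\<Delta> (x + y) \<approx>\<^sub>2 \<Delta> x + \<Delta> y"
    and comult_scale: "\<Delta> (c *s x) \<approx>\<^sub>2 fscale c (\<Delta> x)"
    and counit_add: "\<epsilon> (x + y) = \<epsilon> x + \<epsilon> y"
    and counit_scale: "\<epsilon> (c *s x) = c * \<epsilon> x"
    and antipode_add: "S (x + y) = S x + S y"
    and antipode_scale: "S (c *s x) = c *s S x"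
    and coassoc:
      "lin_ext fscale (\<lambda>(a, b). lin_ext fscale (\<lambda>(u, v). gen (u, v, b)) (\<Delta> a)) (\<Delta> x) \<approx>\<^sub>3
       lin_ext fscale (\<lambda>(a, b). lin_ext fscale (\<lambda>(u, v). gen (a, u, v)) (\<Delta> b)) (\<Delta> x)"
    and counit_left: "lin_ext scale (\<lambda>(a, b). \<epsilon> a *s b) (\<Delta> x) = x"
    and counit_right: "lin_ext scale (\<lambda>(a, b). \<epsilon> b *s a) (\<Delta> x) = x"
    and comult_one: "\<Delta> 1 \<approx>\<^sub>2 gen (1, 1)"
    and comult_mult: "\<Delta> (x * y) \<approx>\<^sub>2 tmult (\<Delta> x) (\<Delta> y)"
    and counit_one: "\<epsilon> 1 = 1"
    and counit_mult: "\<epsilon> (x * y) = \<epsilon> x * \<epsilon> y"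
    and antipode_left: "lin_ext scale (\<lambda>(a, b). S a * b) (\<Delta> x) = \<epsilon> x *s 1"
    and antipode_right: "lin_ext scale (\<lambda>(a, b). a * S b) (\<Delta> x) = \<epsilon> x *s 1"
begin

text \<open>The condition \<open>\<Delta>(C) \<subseteq> C \<otimes> C\<close>: each \<open>\<Delta> x\<close> is a sum of pure tensors with entries in \<open>C\<close>.\<close>

definition subcoalgebra :: "'h set \<Rightarrow> bool"
  where "subcoalgebra C \<longleftrightarrow>
      subspace C \<and> (\<forall>x\<in>C. \<exists>f. Poly_Mapping.keys f \<subseteq> C \<times> C \<and> \<Delta> x \<approx>\<^sub>2 f)"

definition simple_subcoalgebra :: "'h set \<Rightarrow> bool"
  where "simple_subcoalgebra C \<longleftrightarrow>
      subcoalgebra C \<and> C \<noteq> {0} \<and> (\<forall>D. subcoalgebra D \<and> D \<subseteq> C \<longrightarrow> D = {0} \<or> D = C)"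

definition coradical :: "'h set"
  where "coradical = span (\<Union>{C. simple_subcoalgebra C})"

definition connected :: bool
  where "connected \<longleftrightarrow> dim coradical = 1"

definition primitives :: "'h set"
  where "primitives = {x. \<Delta> x \<approx>\<^sub>2 gen (x, 1) + gen (1, x)}"

definition hopf_subalgebra :: "'h set \<Rightarrow> bool"
  where "hopf_subalgebra A \<longleftrightarrow> subalgebra A \<and> subcoalgebra A \<and> (\<forall>x\<in>A. S x \<in> A)"

definition generated_hopf_subalgebra :: "'h set \<Rightarrow> 'h set"
  where "generated_hopf_subalgebra X = \<Inter>{A. hopf_subalgebra A \<and> X \<subseteq> A}"

end

end

theory Submission
  imports Defs
begin

text \<open>
  Let \<open>U\<close> be the subalgebra generated by the primitive elements. A left or right integral with nonzero
  counit gives an element \<open>\<Lambda>\<close> with \<open>\<epsilon> \<Lambda> \<noteq> 0\<close> killed by left multiplication with primitives (in the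
  right case, through the antipode). As the Hopf algebra is a free left \<open>U\<close>-module, there is also such an
  element \<open>t\<close> in \<open>U\<close>. The dual algebra of \<open>U\<close> is commutative, the primitives act on it by derivations,
  and evaluation at \<open>t\<close> is invariant. For a functional \<open>z\<close>, the map \<open>F x = ((x z) * z^{p-1}) t\<close> then
  kills commutators and satisfies \<open>F (x^p) = z(x)^p \<epsilon> t\<close>. Hence the \<open>p\<close>-th powers of a basis of the
  primitives are linearly independent modulo commutators, which means that the primitives are abelian and
  spanned by \<open>p\<close>-th powers. No extension of the ground field is needed.

  Conversely, if the primitives are abelian and spanned by \<open>p\<close>-th powers, then the Frobenius map, being
  injective on them, is injective on every commutative sub-bialgebra \<open>B\<close> containing them, by connectedness;
  so \<open>B\<close> is reduced and spanned by \<open>p\<close>-th powers, and derivations of \<open>B\<close> vanish. Enlarging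
  \<open>B\<close> step by step shows that the whole algebra is commutative. A reduced commutative algebra of finite
  dimension is semisimple, and in a semisimple algebra a simple left ideal on which the counit does not
  vanish consists of left integrals.
\<close>

section \<open>Tensors and linear functionals\<close>

text \<open>The form \<open>F\<close> comes from logarithmic derivatives. For a derivation
  \<open>D\<close> in characteristic \<open>p\<close> and a unit \<open>z\<close>, the element
  \<open>u = D z / z\<close> satisfies \<open>D^{p-1} u + u^p = D^p z / z\<close>. In the dual of
  \<open>U\<close> the power \<open>z^p\<close> is the scalar \<open>z(1)^p\<close>, so
  \<open>z^{p-1}\<close> stands in for the inverse of \<open>z\<close>. Multiplied through by
  \<open>z^p\<close> the identity holds for every \<open>z\<close>, and evaluation at
  \<open>t\<close> removes the term with \<open>D^{p-1}\<close>, because \<open>D\<close> is dual to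
  left multiplication by \<open>x\<close> and \<open>x * t = 0\<close>.

  The obstacle in the converse is that the algebra is not known to be commutative, nor the field
  perfect: Frobenius is additive only on commuting elements, and scalars may lack
  \<open>p\<close>-th roots. So commutative pieces grow by one generator at a time, and roots are
  replaced by an additive left inverse of the Frobenius map of the field.

  Connectedness enters the inductions in one way: for a proper inclusion of coideals, the larger one
  has a new vector on which, modulo the smaller one, the dual algebra acts through evaluation at
  \<open>1\<close>. This takes the place of the coradical filtration.\<close>

interpretation fs: vector_space fscale
  by (rule vector_space_fscale)

lemma vector_space_times: "vector_space ((*) :: 'k::field \<Rightarrow> 'k \<Rightarrow> 'k)"
  by unfold_locales (auto simp: algebra_simps)

lemma lin_ext_superset:
  assumes "vector_space s" "finite F" "Poly_Mapping.keys f \<subseteq> F"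
  shows "lin_ext s \<phi> f = (\<Sum>b\<in>F. s (Poly_Mapping.lookup f b) (\<phi> b))"
proof -
  interpret vector_space s by fact
  show ?thesis unfolding lin_ext_def
    by (rule sum.mono_neutral_left) (use assms in \<open>auto simp: in_keys_iff\<close>)
qed

lemma lin_ext_gen [simp]: "vector_space s \<Longrightarrow> lin_ext s \<phi> (gen b) = \<phi> b"
  by (simp add: lin_ext_def vector_space.vector_space_assms(4))

lemma lin_ext_add:
  assumes "vector_space s"
  shows "lin_ext s \<phi> (f + g) = lin_ext s \<phi> f + lin_ext s \<phi> g"
proof -
  interpret vector_space s by fact
  let ?F = "Poly_Mapping.keys f \<union> Poly_Mapping.keys g"
  have "Poly_Mapping.keys (f + g) \<subseteq> ?F" by (rule keys_add)
  then show ?thesis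
    by (simp add: lin_ext_superset[OF assms, of ?F] lookup_add scale_left_distrib sum.distrib)
qed

lemma keys_fscale: "Poly_Mapping.keys (fscale c f) \<subseteq> Poly_Mapping.keys f"
  by (auto simp: in_keys_iff lookup_fscale)

lemma lin_ext_fscale:
  assumes "vector_space s"
  shows "lin_ext s \<phi> (fscale c f) = s c (lin_ext s \<phi> f)"
proof -
  interpret vector_space s by fact
  show ?thesis
    by (subst lin_ext_superset[OF assms, of "Poly_Mapping.keys f"])
      (auto simp: lin_ext_def lookup_fscale scale_sum_right keys_fscale)
qed

lemma lin_ext_linear:
  assumes "vector_space s" shows "Vector_Spaces.linear fscale s (lin_ext s \<phi>)"
  by (simp add: Vector_Spaces.linear_iff vector_space_fscale assms lin_ext_add lin_ext_fscale)

lemma lin_ext_diff: "vector_space s \<Longrightarrow> lin_ext s \<phi> (f - g) = lin_ext s \<phi> f - lin_ext s \<phi> g"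
  by (metis add_diff_cancel_right' diff_add_cancel lin_ext_add)

lemma lin_ext_zero [simp]: "lin_ext s \<phi> 0 = 0"
  by (simp add: lin_ext_def)

lemma lin_ext_sum:
  "vector_space s \<Longrightarrow> lin_ext s \<phi> (\<Sum>i\<in>I. f i) = (\<Sum>i\<in>I. lin_ext s \<phi> (f i))"
  by (induction I rule: infinite_finite_induct) (auto simp: lin_ext_add)

lemma linear_lin_ext:
  assumes "Vector_Spaces.linear s s' F"
  shows "F (lin_ext s \<phi> f) = lin_ext s' (\<lambda>b. F (\<phi> b)) f"
proof -
  interpret Vector_Spaces.linear s s' F by fact
  show ?thesis by (simp add: lin_ext_def sum scale)
qed

lemma lin_ext_lin_ext:
  assumes "vector_space s"
  shows "lin_ext s \<phi> (lin_ext fscale \<psi> f) = lin_ext s (\<lambda>b. lin_ext s \<phi> (\<psi> b)) f"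
  by (rule linear_lin_ext[OF lin_ext_linear[OF assms]])

lemma lin_ext_cong: "(\<And>b. b \<in> Poly_Mapping.keys f \<Longrightarrow> \<phi> b = \<psi> b) \<Longrightarrow> lin_ext s \<phi> f = lin_ext s \<psi> f"
  by (simp add: lin_ext_def cong: sum.cong)

lemma lin_ext_add_right:
  assumes "vector_space s"
  shows "lin_ext s (\<lambda>b. \<phi> b + \<psi> b) f = lin_ext s \<phi> f + lin_ext s \<psi> f"
proof -
  interpret vector_space s by fact
  show ?thesis by (simp add: lin_ext_def scale_right_distrib sum.distrib)
qed

lemma lin_ext_gen_id: "lin_ext fscale gen f = f"
proof (rule poly_mapping_eqI)
  fix k
  have "Poly_Mapping.lookup (lin_ext fscale gen f) k =
      (\<Sum>b\<in>Poly_Mapping.keys f. if b = k then Poly_Mapping.lookup f b else 0)"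
    unfolding lin_ext_def lookup_sum lookup_fscale lookup_single when_def
    by (intro sum.cong) auto
  also have "\<dots> = Poly_Mapping.lookup f k"
    by (simp add: sum.delta in_keys_iff)
  finally show "Poly_Mapping.lookup (lin_ext fscale gen f) k = Poly_Mapping.lookup f k" .
qed

lemma subspace_keys: "fs.subspace {f. Poly_Mapping.keys f \<subseteq> X}"
proof (rule fs.subspaceI)
  show "x + y \<in> {f. Poly_Mapping.keys f \<subseteq> X}"
    if "x \<in> {f. Poly_Mapping.keys f \<subseteq> X}" "y \<in> {f. Poly_Mapping.keys f \<subseteq> X}" for x y
    using that keys_add[of x y] by auto
  show "fscale c x \<in> {f. Poly_Mapping.keys f \<subseteq> X}"
    if "x \<in> {f. Poly_Mapping.keys f \<subseteq> X}" for c x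
    using that keys_fscale[of c x] by auto
qed simp

lemma (in vector_space) lin_ext_in_subspace:
  assumes "subspace A" "\<And>b. b \<in> Poly_Mapping.keys f \<Longrightarrow> \<phi> b \<in> A"
  shows "lin_ext scale \<phi> f \<in> A"
  unfolding lin_ext_def by (intro subspace_sum subspace_scale assms)

lemma keys_lin_ext:
  assumes "\<And>b. b \<in> Poly_Mapping.keys f \<Longrightarrow> Poly_Mapping.keys (\<phi> b) \<subseteq> X"
  shows "Poly_Mapping.keys (lin_ext fscale \<phi> f) \<subseteq> X"
  using fs.lin_ext_in_subspace[OF subspace_keys[of X], of f \<phi>] assms by auto

lemma slot_relations_lin_ext:
  assumes "vector_space s'" "r \<in> slot_relations s \<iota>"
    and "\<And>v w. \<phi> (\<iota> (v + w)) = \<phi> (\<iota> v) + \<phi> (\<iota> w)"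
    and "\<And>c v. \<phi> (\<iota> (s c v)) = s' c (\<phi> (\<iota> v))"
  shows "lin_ext s' \<phi> r = 0"
  using assms(2) unfolding slot_relations_def
  by (auto simp: lin_ext_diff[OF assms(1)] lin_ext_fscale[OF assms(1)] lin_ext_gen[OF assms(1)] assms(3,4))

lemma linear_zero_on_span:
  assumes "Vector_Spaces.linear s1 s2 F" "\<And>x. x \<in> X \<Longrightarrow> F x = 0" "x \<in> module.span s1 X"
  shows "F x = 0"
proof -
  interpret Vector_Spaces.linear s1 s2 F by fact
  show ?thesis by (rule eq_0_on_span[OF assms(2,3)])
qed

section \<open>Linear functionals on an algebra and their values on tensors\<close>

context k_algebra
begin

lemma vector_space_scale: "vector_space scale" ..

definition lf :: "('h \<Rightarrow> 'k) \<Rightarrow> bool"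
  where "lf f \<longleftrightarrow> (\<forall>x y. f (x + y) = f x + f y) \<and> (\<forall>c x. f (c *s x) = c * f x)"

lemma lf_linear: "lf f \<longleftrightarrow> Vector_Spaces.linear scale (*) f"
  by (simp add: lf_def Vector_Spaces.linear_iff vector_space_scale vector_space_times)

lemma lfI: "(\<And>x y. f (x + y) = f x + f y) \<Longrightarrow> (\<And>c x. f (c *s x) = c * f x) \<Longrightarrow> lf f"
  by (auto simp: lf_def)

lemma lf_add: "lf f \<Longrightarrow> f (x + y) = f x + f y"
  and lf_scale: "lf f \<Longrightarrow> f (c *s x) = c * f x"
  by (auto simp: lf_def)

lemma lf_zero: "lf f \<Longrightarrow> f 0 = 0"
  using lf_scale[of f 0 0] by simp

lemma lf_diff: "lf f \<Longrightarrow> f (x - y) = f x - f y"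
  by (metis add_diff_cancel_right' diff_add_cancel lf_add)

lemma lf_sum: "lf f \<Longrightarrow> f (\<Sum>i\<in>I. g i) = (\<Sum>i\<in>I. f (g i))"
  by (induction I rule: infinite_finite_induct) (auto simp: lf_add lf_zero)

lemma lf_lin_ext: "lf f \<Longrightarrow> f (lin_ext scale \<phi> u) = lin_ext (*) (\<lambda>b. f (\<phi> b)) u"
  by (rule linear_lin_ext) (simp add: lf_linear)

lemma lf_lin: "lf f \<Longrightarrow> lf g \<Longrightarrow> lf (\<lambda>x. f x + g x)" "lf f \<Longrightarrow> lf (\<lambda>x. c * f x)"
  "lf f \<Longrightarrow> lf g \<Longrightarrow> lf (\<lambda>x. f x - g x)" "lf (\<lambda>x. 0)"
  by (auto simp: lf_def algebra_simps)

lemma lf_mult: "lf f \<Longrightarrow> lf (\<lambda>x. f (a * x))" "lf f \<Longrightarrow> lf (\<lambda>x. f (x * a))"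
  by (auto simp: lf_def algebra_simps scale_mult_left scale_mult_right)

lemma lf_extend:
  assumes "independent E"
  shows "\<exists>f. lf f \<and> (\<forall>e\<in>E. f e = g e)"
proof -
  interpret vp: vector_space_pair scale "(*) :: 'k \<Rightarrow> 'k \<Rightarrow> 'k"
    by (intro vector_space_pair.intro vector_space_times vector_space_scale)
  show ?thesis using vp.linear_independent_extend[OF assms, of g] by (simp add: lf_linear)
qed

lemma lf_separate:
  assumes "subspace W" "x \<notin> W"
  shows "\<exists>f. lf f \<and> (\<forall>w\<in>W. f w = 0) \<and> f x = 1"
proof -
  obtain B where B: "B \<subseteq> W" "independent B" "W \<subseteq> span B"
    using maximal_independent_subset[of W] by auto
  have "span B \<subseteq> W" using B(1) assms(1) by (simp add: span_minimal)
  then have x: "x \<notin> span B" using assms(2) by auto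
  then have "independent (insert x B)" using B(2) by (simp add: independent_insert)
  from lf_extend[OF this, of "\<lambda>e. if e = x then 1 else 0"]
  obtain f where f: "lf f" "f x = 1" "\<forall>e\<in>B. f e = 0"
    using x span_base by (metis insertI1 insertI2)
  have "f w = 0" if "w \<in> W" for w
  proof (rule linear_zero_on_span[where ?s1.0 = scale and ?s2.0 = "(*)" and F = f and X = B and x = w])
    show "Vector_Spaces.linear scale (*) f" using f(1) by (simp add: lf_linear)
  qed (use f(3) B(3) that in auto)
  then show ?thesis using f by auto
qed

lemma lf_eqI:
  assumes "\<And>f. lf f \<Longrightarrow> f x = f y" shows "x = y"
proof (rule ccontr)
  assume "x \<noteq> y"
  then obtain f where "lf f" "f (x - y) = 1"
    using lf_separate[of "{0}" "x - y"] by auto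
  then show False using assms[of f] by (simp add: lf_diff)
qed

text \<open>The functional \<open>f \<otimes> g\<close> on \<open>H \<otimes> H\<close>, evaluated
  on a representative.\<close>

definition pair :: "('h \<Rightarrow> 'k) \<Rightarrow> ('h \<Rightarrow> 'k) \<Rightarrow> ('h \<times> 'h \<Rightarrow>\<^sub>0 'k) \<Rightarrow> 'k"
  where "pair f g = lin_ext (*) (\<lambda>(a, b). f a * g b)"

lemma pair_simps: "pair f g (gen (a, b)) = f a * g b" "pair f g (u + v) = pair f g u + pair f g v"
  "pair f g (u - v) = pair f g u - pair f g v" "pair f g (fscale c u) = c * pair f g u"
  "pair f g 0 = 0"
  by (simp_all add: pair_def lin_ext_add lin_ext_diff lin_ext_fscale vector_space_times)

text \<open>The universal property of the tensor product: linearity in each slot kills the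
  generating relations, so the extension depends only on the class of the tensor.\<close>

lemma teq2_lin_ext:
  assumes s: "vector_space s" and uv: "u \<approx>\<^sub>2 v"
    and "\<And>a a' b. \<phi> (a + a', b) = \<phi> (a, b) + \<phi> (a', b)"
    and "\<And>c a b. \<phi> (c *s a, b) = s c (\<phi> (a, b))"
    and "\<And>a b b'. \<phi> (a, b + b') = \<phi> (a, b) + \<phi> (a, b')"
    and "\<And>c a b. \<phi> (a, c *s b) = s c (\<phi> (a, b))"
  shows "lin_ext s \<phi> u = lin_ext s \<phi> v"
proof -
  have "lin_ext s \<phi> (u - v) = 0"
  proof (rule linear_zero_on_span[OF lin_ext_linear[OF s, where \<phi>=\<phi>]])
    show "u - v \<in> module.span fscale
      ((\<Union>y. slot_relations scale (\<lambda>v. (v, y))) \<union> (\<Union>x. slot_relations scale (\<lambda>v. (x, v))))"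
      using uv by (simp add: teq2_def tensor2_relations_def)
    fix r assume "r \<in> (\<Union>y. slot_relations scale (\<lambda>v. (v, y))) \<union> (\<Union>x. slot_relations scale (\<lambda>v. (x, v)))"
    then consider y where "r \<in> slot_relations scale (\<lambda>v. (v, y))"
      | x where "r \<in> slot_relations scale (\<lambda>v. (x, v))" by auto
    then show "lin_ext s \<phi> r = 0"
    proof cases
      case 1 then show ?thesis by (rule slot_relations_lin_ext[OF s]) (simp_all add: assms(3-))
    next
      case 2 then show ?thesis by (rule slot_relations_lin_ext[OF s]) (simp_all add: assms(3-))
    qed
  qed
  then show ?thesis by (simp add: lin_ext_diff[OF s])
qed

lemma teq3_lin_ext:
  assumes s: "vector_space s" and uv: "u \<approx>\<^sub>3 v"
    and "\<And>a a' b d. \<phi> (a + a', b, d) = \<phi> (a, b, d) + \<phi> (a', b, d)"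
    and "\<And>c a b d. \<phi> (c *s a, b, d) = s c (\<phi> (a, b, d))"
    and "\<And>a b b' d. \<phi> (a, b + b', d) = \<phi> (a, b, d) + \<phi> (a, b', d)"
    and "\<And>c a b d. \<phi> (a, c *s b, d) = s c (\<phi> (a, b, d))"
    and "\<And>a b d d'. \<phi> (a, b, d + d') = \<phi> (a, b, d) + \<phi> (a, b, d')"
    and "\<And>c a b d. \<phi> (a, b, c *s d) = s c (\<phi> (a, b, d))"
  shows "lin_ext s \<phi> u = lin_ext s \<phi> v"
proof -
  have "lin_ext s \<phi> (u - v) = 0"
  proof (rule linear_zero_on_span[OF lin_ext_linear[OF s, where \<phi>=\<phi>]])
    let ?X = "(\<Union>y z. slot_relations scale (\<lambda>v. (v, y, z))) \<union>
       (\<Union>x z. slot_relations scale (\<lambda>v. (x, v, z))) \<union>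
       (\<Union>x y. slot_relations scale (\<lambda>v. (x, y, v)))"
    show "u - v \<in> module.span fscale ?X"
      using uv by (simp add: teq3_def tensor3_relations_def)
    fix r assume "r \<in> ?X"
    then consider y z where "r \<in> slot_relations scale (\<lambda>v. (v, y, z))"
      | x z where "r \<in> slot_relations scale (\<lambda>v. (x, v, z))"
      | x y where "r \<in> slot_relations scale (\<lambda>v. (x, y, v))" by auto
    then show "lin_ext s \<phi> r = 0"
    proof cases
      case 1 then show ?thesis by (rule slot_relations_lin_ext[OF s]) (simp_all add: assms(3-))
    next
      case 2 then show ?thesis by (rule slot_relations_lin_ext[OF s]) (simp_all add: assms(3-))
    next
      case 3 then show ?thesis by (rule slot_relations_lin_ext[OF s]) (simp_all add: assms(3-))
    qed
  qed
  then show ?thesis by (simp add: lin_ext_diff[OF s])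
qed

lemma teq2_pair: "u \<approx>\<^sub>2 v \<Longrightarrow> lf f \<Longrightarrow> lf g \<Longrightarrow> pair f g u = pair f g v"
  unfolding pair_def
  by (rule teq2_lin_ext[OF vector_space_times]) (auto simp: lf_def algebra_simps)

lemma teq2_refl [simp]: "u \<approx>\<^sub>2 u"
  and teq2_sym: "u \<approx>\<^sub>2 v \<Longrightarrow> v \<approx>\<^sub>2 u"
  and teq2_trans [trans]: "u \<approx>\<^sub>2 v \<Longrightarrow> v \<approx>\<^sub>2 w \<Longrightarrow> u \<approx>\<^sub>2 w"
  and teq2_add: "u \<approx>\<^sub>2 v \<Longrightarrow> u' \<approx>\<^sub>2 v' \<Longrightarrow> u + u' \<approx>\<^sub>2 v + v'"
  and teq2_fscale: "u \<approx>\<^sub>2 v \<Longrightarrow> fscale c u \<approx>\<^sub>2 fscale c v"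
proof -
  note d = teq2_def tensor2_relations_def
  show "u \<approx>\<^sub>2 u" by (simp add: d fs.span_zero)
  show "u \<approx>\<^sub>2 v \<Longrightarrow> v \<approx>\<^sub>2 u" unfolding d using fs.span_neg by fastforce
  show "u \<approx>\<^sub>2 v \<Longrightarrow> v \<approx>\<^sub>2 w \<Longrightarrow> u \<approx>\<^sub>2 w" unfolding d using fs.span_add by fastforce
  show "u \<approx>\<^sub>2 v \<Longrightarrow> u' \<approx>\<^sub>2 v' \<Longrightarrow> u + u' \<approx>\<^sub>2 v + v'" unfolding d
    using fs.span_add[of "u - v" _ "u' - v'"] by (simp add: algebra_simps)
  show "u \<approx>\<^sub>2 v \<Longrightarrow> fscale c u \<approx>\<^sub>2 fscale c v" unfolding d
    using fs.span_scale[of "u - v" _ c] by (simp add: fs.scale_right_diff_distrib)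
qed

lemma teq2_sum: "(\<And>i. i \<in> I \<Longrightarrow> u i \<approx>\<^sub>2 v i) \<Longrightarrow> (\<Sum>i\<in>I. u i) \<approx>\<^sub>2 (\<Sum>i\<in>I. v i)"
  by (induction I rule: infinite_finite_induct) (auto intro: teq2_add)

lemma teq2_slot:
  "gen (a + a', b) \<approx>\<^sub>2 gen (a, b) + gen (a', b)" "gen (c *s a, b) \<approx>\<^sub>2 fscale c (gen (a, b))"
  "gen (a, b + b') \<approx>\<^sub>2 gen (a, b) + gen (a, b')" "gen (a, c *s b) \<approx>\<^sub>2 fscale c (gen (a, b))"
proof -
  have 1: "gen (\<iota> (v + w)) - (gen (\<iota> v) + gen (\<iota> w)) \<in> slot_relations scale \<iota>"
    "gen (\<iota> (c *s v)) - fscale c (gen (\<iota> v)) \<in> slot_relations scale \<iota>"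
    for \<iota> :: "'h \<Rightarrow> 'h \<times> 'h" and v w
    unfolding slot_relations_def diff_diff_eq[symmetric] by blast+
  note d = teq2_def tensor2_relations_def
  show "gen (a + a', b) \<approx>\<^sub>2 gen (a, b) + gen (a', b)" "gen (c *s a, b) \<approx>\<^sub>2 fscale c (gen (a, b))"
    "gen (a, b + b') \<approx>\<^sub>2 gen (a, b) + gen (a, b')" "gen (a, c *s b) \<approx>\<^sub>2 fscale c (gen (a, b))"
    unfolding d
    using 1(1)[of "\<lambda>v. (v, b)" a a'] 1(2)[of "\<lambda>v. (v, b)" a]
      1(1)[of "\<lambda>v. (a, v)" b b'] 1(2)[of "\<lambda>v. (a, v)" b]
    by (auto intro!: fs.span_base)
qed

lemma teq2_gen_zero: "gen (0, b) \<approx>\<^sub>2 0" "gen (a, 0) \<approx>\<^sub>2 0"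
  using teq2_slot(2)[of 0 0 b] teq2_slot(4)[of a 0 0] by simp_all

lemma teq2_gen_sum:
  "gen (\<Sum>i\<in>I. c i *s x i, b) \<approx>\<^sub>2 (\<Sum>i\<in>I. fscale (c i) (gen (x i, b)))"
  "gen (a, \<Sum>i\<in>I. c i *s x i) \<approx>\<^sub>2 (\<Sum>i\<in>I. fscale (c i) (gen (a, x i)))"
proof (induction I rule: infinite_finite_induct)
  case (insert i I)
  { case 1
    show ?case using teq2_trans[OF teq2_slot(1) teq2_add[OF teq2_slot(2) insert.IH(1)]] insert.hyps by simp }
  { case 2
    show ?case using teq2_trans[OF teq2_slot(3) teq2_add[OF teq2_slot(4) insert.IH(2)]] insert.hyps by simp }
qed (simp_all add: teq2_gen_zero)

lemma pair_sum: "pair f g (\<Sum>i\<in>I. u i) = (\<Sum>i\<in>I. pair f g (u i))"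
  unfolding pair_def by (rule lin_ext_sum[OF vector_space_times])

lemma pair_tmult:
  "pair f g (tmult u v) =
    lin_ext (*) (\<lambda>(a, b). pair (\<lambda>x. f (a * x)) (\<lambda>x. g (b * x)) v) u"
  unfolding tmult_def pair_def
  by (simp add: lin_ext_lin_ext vector_space_times case_prod_unfold)

text \<open>The order of summation decides which factor ends up inside a \<open>pair\<close>, and
  only there can it be replaced by a congruent tensor. This version frees the first factor,
  \<open>pair_tmult\<close> the second.\<close>

lemma pair_tmult':
  "pair f g (tmult u v) =
    lin_ext (*) (\<lambda>(c, d). pair (\<lambda>x. f (x * c)) (\<lambda>x. g (x * d)) u) v"
proof -
  have "pair f g (tmult u v) = (\<Sum>k\<in>Poly_Mapping.keys u. \<Sum>l\<in>Poly_Mapping.keys v.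
      Poly_Mapping.lookup u k * (Poly_Mapping.lookup v l * (f (fst k * fst l) * g (snd k * snd l))))"
    unfolding pair_tmult unfolding pair_def lin_ext_def by (simp add: case_prod_unfold sum_distrib_left)
  also have "\<dots> = (\<Sum>l\<in>Poly_Mapping.keys v. \<Sum>k\<in>Poly_Mapping.keys u.
      Poly_Mapping.lookup u k * (Poly_Mapping.lookup v l * (f (fst k * fst l) * g (snd k * snd l))))"
    by (rule sum.swap)
  also have "\<dots> = lin_ext (*) (\<lambda>(c, d). pair (\<lambda>x. f (x * c)) (\<lambda>x. g (x * d)) u) v"
    by (simp add: pair_def lin_ext_def case_prod_unfold sum_distrib_left mult.left_commute)
  finally show ?thesis .
qed

lemma keys_tmult:
  assumes "Poly_Mapping.keys u \<subseteq> A \<times> B" "Poly_Mapping.keys v \<subseteq> C \<times> D"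
    and "\<And>a c. a \<in> A \<Longrightarrow> c \<in> C \<Longrightarrow> a * c \<in> X" "\<And>b d. b \<in> B \<Longrightarrow> d \<in> D \<Longrightarrow> b * d \<in> Y"
  shows "Poly_Mapping.keys (tmult u v) \<subseteq> X \<times> Y"
  unfolding tmult_def using assms by (fastforce intro!: keys_lin_ext)

end

section \<open>Convolution and the regular actions of the dual algebra\<close>

locale finite_dimensional_hopf_algebra =
  hopf_algebra scale \<Delta> \<epsilon> S + finite_dimensional_vector_space scale Basis
  for scale :: "'k::field \<Rightarrow> 'h::ring_1 \<Rightarrow> 'h" (infixr \<open>*s\<close> 75)
    and \<Delta> :: "'h \<Rightarrow> ('h \<times> 'h \<Rightarrow>\<^sub>0 'k)" and \<epsilon> :: "'h \<Rightarrow> 'k" and S :: "'h \<Rightarrow> 'h"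
    and Basis :: "'h set"
begin

lemma basis_of_subspace:
  assumes "subspace W"
  obtains E where "finite E" "independent E" "span E = W" "card E = dim W"
proof -
  obtain E where "E \<subseteq> W" "independent E" "W \<subseteq> span E" "card E = dim W"
    by (rule basis_exists[of W])
  then show thesis using finiteI_independent[of E] span_subspace[of E W] assms that by simp
qed

lemma basis_extension:
  assumes "independent E"
  obtains F where "E \<subseteq> F" "finite F" "independent F" "span F = UNIV"
proof -
  obtain F where "E \<subseteq> F" "F \<subseteq> UNIV" "independent F" "UNIV \<subseteq> span F"
    by (rule maximal_independent_subset_extend[OF subset_UNIV assms])
  then show thesis using finiteI_independent[of F] that[of F] by (simp add: top.extremum_unique)
qed

lemma adapted_basis:
  assumes "subspace W"
  obtains E F where "E \<subseteq> F" "span E = W" "finite F" "independent F" "span F = UNIV"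
proof -
  obtain E where E: "finite E" "independent E" "span E = W" "card E = dim W"
    by (rule basis_of_subspace[OF assms])
  obtain F where "E \<subseteq> F" "finite F" "independent F" "span F = UNIV"
    by (rule basis_extension[OF E(2)])
  then show thesis using that E(3) by simp
qed

lemma lf_representation:
  assumes "independent E" "span E = UNIV"
  shows "lf (\<lambda>x. representation E x e)"
  using assms by (intro lfI) (auto simp: representation_add representation_scale)

lemma representation_outside:
  assumes "E \<subseteq> F" "independent F" "x \<in> span E" "e \<notin> E"
  shows "representation F x e = 0"
  using representation_extend[OF assms(2,3,1)] assms(4) representation_ne_zero[of E x e] by auto

text \<open>Two bases are allowed so that each slot can have one adapted to its own
  subspace.\<close>

lemma teq2_expand2:
  assumes E: "finite E" "independent E" "span E = UNIV" and F: "finite F" "independent F" "span F = UNIV"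
  shows "u \<approx>\<^sub>2 (\<Sum>e\<in>E. \<Sum>e'\<in>F. fscale (pair (\<lambda>x. representation E x e) (\<lambda>x. representation F x e') u) (gen (e, e')))"
proof -
  let ?r = "representation E" and ?s = "representation F"
  let ?R = "\<lambda>u. \<Sum>e\<in>E. \<Sum>e'\<in>F. fscale (pair (\<lambda>x. ?r x e) (\<lambda>x. ?s x e') u) (gen (e, e'))"
  have g: "gen (a, b) \<approx>\<^sub>2 ?R (gen (a, b))" for a b
  proof -
    have x: "(\<Sum>e\<in>E. ?r x e *s e) = x" "(\<Sum>e\<in>F. ?s x e *s e) = x" for x
      using sum_representation_eq[of E x E] sum_representation_eq[of F x F] E F by auto
    have "gen (a, b) \<approx>\<^sub>2 (\<Sum>e\<in>E. fscale (?r a e) (gen (e, b)))"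
      using teq2_gen_sum(1)[of "?r a" "\<lambda>e. e" E b] by (simp add: x)
    also have "\<dots> \<approx>\<^sub>2 (\<Sum>e\<in>E. fscale (?r a e) (\<Sum>e'\<in>F. fscale (?s b e') (gen (e, e'))))"
      using teq2_gen_sum(2)[of _ "?s b" "\<lambda>e. e" F] by (intro teq2_sum teq2_fscale) (simp add: x)
    also have "\<dots> = ?R (gen (a, b))" by (simp add: fs.scale_sum_right pair_simps)
    finally show ?thesis .
  qed
  have "lin_ext fscale gen u \<approx>\<^sub>2 lin_ext fscale (\<lambda>k. ?R (gen k)) u"
    unfolding lin_ext_def by (intro teq2_sum teq2_fscale) (use g in \<open>auto\<close>)
  also have "lin_ext fscale (\<lambda>k. ?R (gen k)) u = ?R (lin_ext fscale gen u)"
    unfolding lin_ext_def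
    apply (simp add: pair_sum fs.scale_sum_right fs.scale_sum_left pair_simps)
    apply (subst sum.swap, rule sum.cong, simp)
    apply (subst sum.swap, simp)
    done
  finally show ?thesis by (simp add: lin_ext_gen_id)
qed

text \<open>Coefficients with respect to a product basis are themselves values of
  \<open>pair\<close>, so these values separate tensors. From here on congruences of tensors are
  mostly checked on functionals.\<close>

lemma teq2_iff: "u \<approx>\<^sub>2 v \<longleftrightarrow> (\<forall>f g. lf f \<longrightarrow> lf g \<longrightarrow> pair f g u = pair f g v)"
proof (intro iffI allI impI)
  assume a: "\<forall>f g. lf f \<longrightarrow> lf g \<longrightarrow> pair f g u = pair f g v"
  obtain E where E: "finite E" "independent E" "span E = UNIV" "card E = dim UNIV"
    by (rule basis_of_subspace[OF subspace_UNIV])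
  note e = teq2_expand2[OF E(1-3) E(1-3)]
  have "pair (\<lambda>x. representation E x e) (\<lambda>x. representation E x e') u =
      pair (\<lambda>x. representation E x e) (\<lambda>x. representation E x e') v" for e e'
    using a lf_representation[OF E(2,3)] by blast
  then show "u \<approx>\<^sub>2 v" using e[of u] teq2_sym[OF e[of v]] by (simp add: teq2_trans)
qed (rule teq2_pair)

text \<open>This is \<open>A \<otimes> B = (A \<otimes> H) \<inter> (H \<otimes> B)\<close>, each
  membership being tested by functionals that vanish on \<open>A\<close> or on \<open>B\<close>. The
  coefficients outside the adapted bases are such tests.\<close>

lemma teq2_in_tensor_subspace:
  assumes A: "subspace A" and B: "subspace B"
    and "\<And>f g. lf f \<Longrightarrow> lf g \<Longrightarrow> (\<And>x. x \<in> A \<Longrightarrow> f x = 0) \<Longrightarrow> pair f g u = 0"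
    and "\<And>f g. lf f \<Longrightarrow> lf g \<Longrightarrow> (\<And>x. x \<in> B \<Longrightarrow> g x = 0) \<Longrightarrow> pair f g u = 0"
  obtains v where "Poly_Mapping.keys v \<subseteq> A \<times> B" "u \<approx>\<^sub>2 v"
proof -
  obtain A1 E where E: "A1 \<subseteq> E" "span A1 = A" "finite E" "independent E" "span E = UNIV"
    using adapted_basis[OF A] .
  obtain B1 F where F: "B1 \<subseteq> F" "span B1 = B" "finite F" "independent F" "span F = UNIV"
    using adapted_basis[OF B] .
  let ?c = "\<lambda>e e'. pair (\<lambda>x. representation E x e) (\<lambda>x. representation F x e') u"
  let ?v = "\<Sum>e\<in>E. \<Sum>e'\<in>F. fscale (?c e e') (gen (e, e'))"
  have lf: "lf (\<lambda>x. representation E x e)" "lf (\<lambda>x. representation F x e)" for e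
    by (simp_all add: lf_representation E F)
  have "fscale (?c e e') (gen (e, e')) \<in> {v. Poly_Mapping.keys v \<subseteq> A \<times> B}" for e e'
  proof (cases "e \<in> A1 \<and> e' \<in> B1")
    case True
    then have "e \<in> A" "e' \<in> B" using E(2) F(2) span_base by auto
    then show ?thesis using keys_fscale[of "?c e e'" "gen (e, e')"] by auto
  next
    case False
    then have "?c e e' = 0"
      using assms(3)[OF lf(1)[of e] lf(2)[of e']] assms(4)[OF lf(1)[of e] lf(2)[of e']]
        representation_outside[OF E(1,4)] representation_outside[OF F(1,4)] E(2) F(2) by blast
    then show ?thesis by simp
  qed
  then have "?v \<in> {v. Poly_Mapping.keys v \<subseteq> A \<times> B}"
    by (intro fs.subspace_sum subspace_keys)
  then show ?thesis using that teq2_expand2[OF E(3-5) F(3-5), of u] by blast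
qed

text \<open>
  In Sweedler notation, \<open>lact f x = x\<^sub>(\<^sub>1\<^sub>) f(x\<^sub>(\<^sub>2\<^sub>))\<close> and \<open>ract f x = f(x\<^sub>(\<^sub>1\<^sub>)) x\<^sub>(\<^sub>2\<^sub>)\<close>; these are actions of the dual
  algebra, whose product is \<open>conv\<close>. A subspace \<open>W\<close> is stable under \<open>lact\<close> iff \<open>\<Delta>(W) \<subseteq> W \<otimes> H\<close>.
\<close>

definition conv :: "('h \<Rightarrow> 'k) \<Rightarrow> ('h \<Rightarrow> 'k) \<Rightarrow> 'h \<Rightarrow> 'k"
  where "conv f g x = pair f g (\<Delta> x)"

definition lact :: "('h \<Rightarrow> 'k) \<Rightarrow> 'h \<Rightarrow> 'h"
  where "lact f x = lin_ext scale (\<lambda>(a, b). f b *s a) (\<Delta> x)"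

definition ract :: "('h \<Rightarrow> 'k) \<Rightarrow> 'h \<Rightarrow> 'h"
  where "ract f x = lin_ext scale (\<lambda>(a, b). f a *s b) (\<Delta> x)"

lemma lact_eq: "\<Delta> x \<approx>\<^sub>2 u \<Longrightarrow> lf f \<Longrightarrow> lact f x = lin_ext scale (\<lambda>(a, b). f b *s a) u"
  unfolding lact_def
  by (rule teq2_lin_ext[OF vector_space_scale]) (auto simp: lf_def algebra_simps)

lemma ract_eq: "\<Delta> x \<approx>\<^sub>2 u \<Longrightarrow> lf f \<Longrightarrow> ract f x = lin_ext scale (\<lambda>(a, b). f a *s b) u"
  unfolding ract_def
  by (rule teq2_lin_ext[OF vector_space_scale]) (auto simp: lf_def algebra_simps)

lemma conv_eq: "\<Delta> x \<approx>\<^sub>2 u \<Longrightarrow> lf f \<Longrightarrow> lf g \<Longrightarrow> conv f g x = pair f g u"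
  unfolding conv_def by (rule teq2_pair)

lemma lf_counit [simp]: "lf \<epsilon>"
  by (rule lfI) (auto simp: counit_add counit_scale)

lemma lf_conv [simp]: "lf f \<Longrightarrow> lf g \<Longrightarrow> lf (conv f g)"
  by (rule lfI) (auto simp: conv_def teq2_pair[OF comult_add] teq2_pair[OF comult_scale] pair_simps)

lemma lf_lact: "lf f \<Longrightarrow> lf g \<Longrightarrow> g (lact f x) = conv g f x"
  unfolding lact_def conv_def pair_def lf_lin_ext
  by (auto simp: lf_lin_ext lf_scale intro!: lin_ext_cong)

lemma lf_ract: "lf f \<Longrightarrow> lf g \<Longrightarrow> g (ract f x) = conv f g x"
  unfolding ract_def conv_def pair_def lf_lin_ext
  by (auto simp: lf_lin_ext lf_scale intro!: lin_ext_cong)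

lemma conv_counit [simp]: "lf f \<Longrightarrow> conv \<epsilon> f x = f x" "lf f \<Longrightarrow> conv f \<epsilon> x = f x"
  using lf_ract[of \<epsilon> f x] lf_lact[of \<epsilon> f x] counit_left[of x] counit_right[of x]
  by (simp_all add: ract_def lact_def)

lemma conv_counit_fun [simp]: "lf f \<Longrightarrow> conv \<epsilon> f = f" "lf f \<Longrightarrow> conv f \<epsilon> = f"
  by (auto simp: fun_eq_iff)

lemma conv_one [simp]: "lf f \<Longrightarrow> lf g \<Longrightarrow> conv f g 1 = f 1 * g 1"
  by (simp add: conv_eq[OF comult_one] pair_simps)

lemma conv_assoc:
  assumes "lf f" "lf g" "lf h"
  shows "conv (conv f g) h x = conv f (conv g h) x"
proof -
  let ?\<phi> = "\<lambda>(a, b, c). f a * (g b * h c)"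
  have "lin_ext (*) ?\<phi> (lin_ext fscale (\<lambda>(a, b). lin_ext fscale (\<lambda>(u, v). gen (u, v, b)) (\<Delta> a)) (\<Delta> x)) =
      lin_ext (*) ?\<phi> (lin_ext fscale (\<lambda>(a, b). lin_ext fscale (\<lambda>(u, v). gen (a, u, v)) (\<Delta> b)) (\<Delta> x))"
    using coassoc[of x] assms
    by (intro teq3_lin_ext[OF vector_space_times]) (auto simp: lf_def algebra_simps)
  then have "lin_ext (*) (\<lambda>(a, b). lin_ext (*) (\<lambda>(u, v). f u * (g v * h b)) (\<Delta> a)) (\<Delta> x) =
      lin_ext (*) (\<lambda>(a, b). lin_ext (*) (\<lambda>(u, v). f a * (g u * h v)) (\<Delta> b)) (\<Delta> x)"
    by (simp add: lin_ext_lin_ext vector_space_times case_prod_unfold)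
  then show ?thesis
    unfolding conv_def pair_def
    by (simp add: case_prod_unfold lin_ext_def sum_distrib_left sum_distrib_right mult_ac)
qed

lemma conv_lin:
  "conv (\<lambda>x. f x + f' x) g x = conv f g x + conv f' g x"
  "conv f (\<lambda>x. g x + g' x) x = conv f g x + conv f g' x"
  "conv (\<lambda>x. c * f x) g x = c * conv f g x" "conv f (\<lambda>x. c * g x) x = c * conv f g x"
  "conv (\<lambda>x. f x - f' x) g x = conv f g x - conv f' g x"
  "conv f (\<lambda>x. g x - g' x) x = conv f g x - conv f g' x"
  "conv (\<lambda>x. 0) g x = 0" "conv f (\<lambda>x. 0) x = 0"
  unfolding conv_def pair_def lin_ext_def
  by (auto simp: sum.distrib algebra_simps sum_distrib_left case_prod_unfold sum_subtractf)

lemma conv_sum: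
  "conv f (\<lambda>x. \<Sum>i\<in>I. g i x) x = (\<Sum>i\<in>I. conv f (g i) x)"
  by (induction I rule: infinite_finite_induct) (simp_all add: conv_lin)

lemma lact_add: "lf f \<Longrightarrow> lact f (x + y) = lact f x + lact f y"
  and lact_scale: "lf f \<Longrightarrow> lact f (c *s x) = c *s lact f x"
  and ract_add: "lf f \<Longrightarrow> ract f (x + y) = ract f x + ract f y"
  and ract_scale: "lf f \<Longrightarrow> ract f (c *s x) = c *s ract f x"
  by (rule lf_eqI; simp add: lf_add lf_scale lf_lact lf_ract lf_add[OF lf_conv] lf_scale[OF lf_conv])+

lemma lact_lact: "lf f \<Longrightarrow> lf g \<Longrightarrow> lact f (lact g x) = lact (conv f g) x"
  and ract_ract: "lf f \<Longrightarrow> lf g \<Longrightarrow> ract f (ract g x) = ract (conv g f) x"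
  and lact_ract: "lf f \<Longrightarrow> lf g \<Longrightarrow> lact f (ract g x) = ract g (lact f x)"
  by (rule lf_eqI; simp add: lf_lact lf_ract conv_assoc)+

lemma teq2_tmult:
  assumes "u \<approx>\<^sub>2 u'" "v \<approx>\<^sub>2 v'"
  shows "tmult u v \<approx>\<^sub>2 tmult u' v'"
proof -
  have "tmult u v \<approx>\<^sub>2 tmult u v'"
    unfolding teq2_iff by (auto simp: pair_tmult case_prod_unfold lf_mult intro!: lin_ext_cong teq2_pair[OF assms(2)])
  also have "\<dots> \<approx>\<^sub>2 tmult u' v'"
    unfolding teq2_iff by (auto simp: pair_tmult' case_prod_unfold lf_mult intro!: lin_ext_cong teq2_pair[OF assms(1)])
  finally show ?thesis .
qed

lemma comult_mult_eq: "\<Delta> x \<approx>\<^sub>2 u \<Longrightarrow> \<Delta> y \<approx>\<^sub>2 v \<Longrightarrow> \<Delta> (x * y) \<approx>\<^sub>2 tmult u v"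
  by (rule teq2_trans[OF comult_mult]) (rule teq2_tmult)

lemma conv_mult:
  assumes "\<Delta> x \<approx>\<^sub>2 u" "lf f" "lf g"
  shows "conv f g (x * y) = lin_ext (*) (\<lambda>(a, b). conv (\<lambda>z. f (a * z)) (\<lambda>z. g (b * z)) y) u"
  unfolding conv_eq[OF comult_mult_eq[OF assms(1) teq2_refl] assms(2,3)] pair_tmult
  by (simp only: conv_def)

lemma lact_mult:
  assumes "\<Delta> x \<approx>\<^sub>2 u" "lf f"
  shows "lact f (x * y) = lin_ext scale (\<lambda>(a, b). a * lact (\<lambda>z. f (b * z)) y) u"
proof (rule lf_eqI)
  fix g assume g: "lf g"
  have "g (a * lact (\<lambda>z. f (b * z)) y) = conv (\<lambda>z. g (a * z)) (\<lambda>z. f (b * z)) y" for a b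
    using lf_lact[OF lf_mult(1)[OF assms(2)] lf_mult(1)[OF g]] by simp
  then show "g (lact f (x * y)) = g (lin_ext scale (\<lambda>(a, b). a * lact (\<lambda>z. f (b * z)) y) u)"
    using assms g by (simp add: lf_lact conv_mult lf_lin_ext case_prod_unfold)
qed

subsection \<open>Subcoalgebras\<close>

definition right_coideal :: "'h set \<Rightarrow> bool"
  where "right_coideal W \<longleftrightarrow> subspace W \<and> (\<forall>f x. lf f \<longrightarrow> x \<in> W \<longrightarrow> lact f x \<in> W)"

definition left_coideal :: "'h set \<Rightarrow> bool"
  where "left_coideal W \<longleftrightarrow> subspace W \<and> (\<forall>f x. lf f \<longrightarrow> x \<in> W \<longrightarrow> ract f x \<in> W)"

text \<open>Stability under the two actions says
  \<open>\<Delta>(C) \<subseteq> C \<otimes> H\<close> and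
  \<open>\<Delta>(C) \<subseteq> H \<otimes> C\<close>, and the intersection is
  \<open>C \<otimes> C\<close>. This trades an existential over representatives for a closure
  property.\<close>

lemma subcoalgebra_iff: "subcoalgebra C \<longleftrightarrow> right_coideal C \<and> left_coideal C"
proof
  assume C: "subcoalgebra C"
  have "lact f x \<in> C \<and> ract f x \<in> C" if "lf f" "x \<in> C" for f x
  proof -
    obtain u where u: "Poly_Mapping.keys u \<subseteq> C \<times> C" "\<Delta> x \<approx>\<^sub>2 u" and sp: "subspace C"
      using C \<open>x \<in> C\<close> by (auto simp: subcoalgebra_def)
    then show ?thesis
      unfolding lact_eq[OF u(2) \<open>lf f\<close>] ract_eq[OF u(2) \<open>lf f\<close>]
      by (auto intro!: lin_ext_in_subspace subspace_scale)
  qed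
  then show "right_coideal C \<and> left_coideal C" using C by (auto simp: right_coideal_def left_coideal_def subcoalgebra_def)
next
  assume C: "right_coideal C \<and> left_coideal C"
  then have sp: "subspace C" by (simp add: right_coideal_def)
  have "\<exists>v. Poly_Mapping.keys v \<subseteq> C \<times> C \<and> \<Delta> x \<approx>\<^sub>2 v" if x: "x \<in> C" for x
  proof (rule teq2_in_tensor_subspace[OF sp sp, of "\<Delta> x"])
    fix f g assume fg: "lf f" "lf g"
    show "pair f g (\<Delta> x) = 0" if "\<And>x. x \<in> C \<Longrightarrow> f x = 0"
      using C x that[of "lact g x"] fg by (simp add: lf_lact right_coideal_def flip: conv_def)
    show "pair f g (\<Delta> x) = 0" if "\<And>x. x \<in> C \<Longrightarrow> g x = 0"
      using C x that[of "ract f x"] fg by (simp add: lf_ract left_coideal_def flip: conv_def)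
  qed auto
  then show "subcoalgebra C" using sp by (auto simp: subcoalgebra_def)
qed

text \<open>One factor at a time is moved into an action, which keeps \<open>x\<close> inside
  \<open>C\<close>; there the other factor may be exchanged.\<close>

lemma conv_cong_on:
  assumes "subcoalgebra C" "x \<in> C" "lf f" "lf f'" "lf g" "lf g'"
    and "\<And>y. y \<in> C \<Longrightarrow> f y = f' y" "\<And>y. y \<in> C \<Longrightarrow> g y = g' y"
  shows "conv f g x = conv f' g' x"
proof -
  have "conv f g x = f (lact g x)" by (simp add: lf_lact assms)
  also have "\<dots> = f' (lact g x)"
    using assms by (auto simp: subcoalgebra_iff right_coideal_def)
  also have "\<dots> = g (ract f' x)" by (simp add: lf_lact lf_ract assms)
  also have "\<dots> = g' (ract f' x)"
    using assms by (auto simp: subcoalgebra_iff left_coideal_def)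
  also have "\<dots> = conv f' g' x" by (simp add: lf_ract assms)
  finally show ?thesis .
qed

lemma lact_one: "lf f \<Longrightarrow> lact f 1 = f 1 *s 1"
  by (rule lf_eqI) (simp add: lf_lact lf_scale)

lemma ract_one: "lf f \<Longrightarrow> ract f 1 = f 1 *s 1"
  by (rule lf_eqI) (simp add: lf_ract lf_scale)

lemma primitive_iff:
  "x \<in> primitives \<longleftrightarrow> (\<forall>f g. lf f \<longrightarrow> lf g \<longrightarrow> conv f g x = f x * g 1 + f 1 * g x)"
  by (simp add: primitives_def teq2_iff conv_def pair_simps)

lemma counit_primitive: "x \<in> primitives \<Longrightarrow> \<epsilon> x = 0"
  unfolding primitive_iff using conv_counit(1)[OF lf_counit, of x]
  by (metis add_cancel_left_right counit_one lf_counit mult.right_neutral mult_1)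

lemma lact_primitive: "x \<in> primitives \<Longrightarrow> lf f \<Longrightarrow> lact f x = f 1 *s x + f x *s 1"
  by (rule lf_eqI) (simp add: lf_lact lf_scale lf_add primitive_iff algebra_simps)

lemma ract_primitive: "x \<in> primitives \<Longrightarrow> lf f \<Longrightarrow> ract f x = f 1 *s x + f x *s 1"
  by (rule lf_eqI) (simp add: lf_ract lf_scale lf_add primitive_iff algebra_simps)

lemma subspace_primitives: "subspace primitives"
  by (auto simp: subspace_def primitive_iff lf_zero lf_add lf_scale lf_add[OF lf_conv]
      lf_scale[OF lf_conv] lf_zero[OF lf_conv] algebra_simps)

text \<open>The two terms of \<open>\<Delta> x\<close> make \<open>f \<mapsto> f (x * _)\<close> a
  derivation of the convolution algebra. This is the Leibniz rule behind the later computations with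
  powers of functionals.\<close>

lemma conv_primitive_mult:
  assumes "x \<in> primitives" "lf f" "lf g"
  shows "conv f g (x * y) = conv (\<lambda>z. f (x * z)) g y + conv f (\<lambda>z. g (x * z)) y"
  using conv_mult[of x "gen (x, 1) + gen (1, x)" f g y] assms
  by (simp add: primitives_def lin_ext_add vector_space_times)

end

section \<open>Connectedness\<close>

context finite_dimensional_hopf_algebra
begin

text \<open>
  A simple subquotient of \<open>H\<close> under an action of the dual algebra is one-dimensional, provided that
  its annihilator lies in the augmentation ideal \<open>{f. f 1 = 0}\<close>: a maximal set \<open>J\<close> of basis vectors killed by
  some \<open>f\<^sub>0\<close> outside the augmentation ideal is proper, and applying \<open>f\<^sub>0\<close> to a further basis
  vector yields the required element. The action is kept abstract so that the lemma applies on both sides.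
\<close>

lemma trivial_subquotient:
  fixes act :: "('h \<Rightarrow> 'k) \<Rightarrow> 'h \<Rightarrow> 'h" and star
  assumes add: "\<And>f x y. lf f \<Longrightarrow> act f (x + y) = act f x + act f y"
    and scale: "\<And>f c x. lf f \<Longrightarrow> act f (c *s x) = c *s act f x"
    and add': "\<And>f g x. lf f \<Longrightarrow> lf g \<Longrightarrow> act (\<lambda>z. f z + g z) x = act f x + act g x"
    and scale': "\<And>f c x. lf f \<Longrightarrow> act (\<lambda>z. c * f z) x = c *s act f x"
    and comp: "\<And>f g x. lf f \<Longrightarrow> lf g \<Longrightarrow> act f (act g x) = act (star f g) x"
    and star: "\<And>f g. lf f \<Longrightarrow> lf g \<Longrightarrow> lf (star f g)"
    and star_one: "\<And>f g. lf f \<Longrightarrow> lf g \<Longrightarrow> star f g 1 = f 1 * g 1"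
    and counit: "\<And>x. act \<epsilon> x = x"
    and W0: "subspace W0" "\<And>f x. lf f \<Longrightarrow> x \<in> W0 \<Longrightarrow> act f x \<in> W0"
    and W: "subspace W" "\<And>f x. lf f \<Longrightarrow> x \<in> W \<Longrightarrow> act f x \<in> W"
    and "W0 \<subset> W"
    and ann: "\<And>V f. subspace V \<Longrightarrow> (\<And>f x. lf f \<Longrightarrow> x \<in> V \<Longrightarrow> act f x \<in> V) \<Longrightarrow> W0 \<subset> V \<Longrightarrow> V \<subseteq> W \<Longrightarrow>
      lf f \<Longrightarrow> (\<And>x. x \<in> V \<Longrightarrow> act f x \<in> W0) \<Longrightarrow> f 1 = 0"
  shows "\<exists>a\<in>W - W0. \<forall>f. lf f \<longrightarrow> act f a - f 1 *s a \<in> W0"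
proof -
  \<comment> \<open>A minimal \<open>V\<close> above \<open>W0\<close> makes \<open>V / W0\<close> a
    simple module of the dual algebra.\<close>
  define ok where "ok V \<longleftrightarrow> subspace V \<and> (\<forall>f x. lf f \<longrightarrow> x \<in> V \<longrightarrow> act f x \<in> V) \<and> W0 \<subset> V \<and> V \<subseteq> W" for V
  have "ok W" using W \<open>W0 \<subset> W\<close> by (auto simp: ok_def)
  from ex_has_least_nat[of ok, OF this, of dim]
  obtain V where V: "ok V" "\<And>V'. ok V' \<Longrightarrow> dim V \<le> dim V'" by blast
  have V': "subspace V" "\<And>f x. lf f \<Longrightarrow> x \<in> V \<Longrightarrow> act f x \<in> V" "W0 \<subset> V" "V \<subseteq> W"
    using V(1) by (auto simp: ok_def)
  have min: "V' = V" if "ok V'" "V' \<subseteq> V" for V'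
    using subspace_dim_equal[of V' V] V(2)[of V'] that V'(1) by (auto simp: ok_def)
  obtain E where E: "finite E" "independent E" "span E = V" "card E = dim V"
    by (rule basis_of_subspace[OF V'(1)])
  define good where "good J \<longleftrightarrow> J \<subseteq> E \<and> (\<exists>f. lf f \<and> f 1 = 1 \<and> (\<forall>x\<in>J. act f x \<in> W0))" for J
  have "good {}" unfolding good_def using counit_one lf_counit by blast
  moreover have "\<forall>J. good J \<longrightarrow> card J < Suc (card E)"
    using E(1) by (auto simp: good_def less_Suc_eq_le intro: card_mono)
  ultimately obtain J where J: "good J" "\<And>J'. good J' \<Longrightarrow> card J' \<le> card J"
    using ex_has_greatest_nat[of good "{}" card "Suc (card E)"] by blast
  obtain f0 where f0: "lf f0" "f0 1 = 1" "\<And>x. x \<in> J \<Longrightarrow> act f0 x \<in> W0" and "J \<subseteq> E"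
    using J(1) by (auto simp: good_def)
  have zero: "act f 0 = 0" if "lf f" for f using scale[OF that, of 0 0] by simp
  have sub: "subspace {x. act f x \<in> W0}" if "lf f" for f
    using W0(1) by (auto simp: subspace_def add scale zero that)
  \<comment> \<open>Otherwise \<open>f0\<close> annihilates \<open>V / W0\<close> although
    \<open>f0 1 = 1\<close>, against \<open>ann\<close>.\<close>
  have "J \<noteq> E"
  proof
    assume "J = E"
    then have "act f0 x \<in> W0" if "x \<in> V" for x
      using span_minimal[OF _ sub[OF f0(1)], of E] f0(3) E(3) that by auto
    from ann[OF V' f0(1) this] f0(2) show False by simp
  qed
  then obtain v where v: "v \<in> E" "v \<notin> J" using \<open>J \<subseteq> E\<close> by auto
  have star0: "f 1 = 0" if "lf f" "\<And>x. x \<in> J \<Longrightarrow> act f x \<in> W0" "act f v \<in> W0" for f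
  proof (rule ccontr)
    assume f1: "f 1 \<noteq> 0"
    have "good (insert v J)" unfolding good_def
      using v(1) \<open>J \<subseteq> E\<close> that W0(1) f1
      by (auto intro!: exI[of _ "\<lambda>x. inverse (f 1) * f x"] simp: lf_lin scale' subspace_scale)
    from J(2)[OF this] show False using v finite_subset[OF \<open>J \<subseteq> E\<close> E(1)] by simp
  qed
  define I where "I = {f. lf f \<and> (\<forall>x\<in>J. act f x \<in> W0)}"
  have I_star: "star h f \<in> I" if "f \<in> I" "lf h" for f h
    using that W0(2) star by (auto simp: I_def simp flip: comp)
  \<comment> \<open>\<open>I\<close> is the left ideal of functionals killing \<open>J\<close>
    modulo \<open>W0\<close>, and \<open>Z\<close> is its augmentation part applied to
    \<open>v\<close>, plus \<open>W0\<close>. By minimality \<open>Z\<close> is \<open>W0\<close> or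
    \<open>V\<close>.\<close>
  define Z where "Z = {act f v + w | f w. f \<in> I \<and> f 1 = 0 \<and> w \<in> W0}"
  have vV: "v \<in> V" using v(1) E(3) span_base by auto
  have Z_W0: "act f v \<in> W0" if "f \<in> I" "f 1 = 0" for f
  proof (rule ccontr)
    assume n: "act f v \<notin> W0"
    have Z_sub: "subspace Z"
    proof (rule subspaceI)
      have "(\<lambda>x. 0) \<in> I" using W0(1) scale'[of "\<lambda>x. 0" 0] by (auto simp: I_def lf_lin subspace_0)
      then show "0 \<in> Z" using W0(1) scale'[of "\<lambda>x. 0" 0]
        by (auto simp: Z_def lf_lin subspace_0 intro!: exI[of _ "\<lambda>x. 0"] exI[of _ 0])
    next
      fix x y assume "x \<in> Z" "y \<in> Z"
      then obtain f g w w' where "x = act f v + w" "y = act g v + w'" "f \<in> I" "g \<in> I" "f 1 = 0" "g 1 = 0" "w \<in> W0" "w' \<in> W0"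
        by (auto simp: Z_def)
      then show "x + y \<in> Z" using W0(1)
        by (auto simp: Z_def I_def lf_lin add' subspace_add intro!: exI[of _ "\<lambda>x. f x + g x"] exI[of _ "w + w'"])
    next
      fix c x assume "x \<in> Z"
      then obtain f w where "x = act f v + w" "f \<in> I" "f 1 = 0" "w \<in> W0"
        by (auto simp: Z_def)
      then show "c *s x \<in> Z" using W0(1)
        by (auto simp: Z_def I_def lf_lin scale' scale_right_distrib subspace_scale intro!: exI[of _ "\<lambda>x. c * f x"] exI[of _ "c *s w"])
    qed
    have "act h x \<in> Z" if h: "lf h" and "x \<in> Z" for h x
    proof -
      obtain f w where fw: "x = act f v + w" "f \<in> I" "f 1 = 0" "w \<in> W0"
        using \<open>x \<in> Z\<close> by (auto simp: Z_def)
      then have "act h x = act (star h f) v + act h w" using h by (simp add: I_def add comp)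
      moreover have "star h f \<in> I" "star h f 1 = 0" "act h w \<in> W0"
        using fw h I_star W0(2) star_one[OF h, of f] by (auto simp: I_def)
      ultimately show ?thesis by (auto simp: Z_def)
    qed
    moreover have z: "act f v + w \<in> Z" if "f \<in> I" "f 1 = 0" "w \<in> W0" for f w
      using that by (auto simp: Z_def)
    have "(\<lambda>x. 0) \<in> I" using W0(1) scale'[of "\<lambda>x. 0" 0] by (auto simp: I_def lf_lin subspace_0)
    then have "W0 \<subseteq> Z" using z[of "\<lambda>x. 0"] scale'[of "\<lambda>x. 0" 0] by (auto simp: lf_lin)
    moreover have "act f v \<in> Z" using z[OF \<open>f \<in> I\<close> \<open>f 1 = 0\<close>, of 0] W0(1) by (simp add: subspace_0)
    moreover have "Z \<subseteq> V" using vV V' subspace_add[OF V'(1)] by (auto simp: Z_def I_def)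
    ultimately have "ok Z" using Z_sub n V'(4) by (auto simp: ok_def)
    then have "Z = V" using min \<open>Z \<subseteq> V\<close> by blast
    \<comment> \<open>With \<open>Z = V\<close>, some \<open>g\<close> in the augmentation part
      agrees with \<open>f0\<close> on \<open>v\<close> modulo \<open>W0\<close>. Then
      \<open>f0 - g\<close> kills \<open>J\<close> and \<open>v\<close> but has value
      \<open>1\<close> at \<open>1\<close>, against the maximality of \<open>J\<close>.\<close>
    then have "act f0 v \<in> Z" using V'(2)[OF f0(1) vV] by simp
    then obtain g w where g: "act f0 v = act g v + w" "g \<in> I" "g 1 = 0" "w \<in> W0" by (auto simp: Z_def)
    let ?h = "\<lambda>x. f0 x + (-1) * g x"
    have lg: "lf g" using g(2) by (simp add: I_def)
    have h: "lf ?h" "\<And>x. act ?h x = act f0 x - act g x"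
      using f0(1) lg add'[OF f0(1) lf_lin(2)[OF lg, of "-1"]] scale'[OF lg, of "-1"] lf_lin(1)[OF f0(1) lf_lin(2)[OF lg, of "-1"]]
      by simp_all
    have "?h 1 = 0"
    proof (rule star0[OF h(1)])
      show "act ?h x \<in> W0" if "x \<in> J" for x
        unfolding h(2) using f0(3)[OF that] g(2) that W0(1) by (auto simp: I_def subspace_diff)
      show "act ?h v \<in> W0" unfolding h(2) g(1) using g(4) by simp
    qed
    then show False using f0(2) g(3) by simp
  qed
  have "f0 \<in> I" using f0 by (auto simp: I_def)
  have "act f0 v \<notin> W0" using star0[OF f0(1,3)] f0(2) by auto
  moreover have "act f0 v \<in> W" using V' vV f0(1) by blast
  \<comment> \<open>\<open>star f f0\<close> minus \<open>f 1\<close> times \<open>f0\<close> lies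
    in the augmentation part of \<open>I\<close>, so \<open>Z_W0\<close> applies.\<close>
  moreover have "act f (act f0 v) - f 1 *s act f0 v \<in> W0" if f: "lf f" for f
  proof -
    let ?h = "\<lambda>x. star f f0 x + (- f 1) * f0 x"
    have h: "lf ?h" "\<And>x. act ?h x = act f (act f0 x) - f 1 *s act f0 x"
      using add'[OF star[OF f f0(1)] lf_lin(2)[OF f0(1), of "- f 1"]] scale'[OF f0(1), of "- f 1"]
        lf_lin(1)[OF star[OF f f0(1)] lf_lin(2)[OF f0(1), of "- f 1"]]
      by (simp_all add: comp[OF f f0(1)])
    have "?h \<in> I" using h f0 W0 f by (auto simp: I_def subspace_diff subspace_scale)
    moreover have "?h 1 = 0" using star_one[OF f f0(1)] f0(2) by simp
    ultimately show ?thesis using Z_W0 by (metis h(2))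
  qed
  ultimately show ?thesis by blast
qed

lemma subcoalgebra_span:
  assumes "\<And>f x. lf f \<Longrightarrow> x \<in> X \<Longrightarrow> lact f x \<in> span X" "\<And>f x. lf f \<Longrightarrow> x \<in> X \<Longrightarrow> ract f x \<in> span X"
  shows "subcoalgebra (span X)"
proof -
  have "lact f x \<in> span X" if f: "lf f" and x: "x \<in> span X" for f x
    using x
  proof (induction rule: span_induct_alt)
    case base show ?case using lact_scale[OF f, of 0 0] by (simp add: span_zero)
  next
    case (step c y z)
    then show ?case using assms(1)[OF f] by (simp add: lact_add lact_scale f span_add span_scale)
  qed
  moreover have "ract f x \<in> span X" if f: "lf f" and x: "x \<in> span X" for f x
    using x
  proof (induction rule: span_induct_alt)
    case base show ?case using ract_scale[OF f, of 0 0] by (simp add: span_zero)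
  next
    case (step c y z)
    then show ?case using assms(2)[OF f] by (simp add: ract_add ract_scale f span_add span_scale)
  qed
  ultimately show ?thesis by (simp add: subcoalgebra_iff right_coideal_def left_coideal_def)
qed

lemma subcoalgebra_span_one: "subcoalgebra (span {1})"
proof -
  have "lact f x \<in> span {1} \<and> ract f x \<in> span {1}" if "lf f" "x \<in> span {1}" for f x
    using that by (auto simp: span_singleton lact_scale ract_scale lact_one ract_one)
  then show ?thesis by (simp add: subcoalgebra_iff right_coideal_def left_coideal_def)
qed

lemma lact_lin: "lact (\<lambda>z. f z + g z) x = lact f x + lact g x" "lact (\<lambda>z. c * f z) x = c *s lact f x"
  and ract_lin: "ract (\<lambda>z. f z + g z) x = ract f x + ract g x" "ract (\<lambda>z. c * f z) x = c *s ract f x"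
  unfolding lact_def ract_def
  by (simp_all add: lin_ext_def case_prod_unfold algebra_simps sum.distrib scale_sum_right)

lemma lact_counit [simp]: "lact \<epsilon> x = x" and ract_counit [simp]: "ract \<epsilon> x = x"
  by (simp_all add: lact_def ract_def counit_left counit_right)

end

locale connected_hopf_algebra = finite_dimensional_hopf_algebra +
  assumes is_connected: connected
begin

text \<open>The line spanned by \<open>1\<close> is a simple subcoalgebra, so by connectedness it is
  the whole coradical. A minimal nonzero subcoalgebra of \<open>C\<close> is simple and hence equal
  to that line.\<close>

lemma one_in_subcoalgebra:
  assumes C: "subcoalgebra C" "C \<noteq> {0}"
  shows "1 \<in> C"
proof -
  have one: "1 \<in> D" if "subspace D" "d \<in> D" "d \<noteq> 0" "d \<in> span {1}" for D d
  proof -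
    obtain c where c: "d = c *s 1" using \<open>d \<in> span {1}\<close> by (auto simp: span_singleton)
    then have "c \<noteq> 0" using \<open>d \<noteq> 0\<close> by auto
    then have "1 = inverse c *s d" by (simp add: c)
    then show "1 \<in> D" using that(1,2) subspace_scale by metis
  qed
  have "simple_subcoalgebra (span {1})"
    unfolding simple_subcoalgebra_def
  proof (intro conjI allI impI)
    show "span {1} \<noteq> {0::'b}" using span_base[of "1::'b" "{1}"] by auto
    fix D assume D: "subcoalgebra D \<and> D \<subseteq> span {1}"
    then have D': "subspace D" "0 \<in> D" by (auto simp: subcoalgebra_def subspace_0)
    show "D = {0} \<or> D = span {1}"
    proof (cases "D = {0}")
      case False
      then obtain d where "d \<in> D" "d \<noteq> 0" using D'(2) by auto
      then have "1 \<in> D" using one D D'(1) by blast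
      then show ?thesis using D D'(1) span_minimal[of "{1}" D] by auto
    qed simp
  qed (rule subcoalgebra_span_one)
  then have 1: "span {1} \<subseteq> coradical"
    unfolding coradical_def by (metis (mono_tags, lifting) Sup_upper mem_Collect_eq span_superset subset_trans)
  have "dim (span {1}) = dim coradical"
    using is_connected by (simp add: connected_def)
  then have cor: "coradical = span {1}"
    using subspace_dim_equal[OF subspace_span _ 1] by (simp add: coradical_def)
  let ?P = "\<lambda>D. subcoalgebra D \<and> D \<noteq> {0} \<and> D \<subseteq> C"
  have "?P C" using C by simp
  from ex_has_least_nat[of ?P, OF this, of dim]
  obtain D where D: "?P D" "\<And>D'. ?P D' \<Longrightarrow> dim D \<le> dim D'" by blast
  have "simple_subcoalgebra D"
    unfolding simple_subcoalgebra_def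
  proof (intro conjI allI impI)
    fix D' assume D': "subcoalgebra D' \<and> D' \<subseteq> D"
    show "D' = {0} \<or> D' = D"
    proof (cases "D' = {0}")
      case False
      then have "?P D'" using D' D(1) by auto
      then show ?thesis
        using subspace_dim_equal[of D' D] D(1) D(2)[of D'] D' by (simp add: subcoalgebra_def)
    qed simp
  qed (use D in auto)
  then have "D \<subseteq> coradical"
    unfolding coradical_def by (metis (mono_tags, lifting) Sup_upper mem_Collect_eq span_superset subset_trans)
  moreover obtain d where "d \<in> D" "d \<noteq> 0"
    using D(1) by (metis empty_iff is_singletonI is_singletonI' is_singleton_the_elem singletonI subcoalgebra_def subspace_0)
  ultimately have "1 \<in> D" using one[of D d] D(1) cor by (auto simp: subcoalgebra_def)
  then show ?thesis using D(1) by auto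
qed

text \<open>\<open>trivial_subquotient\<close> asks that functionals annihilating
  \<open>V / W0\<close> vanish at \<open>1\<close>. They vanish on the matrix coefficients of this
  subquotient, whose span is a nonzero subcoalgebra and therefore contains \<open>1\<close>.\<close>

lemma right_coideal_extension:
  assumes W0: "right_coideal W0" and W: "right_coideal W" and "W0 \<subset> W"
  shows "\<exists>a\<in>W - W0. \<forall>f. lf f \<longrightarrow> lact f a - f 1 *s a \<in> W0"
proof (rule trivial_subquotient[where star = conv])
  fix V f assume V: "subspace V" "\<And>f x. lf f \<Longrightarrow> x \<in> V \<Longrightarrow> lact f x \<in> V" "W0 \<subset> V" "V \<subseteq> W"
    and f: "lf f" "\<And>x. x \<in> V \<Longrightarrow> lact f x \<in> W0"
  \<comment> \<open>Matrix coefficients: \<open>g\<close> is a functional on \<open>V / W0\<close>,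
    and the value of \<open>f\<close> at the coefficient is \<open>g (lact f x)\<close>.\<close>
  define X where "X = {ract g x | g x. lf g \<and> (\<forall>w\<in>W0. g w = 0) \<and> x \<in> V}"
  have "subcoalgebra (span X)"
  proof (rule subcoalgebra_span)
    fix h y assume h: "lf h" and "y \<in> X"
    then obtain g x where g: "y = ract g x" "lf g" "\<forall>w\<in>W0. g w = 0" "x \<in> V" by (auto simp: X_def)
    have "lact h y = ract g (lact h x)" using g h by (simp add: lact_ract)
    then have "lact h y \<in> X" unfolding X_def using g V(2)[OF h g(4)] by blast
    then show "lact h y \<in> span X" by (rule span_base)
    have "conv g h w = 0" if "w \<in> W0" for w
      using W0 g(3) that h by (auto simp: right_coideal_def simp flip: lf_lact[OF h g(2)])
    moreover have "ract h y = ract (conv g h) x" using h g by (simp add: ract_ract)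
    ultimately have "ract h y \<in> X" unfolding X_def using h g lf_conv[OF g(2) h] by blast
    then show "ract h y \<in> span X" by (rule span_base)
  qed
  moreover obtain x where x: "x \<in> V" "x \<notin> W0" using V(3) by auto
  moreover obtain g where g: "lf g" "\<forall>w\<in>W0. g w = 0" "g x = 1"
    using lf_separate[OF _ x(2)] W0 by (auto simp: right_coideal_def)
  then have "\<epsilon> (ract g x) = 1" by (simp add: lf_ract)
  then have "ract g x \<noteq> 0" using lf_zero[OF lf_counit] by auto
  moreover have "ract g x \<in> X" using g x by (auto simp: X_def)
  ultimately have "1 \<in> span X" by (intro one_in_subcoalgebra) (auto dest: span_base)
  moreover have "f y = 0" if "y \<in> X" for y
    using that f by (auto simp: X_def lf_ract simp flip: lf_lact)
  ultimately show "f 1 = 0"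
    using linear_zero_on_span[of scale "(*)" f X 1] f(1) by (simp add: lf_linear)
qed (use assms in \<open>auto simp: lact_add lact_scale lact_lin lact_lact right_coideal_def\<close>)

lemma left_coideal_extension:
  assumes W0: "left_coideal W0" and W: "left_coideal W" and "W0 \<subset> W"
  shows "\<exists>a\<in>W - W0. \<forall>f. lf f \<longrightarrow> ract f a - f 1 *s a \<in> W0"
proof (rule trivial_subquotient[where star = "\<lambda>f g. conv g f"])
  fix V f assume V: "subspace V" "\<And>f x. lf f \<Longrightarrow> x \<in> V \<Longrightarrow> ract f x \<in> V" "W0 \<subset> V" "V \<subseteq> W"
    and f: "lf f" "\<And>x. x \<in> V \<Longrightarrow> ract f x \<in> W0"
  define X where "X = {lact g x | g x. lf g \<and> (\<forall>w\<in>W0. g w = 0) \<and> x \<in> V}"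
  have "subcoalgebra (span X)"
  proof (rule subcoalgebra_span)
    fix h y assume h: "lf h" and "y \<in> X"
    then obtain g x where g: "y = lact g x" "lf g" "\<forall>w\<in>W0. g w = 0" "x \<in> V" by (auto simp: X_def)
    have "ract h y = lact g (ract h x)" using g h by (simp add: lact_ract)
    then have "ract h y \<in> X" unfolding X_def using g V(2)[OF h g(4)] by blast
    then show "ract h y \<in> span X" by (rule span_base)
    have "conv h g w = 0" if "w \<in> W0" for w
      using W0 g(3) that h by (auto simp: left_coideal_def simp flip: lf_ract[OF h g(2)])
    moreover have "lact h y = lact (conv h g) x" using h g by (simp add: lact_lact)
    ultimately have "lact h y \<in> X" unfolding X_def using h g lf_conv[OF h g(2)] by blast
    then show "lact h y \<in> span X" by (rule span_base)
  qed
  moreover obtain x where x: "x \<in> V" "x \<notin> W0" using V(3) by auto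
  moreover obtain g where g: "lf g" "\<forall>w\<in>W0. g w = 0" "g x = 1"
    using lf_separate[OF _ x(2)] W0 by (auto simp: left_coideal_def)
  then have "\<epsilon> (lact g x) = 1" by (simp add: lf_lact)
  then have "lact g x \<noteq> 0" using lf_zero[OF lf_counit] by auto
  moreover have "lact g x \<in> X" using g x by (auto simp: X_def)
  ultimately have "1 \<in> span X" by (intro one_in_subcoalgebra) (auto dest: span_base)
  moreover have "f y = 0" if "y \<in> X" for y
    using that f by (auto simp: X_def lf_lact simp flip: lf_ract)
  ultimately show "f 1 = 0"
    using linear_zero_on_span[of scale "(*)" f X 1] f(1) by (simp add: lf_linear)
qed (use assms in \<open>auto simp: ract_add ract_scale ract_lin ract_ract left_coideal_def\<close>)

text \<open>A step of the coradical filtration above \<open>B\<close>.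
  \<open>left_coideal_extension\<close> is applied inside \<open>A1\<close>, whose elements are
  already trivial modulo \<open>B\<close> under \<open>lact\<close>; so \<open>a\<close> is trivial
  on both sides, and the rest of \<open>\<Delta> a\<close> lies in
  \<open>(B \<otimes> H) \<inter> (H \<otimes> B)\<close>.\<close>

lemma subcoalgebra_extension:
  assumes B: "subcoalgebra B" "1 \<in> B" and A: "subcoalgebra A" and "B \<subset> A"
  obtains a v where "a \<in> A" "a \<notin> B" "Poly_Mapping.keys v \<subseteq> B \<times> B" "\<Delta> a \<approx>\<^sub>2 gen (a, 1) + gen (1, a) + v"
proof -
  have B': "subspace B" "right_coideal B" "left_coideal B" using B(1) by (auto simp: subcoalgebra_iff right_coideal_def)
  have A': "subspace A" "right_coideal A" "left_coideal A" using A by (auto simp: subcoalgebra_iff right_coideal_def)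
  define A1 where "A1 = {a\<in>A. \<forall>f. lf f \<longrightarrow> lact f a - f 1 *s a \<in> B}"
  have eq: "lact f (ract g a) - f 1 *s ract g a = ract g (lact f a - f 1 *s a)" if "lf f" "lf g" for f g a
    using ract_add[OF that(2), of "lact f a" "- f 1 *s a"] ract_scale[OF that(2), of "- f 1" a] that
    by (simp add: lact_ract)
  have "left_coideal A1" unfolding left_coideal_def
  proof (intro conjI allI impI)
    have "lact f (x + y) - f 1 *s (x + y) = (lact f x - f 1 *s x) + (lact f y - f 1 *s y)"
      "lact f (c *s x) - f 1 *s (c *s x) = c *s (lact f x - f 1 *s x)" "lact f 0 = 0" if "lf f" for f x y c
      using that lact_scale[OF that, of 0 0]
      by (auto simp: lact_add lact_scale scale_right_distrib scale_right_diff_distrib mult.commute)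
    then show "subspace A1" unfolding A1_def subspace_def using A'(1) B'(1)
      by (auto simp: subspace_0 subspace_add subspace_scale)
    show "ract g x \<in> A1" if "lf g" "x \<in> A1" for g x
      using that A'(3) B'(3) by (auto simp: A1_def eq left_coideal_def)
  qed
  moreover have "B \<subseteq> A1" using B'(2) \<open>B \<subset> A\<close>
    by (auto simp: A1_def right_coideal_def subspace_diff subspace_scale)
  moreover have "B \<noteq> A1" using right_coideal_extension[OF B'(2) A'(2) \<open>B \<subset> A\<close>] by (auto simp: A1_def)
  ultimately obtain a where a: "a \<in> A1" "a \<notin> B" "\<And>f. lf f \<Longrightarrow> ract f a - f 1 *s a \<in> B"
    using left_coideal_extension[OF B'(3), of A1] by blast
  have a2: "lact f a - f 1 *s a \<in> B" if "lf f" for f using a(1) that by (auto simp: A1_def)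
  obtain v where v: "Poly_Mapping.keys v \<subseteq> B \<times> B" "\<Delta> a - (gen (a, 1) + gen (1, a)) \<approx>\<^sub>2 v"
  proof (rule teq2_in_tensor_subspace[OF B'(1) B'(1)])
    fix f g assume fg: "lf f" "lf g"
    have p: "pair f g (\<Delta> a - (gen (a, 1) + gen (1, a))) = conv f g a - f a * g 1 - f 1 * g a"
      by (simp add: pair_simps conv_def)
    show "pair f g (\<Delta> a - (gen (a, 1) + gen (1, a))) = 0" if z: "\<And>x. x \<in> B \<Longrightarrow> f x = 0"
      using z[OF a2[OF fg(2)]] z[OF B(2)] fg by (simp add: p lf_diff lf_lact lf_scale mult.commute)
    show "pair f g (\<Delta> a - (gen (a, 1) + gen (1, a))) = 0" if z: "\<And>x. x \<in> B \<Longrightarrow> g x = 0"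
      using z[OF a(3)[OF fg(1)]] z[OF B(2)] fg by (simp add: p lf_diff lf_ract lf_scale)
  qed
  have "\<Delta> a \<approx>\<^sub>2 gen (a, 1) + gen (1, a) + v"
    using teq2_add[OF v(2) teq2_refl[of "gen (a, 1) + gen (1, a)"]] by (simp add: add.commute)
  then show thesis using that a v(1) by (auto simp: A1_def)
qed

end

section \<open>Sub-bialgebras\<close>

context k_algebra
begin

definition alg :: "'h set \<Rightarrow> 'h set"
  where "alg X = span {prod_list xs | xs. set xs \<subseteq> X}"

lemma alg_superset: "X \<subseteq> alg X"
proof
  fix x assume "x \<in> X"
  then show "x \<in> alg X" unfolding alg_def
    by (intro span_base) (auto intro!: exI[of _ "[x]"])
qed

lemma subalgebra_alg: "subalgebra (alg X)"
proof -
  let ?P = "{prod_list xs | xs. set xs \<subseteq> X}"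
  have 1: "1 \<in> alg X" unfolding alg_def by (rule span_base) (auto intro!: exI[of _ "[]"])
  have *: "x * y \<in> alg X" if x: "x \<in> ?P" and y: "y \<in> alg X" for x y
    using y[unfolded alg_def]
  proof (induction rule: span_induct_alt)
    case base show ?case by (simp add: alg_def span_zero)
  next
    case (step c y z)
    obtain xs ys where "x = prod_list xs" "y = prod_list ys" "set xs \<subseteq> X" "set ys \<subseteq> X"
      using x step(1) by auto
    then have "x * y \<in> ?P" by (auto intro!: exI[of _ "xs @ ys"])
    from span_add[OF span_scale[OF span_base[OF this]] step(2)[unfolded alg_def]]
    show ?case by (simp add: alg_def distrib_left scale_mult_right)
  qed
  have "x * y \<in> alg X" if "x \<in> alg X" "y \<in> alg X" for x y
    using that(1)[unfolded alg_def]
  proof (induction rule: span_induct_alt)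
    case base show ?case by (simp add: alg_def span_zero)
  next
    case (step c x z)
    then show ?case using *[OF step(1) that(2)]
      by (auto simp: alg_def distrib_right scale_mult_left intro!: span_add span_scale)
  qed
  then show ?thesis using 1 by (simp add: subalgebra_def alg_def subspace_span)
qed

lemma alg_minimal:
  assumes "subalgebra A" "X \<subseteq> A"
  shows "alg X \<subseteq> A"
proof -
  have "prod_list xs \<in> A" if "set xs \<subseteq> X" for xs
    using that assms by (induction xs) (auto simp: subalgebra_def)
  then show ?thesis unfolding alg_def
    using assms(1) by (intro span_minimal) (auto simp: subalgebra_def)
qed

lemma subalgebra_centralizer: "subalgebra {z. \<forall>y\<in>Y. z * y = y * z}"
  unfolding subalgebra_def subspace_def
proof (intro conjI ballI allI; clarify)
  fix x z y assume "\<forall>y\<in>Y. x * y = y * x" "\<forall>y\<in>Y. z * y = y * z" "y \<in> Y"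
  then have "x * y = y * x" "z * y = y * z" by auto
  then show "x * z * y = y * (x * z)" "(x + z) * y = y * (x + z)"
    by (metis mult.assoc, simp add: distrib_left distrib_right)
qed (simp_all add: scale_mult_left scale_mult_right)

text \<open>A centralizer is a subalgebra; using this twice passes from generators to the algebras
  on both sides.\<close>

lemma alg_commute:
  assumes "\<And>x y. x \<in> X \<Longrightarrow> y \<in> Y \<Longrightarrow> x * y = y * x" "x \<in> alg X" "y \<in> alg Y"
  shows "x * y = y * x"
proof -
  have "alg X \<subseteq> {z. \<forall>y\<in>Y. z * y = y * z}"
    by (rule alg_minimal[OF subalgebra_centralizer]) (use assms(1) in auto)
  then have "Y \<subseteq> {z. \<forall>y\<in>alg X. z * y = y * z}" by auto
  then have "alg Y \<subseteq> {z. \<forall>y\<in>alg X. z * y = y * z}"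
    by (rule alg_minimal[OF subalgebra_centralizer])
  then show ?thesis using assms(2,3) by auto
qed

lemma lin_ext_tmult:
  "vector_space s \<Longrightarrow> lin_ext s \<phi> (tmult u v) =
    lin_ext s (\<lambda>(a, b). lin_ext s (\<lambda>(c, d). \<phi> (a * c, b * d)) v) u"
  unfolding tmult_def by (simp add: lin_ext_lin_ext case_prod_unfold)

lemma tmult_add: "tmult (u + u') v = tmult u v + tmult u' v" "tmult u (v + v') = tmult u v + tmult u v'"
  unfolding tmult_def
  by (simp_all add: lin_ext_add vector_space_fscale case_prod_unfold lin_ext_add_right)

lemma tmult_gen: "tmult (gen (a, b)) (gen (c, d)) = gen (a * c, b * d)"
  by (simp add: tmult_def vector_space_fscale)

lemma tmult_commute:
  assumes "Poly_Mapping.keys u \<subseteq> A \<times> B" "Poly_Mapping.keys v \<subseteq> C \<times> D"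
    "\<And>a c. a \<in> A \<Longrightarrow> c \<in> C \<Longrightarrow> a * c = c * a" "\<And>b d. b \<in> B \<Longrightarrow> d \<in> D \<Longrightarrow> b * d = d * b"
  shows "tmult u v = tmult v u"
proof -
  have "tmult u v = (\<Sum>k\<in>Poly_Mapping.keys u. \<Sum>l\<in>Poly_Mapping.keys v.
      fscale (Poly_Mapping.lookup u k) (fscale (Poly_Mapping.lookup v l) (gen (fst k * fst l, snd k * snd l))))"
    by (simp add: tmult_def lin_ext_def case_prod_unfold fs.scale_sum_right)
  also have "\<dots> = (\<Sum>k\<in>Poly_Mapping.keys u. \<Sum>l\<in>Poly_Mapping.keys v.
      fscale (Poly_Mapping.lookup v l) (fscale (Poly_Mapping.lookup u k) (gen (fst l * fst k, snd l * snd k))))"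
  proof (intro sum.cong refl)
    fix k l assume "k \<in> Poly_Mapping.keys u" "l \<in> Poly_Mapping.keys v"
    then have "k \<in> A \<times> B" "l \<in> C \<times> D" using assms(1,2) by auto
    then show "fscale (Poly_Mapping.lookup u k) (fscale (Poly_Mapping.lookup v l) (gen (fst k * fst l, snd k * snd l))) =
      fscale (Poly_Mapping.lookup v l) (fscale (Poly_Mapping.lookup u k) (gen (fst l * fst k, snd l * snd k)))"
      using assms(3)[of "fst k" "fst l"] assms(4)[of "snd k" "snd l"]
      by (auto simp: mult.commute)
  qed
  also have "\<dots> = (\<Sum>l\<in>Poly_Mapping.keys v. \<Sum>k\<in>Poly_Mapping.keys u.
      fscale (Poly_Mapping.lookup v l) (fscale (Poly_Mapping.lookup u k) (gen (fst l * fst k, snd l * snd k))))"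
    by (rule sum.swap)
  also have "\<dots> = tmult v u"
    by (simp add: tmult_def lin_ext_def case_prod_unfold fs.scale_sum_right)
  finally show ?thesis .
qed

end

section \<open>Generated sub-bialgebras and commutators of nearly primitive elements\<close>

context finite_dimensional_hopf_algebra
begin

text \<open>Finite dimension in place of Zorn's lemma: largest dimension implies maximality.\<close>

lemma ex_maximal_subspace:
  assumes "P W" "\<And>M. P M \<Longrightarrow> subspace M"
  obtains M where "P M" "\<And>M'. P M' \<Longrightarrow> M \<subseteq> M' \<Longrightarrow> M' = M"
proof -
  have "\<exists>M. P M \<and> (\<forall>M'. P M' \<longrightarrow> dim M' \<le> dim M)"
    using assms(1) dim_subset_UNIV
    by (intro ex_has_greatest_nat[of P W dim "Suc dimension"]) (auto simp: less_Suc_eq_le)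
  then obtain M where M: "P M" "\<And>M'. P M' \<Longrightarrow> dim M' \<le> dim M" by blast
  have "M' = M" if "P M'" "M \<subseteq> M'" for M'
    using subspace_dim_equal[OF assms(2)[OF M(1)] assms(2)[OF that(1)] that(2) M(2)[OF that(1)]] by simp
  then show thesis using that M(1) by blast
qed

definition subbialgebra :: "'h set \<Rightarrow> bool"
  where "subbialgebra B \<longleftrightarrow> subalgebra B \<and> subcoalgebra B"

text \<open>By multiplicativity of \<open>\<Delta>\<close>, the elements whose comultiplication lies
  in \<open>alg X \<otimes> alg X\<close> form a subalgebra, so generators suffice.\<close>

lemma subcoalgebra_alg:
  assumes "\<And>x. x \<in> X \<Longrightarrow> \<exists>v. Poly_Mapping.keys v \<subseteq> alg X \<times> alg X \<and> \<Delta> x \<approx>\<^sub>2 v"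
  shows "subcoalgebra (alg X)"
proof -
  let ?A = "alg X"
  have A: "subalgebra ?A" by (rule subalgebra_alg)
  let ?D = "{y. \<exists>v. Poly_Mapping.keys v \<subseteq> ?A \<times> ?A \<and> \<Delta> y \<approx>\<^sub>2 v}"
  have "subalgebra ?D" unfolding subalgebra_def subspace_def
  proof (intro conjI ballI allI)
    have "\<Delta> 0 \<approx>\<^sub>2 0" using comult_scale[of 0 0] by simp
    then show "0 \<in> ?D" by (auto intro!: exI[of _ 0])
    have "1 \<in> ?A" using A by (simp add: subalgebra_def)
    then show "1 \<in> ?D" using comult_one by (auto intro!: exI[of _ "gen (1, 1)"])
  next
    fix x y assume "x \<in> ?D" "y \<in> ?D"
    then obtain u v where uv: "Poly_Mapping.keys u \<subseteq> ?A \<times> ?A" "Poly_Mapping.keys v \<subseteq> ?A \<times> ?A"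
      "\<Delta> x \<approx>\<^sub>2 u" "\<Delta> y \<approx>\<^sub>2 v" by auto
    have "\<Delta> (x + y) \<approx>\<^sub>2 u + v" using comult_add teq2_add[OF uv(3,4)] teq2_trans by blast
    moreover have "Poly_Mapping.keys (u + v) \<subseteq> ?A \<times> ?A" using keys_add[of u v] uv by blast
    ultimately show "x + y \<in> ?D" by blast
    have "Poly_Mapping.keys (tmult u v) \<subseteq> ?A \<times> ?A"
      using A by (intro keys_tmult[OF uv(1,2)]) (auto simp: subalgebra_def)
    then show "x * y \<in> ?D" using comult_mult_eq[OF uv(3,4)] by blast
  next
    fix c x assume "x \<in> ?D"
    then obtain u where u: "Poly_Mapping.keys u \<subseteq> ?A \<times> ?A" "\<Delta> x \<approx>\<^sub>2 u" by auto
    have "\<Delta> (c *s x) \<approx>\<^sub>2 fscale c u" using comult_scale teq2_fscale[OF u(2)] teq2_trans by blast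
    moreover have "Poly_Mapping.keys (fscale c u) \<subseteq> ?A \<times> ?A" using keys_fscale[of c u] u by blast
    ultimately show "c *s x \<in> ?D" by blast
  qed
  from alg_minimal[OF this, of X] have "?A \<subseteq> ?D" using assms by blast
  then show ?thesis using A by (auto simp: subcoalgebra_def subalgebra_def)
qed

lemma subbialgebra_alg_primitives: "subbialgebra (alg primitives)"
  unfolding subbialgebra_def
proof (intro conjI subalgebra_alg subcoalgebra_alg)
  fix x assume x: "x \<in> primitives"
  have "Poly_Mapping.keys (gen (x, 1) + gen (1, x) :: 'h \<times> 'h \<Rightarrow>\<^sub>0 'k) \<subseteq> {(x, 1), (1, x)}"
    using keys_add[of "gen (x, 1)" "gen (1, x) :: 'h \<times> 'h \<Rightarrow>\<^sub>0 'k"] by auto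
  then show "\<exists>v. Poly_Mapping.keys v \<subseteq> alg primitives \<times> alg primitives \<and> \<Delta> x \<approx>\<^sub>2 v"
    using x alg_superset[of primitives] subalgebra_alg[of primitives]
    by (intro exI[of _ "gen (x, 1) + gen (1, x)"]) (auto simp: primitives_def subalgebra_def)
qed

lemma subbialgebra_adjoin:
  assumes B: "subbialgebra B" and v: "Poly_Mapping.keys v \<subseteq> B \<times> B"
    and a: "\<Delta> a \<approx>\<^sub>2 gen (a, 1) + gen (1, a) + v"
  shows "subbialgebra (alg (insert a B))"
  unfolding subbialgebra_def
proof (intro conjI subalgebra_alg subcoalgebra_alg)
  let ?A = "alg (insert a B)"
  have A: "B \<subseteq> ?A" "a \<in> ?A" "1 \<in> ?A"
    using alg_superset[of "insert a B"] subalgebra_alg[of "insert a B"] by (auto simp: subalgebra_def)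
  fix x assume "x \<in> insert a B"
  then consider "x = a" | "x \<in> B" by auto
  then show "\<exists>v. Poly_Mapping.keys v \<subseteq> ?A \<times> ?A \<and> \<Delta> x \<approx>\<^sub>2 v"
  proof cases
    case 1
    have "Poly_Mapping.keys (gen (a, 1) + gen (1, a) + v) \<subseteq> {(a, 1), (1, a)} \<union> Poly_Mapping.keys v"
      using keys_add[of "gen (a, 1)" "gen (1, a) :: 'h \<times> 'h \<Rightarrow>\<^sub>0 'k"] keys_add[of "gen (a, 1) + gen (1, a)" v] by auto
    then show ?thesis using A v a 1 by (intro exI[of _ "gen (a, 1) + gen (1, a) + v"]) auto
  next
    case 2
    then obtain u where "Poly_Mapping.keys u \<subseteq> B \<times> B" "\<Delta> x \<approx>\<^sub>2 u"
      using B by (auto simp: subbialgebra_def subcoalgebra_def)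
    then show ?thesis using A by blast
  qed
qed

text \<open>In \<open>\<Delta> x \<Delta> a - \<Delta> a \<Delta> x\<close> all terms with
  \<open>u\<close> or \<open>v\<close> cancel by the commutation hypotheses, and
  \<open>x \<otimes> 1\<close> commutes with \<open>1 \<otimes> a\<close>. Only
  \<open>[x, a] \<otimes> 1 + 1 \<otimes> [x, a]\<close> survives.\<close>

lemma commutator_primitive:
  assumes x: "\<Delta> x \<approx>\<^sub>2 gen (x, 1) + gen (1, x) + u" and a: "\<Delta> a \<approx>\<^sub>2 gen (a, 1) + gen (1, a) + v"
    and u: "Poly_Mapping.keys u \<subseteq> B \<times> B" and v: "Poly_Mapping.keys v \<subseteq> C \<times> C"
    and "\<And>b. b \<in> B \<Longrightarrow> a * b = b * a" "\<And>c. c \<in> C \<Longrightarrow> x * c = c * x"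
    and "\<And>b c. b \<in> B \<Longrightarrow> c \<in> C \<Longrightarrow> b * c = c * b"
  shows "x * a - a * x \<in> primitives"
  unfolding primitive_iff
proof (intro allI impI)
  fix f g assume fg: "lf f" "lf g"
  let ?x = "gen (x, 1) + gen (1, x) :: 'h \<times> 'h \<Rightarrow>\<^sub>0 'k" and ?a = "gen (a, 1) + gen (1, a) :: 'h \<times> 'h \<Rightarrow>\<^sub>0 'k"
  have c1: "tmult u v = tmult v u"
    using tmult_commute[OF u v] assms(7) by blast
  have k: "Poly_Mapping.keys ?x \<subseteq> {x, 1} \<times> {x, 1}" "Poly_Mapping.keys ?a \<subseteq> {a, 1} \<times> {a, 1}"
    using keys_add[of "gen (x, 1)" "gen (1, x) :: 'h \<times> 'h \<Rightarrow>\<^sub>0 'k"] keys_add[of "gen (a, 1)" "gen (1, a) :: 'h \<times> 'h \<Rightarrow>\<^sub>0 'k"] by auto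
  have c2: "tmult ?x v = tmult v ?x"
    using assms(6) by (intro tmult_commute[OF k(1) v]) auto
  have c3: "tmult u ?a = tmult ?a u"
    using tmult_commute[OF k(2) u] assms(5) by fastforce
  have "conv f g (x * a) = pair f g (tmult (?x + u) (?a + v))"
    using comult_mult_eq[OF x a] fg by (rule conv_eq)
  moreover have "conv f g (a * x) = pair f g (tmult (?a + v) (?x + u))"
    using comult_mult_eq[OF a x] fg by (rule conv_eq)
  moreover have "pair f g (tmult (?x + u) (?a + v)) - pair f g (tmult (?a + v) (?x + u)) =
      pair f g (tmult ?x ?a) - pair f g (tmult ?a ?x)"
    unfolding tmult_add(1)[of ?x u] tmult_add(1)[of ?a v] tmult_add(2)[of _ ?x u] tmult_add(2)[of _ ?a v]
    by (simp add: pair_simps c1 c2 c3)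
  moreover have "pair f g (tmult ?x ?a) - pair f g (tmult ?a ?x) =
      (f (x * a) - f (a * x)) * g 1 + f 1 * (g (x * a) - g (a * x))"
    by (simp add: tmult_add tmult_gen pair_simps algebra_simps)
  ultimately show "conv f g (x * a - a * x) = f (x * a - a * x) * g 1 + f 1 * g (x * a - a * x)"
    using fg by (simp add: lf_diff[OF lf_conv] lf_diff)
qed

lemma right_coideal_zero: "right_coideal {0}"
  using lact_scale[of _ 0 0] by (auto simp: right_coideal_def)

lemma right_coideal_UNIV: "right_coideal UNIV" and subcoalgebra_UNIV: "subcoalgebra UNIV"
  by (auto simp: subcoalgebra_iff right_coideal_def left_coideal_def)

lemma right_coideal_insert:
  assumes M: "right_coideal M" and a: "\<And>f. lf f \<Longrightarrow> lact f a - f 1 *s a \<in> M"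
  shows "right_coideal (span (insert a M))"
proof -
  have M': "subspace M" "span M = M" using M by (auto simp: right_coideal_def span_eq_iff)
  have "lact f x \<in> span (insert a M)" if x: "x \<in> span (insert a M)" and f: "lf f" for f x
  proof -
    obtain k where "x - k *s a \<in> M" using x M'(2) by (auto simp: span_breakdown_eq)
    then have "lact f (x - k *s a) + k *s (lact f a - f 1 *s a) \<in> M"
      using M f a[OF f] M'(1) by (auto simp: right_coideal_def subspace_add subspace_scale)
    moreover have "lact f (x - k *s a) = lact f x - k *s lact f a"
      using lact_add[OF f, of x "(- k) *s a"] lact_scale[OF f, of "- k" a] by simp
    ultimately have "lact f x - (k * f 1) *s a \<in> M" by (simp add: algebra_simps)
    then show ?thesis unfolding span_breakdown_eq M'(2) by blast
  qed
  then show ?thesis by (auto simp: right_coideal_def)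
qed

text \<open>The form of \<open>\<Delta> a\<close> suited to the antipode: its axiom then expresses
  \<open>S a\<close> through \<open>S\<close> on \<open>M\<close>, which the induction already
  controls.\<close>

lemma teq2_right_coideal_step:
  assumes M: "right_coideal M" and U: "subcoalgebra U" "1 \<in> U" "a \<in> U"
    and a: "\<And>f. lf f \<Longrightarrow> lact f a - f 1 *s a \<in> M"
  obtains v where "Poly_Mapping.keys v \<subseteq> M \<times> U" "\<Delta> a \<approx>\<^sub>2 gen (a, 1) + v"
proof -
  obtain v where v: "Poly_Mapping.keys v \<subseteq> M \<times> U" "\<Delta> a - gen (a, 1) \<approx>\<^sub>2 v"
  proof (rule teq2_in_tensor_subspace[of M U])
    show "subspace M" "subspace U" using M U by (auto simp: right_coideal_def subcoalgebra_def)
    fix f g assume fg: "lf f" "lf g"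
    have p: "pair f g (\<Delta> a - gen (a, 1)) = conv f g a - f a * g 1"
      by (simp add: pair_simps conv_def)
    show "pair f g (\<Delta> a - gen (a, 1)) = 0" if z: "\<And>x. x \<in> M \<Longrightarrow> f x = 0"
      using z[OF a[OF fg(2)]] fg by (simp add: p lf_diff lf_lact lf_scale mult.commute)
    have "ract f a \<in> U" using U fg by (auto simp: subcoalgebra_iff left_coideal_def)
    then show "pair f g (\<Delta> a - gen (a, 1)) = 0" if z: "\<And>x. x \<in> U \<Longrightarrow> g x = 0"
      using z[of "ract f a"] z[OF U(2)] fg by (simp add: p lf_ract)
  qed
  have "\<Delta> a \<approx>\<^sub>2 gen (a, 1) + v"
    using teq2_add[OF v(2) teq2_refl[of "gen (a, 1)"]] by (simp add: add.commute)
  then show thesis using that v(1) by auto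
qed

lemma antipode_eq:
  assumes "\<Delta> x \<approx>\<^sub>2 u"
  shows "lin_ext scale (\<lambda>(a, b). S a * b) u = \<epsilon> x *s 1"
  unfolding antipode_left[symmetric]
  by (rule sym, rule teq2_lin_ext[OF vector_space_scale assms])
    (auto simp: antipode_add antipode_scale algebra_simps scale_mult_left scale_mult_right)

lemma lf_counit_antipode: "lf (\<lambda>x. \<epsilon> (S x))"
  by (rule lfI) (auto simp: antipode_add antipode_scale counit_add counit_scale)

lemma counit_antipode: "\<epsilon> (S x) = \<epsilon> x"
proof -
  have "conv (\<lambda>x. \<epsilon> (S x)) \<epsilon> x = \<epsilon> (lin_ext scale (\<lambda>(a, b). S a * b) (\<Delta> x))"
    by (simp add: conv_def pair_def lf_lin_ext counit_mult case_prod_unfold)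
  then show ?thesis by (simp add: lf_counit_antipode antipode_left counit_scale counit_one)
qed

end

section \<open>Induction along right coideals, and the antipode\<close>

context connected_hopf_algebra
begin

text \<open>A right coideal grows from \<open>{0}\<close> by adjoining vectors that are trivial
  modulo the previous stage; a maximal stage on which \<open>Q\<close> holds must be all of
  \<open>W\<close>.\<close>

lemma right_coideal_induct:
  assumes W: "right_coideal W" and Q: "subspace {x. Q x}" and x: "x \<in> W"
    and step: "\<And>M a. right_coideal M \<Longrightarrow> M \<subseteq> W \<Longrightarrow> (\<And>m. m \<in> M \<Longrightarrow> Q m) \<Longrightarrow> a \<in> W \<Longrightarrow>
      (\<And>f. lf f \<Longrightarrow> lact f a - f 1 *s a \<in> M) \<Longrightarrow> Q a"
  shows "Q x"
proof -
  let ?P = "\<lambda>M. right_coideal M \<and> M \<subseteq> W \<and> M \<subseteq> {x. Q x}"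
  have P0: "?P {0}" using right_coideal_zero W subspace_0[OF Q] by (auto simp: right_coideal_def subspace_0)
  obtain M where M: "?P M" "\<And>M'. ?P M' \<Longrightarrow> M \<subseteq> M' \<Longrightarrow> M' = M"
    by (rule ex_maximal_subspace[of ?P, OF P0]) (auto simp: right_coideal_def)
  have "M = W"
  proof (rule ccontr)
    assume "M \<noteq> W"
    then obtain a where a: "a \<in> W" "a \<notin> M" "\<And>f. lf f \<Longrightarrow> lact f a - f 1 *s a \<in> M"
      using right_coideal_extension[of M W] M(1) W by blast
    have sp: "subspace W" "span M = M" using W M(1) by (auto simp: right_coideal_def span_eq_iff)
    have "Q a" using step[of M a] M(1) a by blast
    then have "?P (span (insert a M))"
      using right_coideal_insert[of M a] M(1) a span_minimal[of "insert a M" W] sp(1)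
        span_minimal[of "insert a M" "{x. Q x}"] Q by auto
    from M(2)[OF this] show False using a(2) span_superset[of "insert a M"] by blast
  qed
  then show ?thesis using M(1) x by auto
qed

text \<open>The case of anti-multiplicativity that turns \<open>t * x = 0\<close> into
  \<open>x * S t = 0\<close>, and so a right integral into an invariant. The antipode axiom for
  \<open>a * x\<close> gives a recursion along right coideals.\<close>

lemma antipode_mult_primitive:
  assumes x: "x \<in> primitives"
  shows "S (y * x) = - (x * S y)"
proof (rule right_coideal_induct[OF right_coideal_UNIV, of "\<lambda>y. S (y * x) = - (x * S y)"])
  have "S 0 = 0" using antipode_scale[of 0 0] by simp
  then show "subspace {y. S (y * x) = - (x * S y)}"
    by (auto simp: subspace_def antipode_add antipode_scale algebra_simps scale_mult_left scale_mult_right)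
  fix M a assume M: "right_coideal M" "\<And>m. m \<in> M \<Longrightarrow> S (m * x) = - (x * S m)"
    and a: "\<And>f. lf f \<Longrightarrow> lact f a - f 1 *s a \<in> M"
  obtain v where v: "Poly_Mapping.keys v \<subseteq> M \<times> UNIV" "\<Delta> a \<approx>\<^sub>2 gen (a, 1) + v"
    using teq2_right_coideal_step[OF M(1) subcoalgebra_UNIV _ _ a] by blast
  let ?T = "lin_ext scale (\<lambda>(a, b). S a * b)"
  have Tv: "?T v = \<epsilon> a *s 1 - S a"
    using antipode_eq[OF v(2)] by (simp add: lin_ext_add vector_space_scale algebra_simps)
  have "\<Delta> (a * x) \<approx>\<^sub>2 tmult (gen (a, 1) + v) (gen (x, 1) + gen (1, x))"
    using v(2) x by (intro comult_mult_eq) (auto simp: primitives_def)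
  from antipode_eq[OF this] have "0 = ?T (tmult (gen (a, 1) + v) (gen (x, 1) + gen (1, x)))"
    using counit_primitive[OF x] by (simp add: counit_mult)
  also have "\<dots> = S (a * x) + S a * x + lin_ext scale (\<lambda>(m, b). S (m * x) * b + S m * (b * x)) v"
    by (simp add: lin_ext_tmult lin_ext_add vector_space_scale)
  also have "lin_ext scale (\<lambda>(m, b). S (m * x) * b + S m * (b * x)) v =
      lin_ext scale (\<lambda>k. (case k of (m, b) \<Rightarrow> S m * b) * x - x * (case k of (m, b) \<Rightarrow> S m * b)) v"
    using v(1) M(2) by (intro lin_ext_cong) (auto simp: algebra_simps)
  \<comment> \<open>By \<open>Tv\<close> this is \<open>x * S a - S a * x\<close>, because the
    scalar part of \<open>?T v\<close> is central.\<close>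
  also have "\<dots> = ?T v * x - x * ?T v"
    by (rule linear_lin_ext[of scale scale "\<lambda>y. y * x - x * y", symmetric])
      (simp add: Vector_Spaces.linear_iff vector_space_scale algebra_simps scale_mult_left scale_mult_right)
  finally show "S (a * x) = - (x * S a)"
    by (simp add: Tv algebra_simps scale_mult_left scale_mult_right eq_neg_iff_add_eq_0)
qed auto

text \<open>The antipode axiom solved for \<open>S a\<close>: the remaining terms involve
  \<open>S\<close> only on \<open>M\<close>. Thus sub-bialgebras are automatically Hopf subalgebras,
  and \<open>K\<close> is just \<open>alg primitives\<close>.\<close>

lemma antipode_subbialgebra:
  assumes U: "subbialgebra U" and "x \<in> U"
  shows "S x \<in> U"
proof (rule right_coideal_induct[where W = U and Q = "\<lambda>x. S x \<in> U"])
  have U': "subspace U" "1 \<in> U" "\<And>x y. x \<in> U \<Longrightarrow> y \<in> U \<Longrightarrow> x * y \<in> U" "subcoalgebra U"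
    using U by (auto simp: subbialgebra_def subalgebra_def)
  then show "right_coideal U" by (simp add: subcoalgebra_iff)
  have "S 0 = 0" using antipode_scale[of 0 0] by simp
  then show "subspace {y. S y \<in> U}" using U'(1)
    by (auto simp: subspace_def antipode_add antipode_scale)
  fix M a assume M: "right_coideal M" "\<And>m. m \<in> M \<Longrightarrow> S m \<in> U"
    and a: "a \<in> U" "\<And>f. lf f \<Longrightarrow> lact f a - f 1 *s a \<in> M"
  obtain v where v: "Poly_Mapping.keys v \<subseteq> M \<times> U" "\<Delta> a \<approx>\<^sub>2 gen (a, 1) + v"
    using teq2_right_coideal_step[OF M(1) U'(4,2) a] by blast
  let ?T = "lin_ext scale (\<lambda>(a, b). S a * b)"
  have "S a = \<epsilon> a *s 1 - ?T v"
    using antipode_eq[OF v(2)] by (simp add: lin_ext_add vector_space_scale algebra_simps)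
  moreover have "?T v \<in> U"
    using v(1) M(2) U' by (intro lin_ext_in_subspace) auto
  ultimately show "S a \<in> U" using U' by (auto simp: subspace_diff subspace_scale)
qed fact

lemma generated_hopf_subalgebra_primitives: "generated_hopf_subalgebra primitives = alg primitives"
proof
  have "hopf_subalgebra (alg primitives)"
    using subbialgebra_alg_primitives antipode_subbialgebra
    by (auto simp: hopf_subalgebra_def subbialgebra_def)
  then show "generated_hopf_subalgebra primitives \<subseteq> alg primitives"
    using alg_superset by (auto simp: generated_hopf_subalgebra_def)
  show "alg primitives \<subseteq> generated_hopf_subalgebra primitives"
    unfolding generated_hopf_subalgebra_def hopf_subalgebra_def by (intro Inter_greatest alg_minimal) auto
qed

end

section \<open>Prime characteristic\<close>

text \<open>The orbits of the cyclic group generated by \<open>\<sigma>\<close> have \<open>1\<close> or \<open>p\<close> elements.\<close>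

lemma sum_fixed_points:
  fixes F :: "'x \<Rightarrow> 'a::comm_ring_1"
  assumes p: "prime p" "of_nat p = (0::'a)" and X: "finite X"
    and \<sigma>: "\<And>x. x \<in> X \<Longrightarrow> \<sigma> x \<in> X" "\<And>x. x \<in> X \<Longrightarrow> (\<sigma> ^^ p) x = x"
    and F: "\<And>x. x \<in> X \<Longrightarrow> F (\<sigma> x) = F x"
  shows "sum F X = sum F {x\<in>X. \<sigma> x = x}"
proof -
  define Y where "Y = {x\<in>X. \<sigma> x \<noteq> x}"
  define orb where "orb x = (\<lambda>i. (\<sigma> ^^ i) x) ` {..<p}" for x
  have p0: "p > 0" using p(1) prime_gt_0_nat by blast
  have it: "(\<sigma> ^^ i) x \<in> X" "F ((\<sigma> ^^ i) x) = F x" if "x \<in> X" for i x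
    using that by (induction i) (auto simp: \<sigma>(1) F)
  have per: "(\<sigma> ^^ (p * k)) x = x" if "x \<in> X" for x k
    using that by (induction k) (auto simp: funpow_add \<sigma>(2))
  have md: "(\<sigma> ^^ i) x = (\<sigma> ^^ (i mod p)) x" if "x \<in> X" for i x
  proof -
    have "(\<sigma> ^^ i) x = (\<sigma> ^^ (i mod p + p * (i div p))) x" by simp
    then show ?thesis using per[OF that] by (simp only: funpow_add o_apply)
  qed
  have orb_iff: "y \<in> orb x \<longleftrightarrow> (\<exists>i. y = (\<sigma> ^^ i) x)" if "x \<in> X" for x y
  proof
    assume "\<exists>i. y = (\<sigma> ^^ i) x"
    then obtain i where "y = (\<sigma> ^^ i) x" ..
    then have "y = (\<sigma> ^^ (i mod p)) x" using md[OF that, of i] by simp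
    then show "y \<in> orb x" unfolding orb_def using p0 by (intro image_eqI[of _ _ "i mod p"]) simp_all
  qed (auto simp: orb_def)
  have orb_sub: "orb y \<subseteq> orb x" if "x \<in> X" "y \<in> orb x" for x y
  proof -
    obtain i where i: "y = (\<sigma> ^^ i) x" using orb_iff[OF \<open>x \<in> X\<close>] \<open>y \<in> orb x\<close> by blast
    have "(\<sigma> ^^ j) y = (\<sigma> ^^ (j + i)) x" for j by (simp add: i funpow_add)
    moreover have "y \<in> X" using i it(1)[OF that(1)] by simp
    ultimately show ?thesis by (auto simp: orb_iff[OF that(1)] orb_iff[OF \<open>y \<in> X\<close>])
  qed
  have orb_sym: "x \<in> orb y" if "x \<in> X" "y \<in> orb x" for x y
  proof -
    obtain i where i: "i < p" "y = (\<sigma> ^^ i) x" using \<open>y \<in> orb x\<close> unfolding orb_def by auto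
    have "(\<sigma> ^^ (p - i)) y = (\<sigma> ^^ (p - i + i)) x" by (simp only: i(2) funpow_add o_apply)
    also have "\<dots> = x" using i(1) \<sigma>(2)[OF that(1)] by simp
    finally have "x = (\<sigma> ^^ (p - i)) y" by simp
    moreover have "y \<in> X" using i(2) it(1)[OF that(1)] by simp
    ultimately show ?thesis using orb_iff[of y x] by blast
  qed
  have orb_eq: "orb x = orb y" if "x \<in> X" "y \<in> X" "orb x \<inter> orb y \<noteq> {}" for x y
  proof -
    obtain z where z: "z \<in> orb x" "z \<in> orb y" using \<open>orb x \<inter> orb y \<noteq> {}\<close> by auto
    then have zX: "z \<in> X" using orb_iff[OF that(1)] it(1)[OF that(1)] by auto
    show ?thesis using orb_sub[OF that(1) z(1)] orb_sub[OF that(2) z(2)]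
        orb_sub[OF zX orb_sym[OF that(1) z(1)]] orb_sub[OF zX orb_sym[OF that(2) z(2)]] by blast
  qed
  have inj: "inj_on (\<lambda>i. (\<sigma> ^^ i) x) {..<p}" if "x \<in> Y" for x
  proof -
    have x: "x \<in> X" "\<sigma> x \<noteq> x" using that by (auto simp: Y_def)
    have "False" if ij: "i < j" "j < p" "(\<sigma> ^^ i) x = (\<sigma> ^^ j) x" for i j
    proof -
      \<comment> \<open>A coincidence gives the period \<open>j - i\<close>, coprime to
        \<open>p\<close>; together with the period \<open>p\<close>, Bezout forces
        \<open>\<sigma> x = x\<close>.\<close>
      let ?d = "j - i"
      have "(\<sigma> ^^ ?d) x = (\<sigma> ^^ (?d + p)) x" using \<sigma>(2)[OF x(1)] by (simp add: funpow_add)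
      also have "?d + p = (p - i) + j" using ij by simp
      also have "(\<sigma> ^^ ((p - i) + j)) x = (\<sigma> ^^ (p - i)) ((\<sigma> ^^ i) x)" by (simp add: funpow_add ij(3))
      also have "\<dots> = (\<sigma> ^^ ((p - i) + i)) x" by (simp only: funpow_add o_apply)
      also have "(p - i) + i = p" using ij by simp
      finally have d: "(\<sigma> ^^ ?d) x = x" using \<sigma>(2)[OF x(1)] by simp
      have dk: "(\<sigma> ^^ (?d * k)) x = x" for k using d by (induction k) (auto simp: funpow_add)
      have "\<not> p dvd ?d" using ij by (auto dest: dvd_imp_le)
      then have "coprime ?d p" using prime_imp_coprime[OF p(1)] coprime_commute by blast
      then obtain u v where uv: "?d * u = p * v + 1"
        using coprime_bezout_strong[of ?d p] p(1) by (metis not_prime_1)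
      have "x = (\<sigma> ^^ (p * v + 1)) x" using dk[of u] uv by simp
      also have "\<dots> = (\<sigma> ^^ (1 + p * v)) x" by (simp only: add.commute)
      also have "\<dots> = \<sigma> x" unfolding funpow_add o_apply per[OF x(1)] by simp
      finally show False using x(2) by simp
    qed
    then show ?thesis unfolding inj_on_def by (metis lessThan_iff linorder_neqE_nat)
  qed
  have orbY: "orb x \<subseteq> Y" if "x \<in> Y" for x
  proof
    fix y assume "y \<in> orb x"
    have x: "x \<in> X" "\<sigma> x \<noteq> x" using that by (auto simp: Y_def)
    have y: "y \<in> X" using \<open>y \<in> orb x\<close> orb_iff[OF x(1)] it(1)[OF x(1)] by auto
    have "\<sigma> y \<noteq> y"
    proof
      assume "\<sigma> y = y"
      then have "(\<sigma> ^^ i) y = y" for i by (induction i) auto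
      then have "orb y \<subseteq> {y}" by (auto simp: orb_def)
      then have "x = y" using orb_sym[OF x(1) \<open>y \<in> orb x\<close>] by auto
      then show False using x(2) \<open>\<sigma> y = y\<close> by simp
    qed
    then show "y \<in> Y" using y by (simp add: Y_def)
  qed
  have self: "x \<in> orb x" if "x \<in> X" for x using orb_iff[OF that] by (metis funpow_0)
  have sum0: "sum F (orb x) = 0" if "x \<in> Y" for x
  proof -
    have "sum F (orb x) = (\<Sum>i<p. F ((\<sigma> ^^ i) x))"
      unfolding orb_def by (subst sum.reindex[OF inj[OF that]]) simp
    also have "\<dots> = of_nat p * F x" using it(2)[of x] that by (simp add: Y_def)
    finally show ?thesis by (simp add: p(2))
  qed
  have YU: "Y = \<Union> (orb ` Y)" using orbY self by (auto simp: Y_def)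
  have "sum F Y = (sum \<circ> sum) F (orb ` Y)"
    by (subst YU, rule sum.Union_disjoint) (use orb_eq in \<open>auto simp: Y_def orb_def\<close>)
  also have "\<dots> = 0" using sum0 by (auto intro: sum.neutral)
  finally have "sum F Y = 0" .
  moreover have "sum F X = sum F {x\<in>X. \<sigma> x = x} + sum F Y"
    unfolding Y_def using X by (subst sum.union_disjoint[symmetric]) (auto intro: sum.cong)
  ultimately show ?thesis by simp
qed

lemma binomial_commuting:
  fixes a b :: "'a::ring_1"
  assumes "a * b = b * a"
  shows "(a + b) ^ n = (\<Sum>k\<le>n. of_nat (n choose k) * a ^ k * b ^ (n - k))"
proof (induction n)
  case (Suc n)
  have c: "b * a ^ k = a ^ k * b" for k
    using power_commuting_commutes[OF assms, of k] by simp
  have t: "a * (of_nat m * a ^ k * y) = of_nat m * a ^ Suc k * y"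
    "b * (of_nat m * a ^ k * b ^ l) = of_nat m * a ^ k * b ^ Suc l" for m k l y
  proof -
    have "a * (of_nat m * a ^ k * y) = (a * of_nat m) * a ^ k * y" by (simp only: mult.assoc)
    then show "a * (of_nat m * a ^ k * y) = of_nat m * a ^ Suc k * y"
      by (simp only: mult_of_nat_commute[symmetric] power_Suc mult.assoc)
    have "b * (of_nat m * a ^ k * b ^ l) = (b * of_nat m) * a ^ k * b ^ l" by (simp only: mult.assoc)
    also have "\<dots> = of_nat m * (b * a ^ k) * b ^ l" by (simp only: mult_of_nat_commute[symmetric] mult.assoc)
    finally show "b * (of_nat m * a ^ k * b ^ l) = of_nat m * a ^ k * b ^ Suc l"
      by (simp only: c power_Suc mult.assoc)
  qed
  have "(a + b) ^ Suc n = (a + b) * (\<Sum>k\<le>n. of_nat (n choose k) * a ^ k * b ^ (n - k))"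
    by (simp add: Suc.IH)
  also have "\<dots> = a * (\<Sum>k\<le>n. of_nat (n choose k) * a ^ k * b ^ (n - k)) +
      b * (\<Sum>k\<le>n. of_nat (n choose k) * a ^ k * b ^ (n - k))"
    by (rule distrib_right)
  also have "a * (\<Sum>k\<le>n. of_nat (n choose k) * a ^ k * b ^ (n - k)) =
      (\<Sum>k\<le>n. of_nat (n choose k) * a ^ Suc k * b ^ (n - k))"
    by (simp only: sum_distrib_left t)
  also have "b * (\<Sum>k\<le>n. of_nat (n choose k) * a ^ k * b ^ (n - k)) =
      (\<Sum>k\<le>n. of_nat (n choose k) * a ^ k * b ^ (Suc n - k))"
    unfolding sum_distrib_left t by (rule sum.cong) (simp_all add: Suc_diff_le)
  also have "(\<Sum>k\<le>n. of_nat (n choose k) * a ^ k * b ^ (Suc n - k)) =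
      b ^ Suc n + (\<Sum>k\<le>n. of_nat (n choose Suc k) * a ^ Suc k * b ^ (n - k))"
    using sum.atMost_Suc_shift[of "\<lambda>k. of_nat (n choose k) * a ^ k * b ^ (Suc n - k)" n]
    by (simp add: binomial_eq_0)
  also have "(\<Sum>k\<le>n. of_nat (n choose k) * a ^ Suc k * b ^ (n - k)) + \<dots> =
      b ^ Suc n + (\<Sum>k\<le>n. of_nat (Suc n choose Suc k) * a ^ Suc k * b ^ (n - k))"
    by (simp add: sum.distrib[symmetric] algebra_simps)
  also have "\<dots> = (\<Sum>k\<le>Suc n. of_nat (Suc n choose k) * a ^ k * b ^ (Suc n - k))"
    by (subst sum.atMost_Suc_shift) simp
  finally show ?case .
qed simp

lemma power_p_add:
  fixes a b :: "'a::ring_1"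
  assumes p: "prime p" "of_nat p = (0::'a)" and "a * b = b * a"
  shows "(a + b) ^ p = a ^ p + b ^ p"
proof -
  have "p > 0" using p(1) prime_gt_0_nat by blast
  have z: "of_nat (p choose k) = (0::'a)" if k: "k \<in> {..p} - {0, p}" for k
  proof -
    have "p dvd (p choose k)" using k p(1) by (intro dvd_choose_prime) auto
    then obtain m where "p choose k = p * m" by auto
    then show ?thesis using p(2) by simp
  qed
  have "(a + b) ^ p = (\<Sum>k\<in>{0, p}. of_nat (p choose k) * a ^ k * b ^ (p - k))"
    unfolding binomial_commuting[OF assms(3)]
    by (rule sum.mono_neutral_right) (use z in auto)
  then show ?thesis using \<open>p > 0\<close> by (simp add: add.commute)
qed

locale char_p_hopf_algebra = connected_hopf_algebra +
  fixes p :: nat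
  assumes prime_p: "prime p" and char_p: "CHAR('a) = p"
begin

lemma p_gt_0: "p > 0"
  using prime_p prime_gt_0_nat by blast

lemma of_nat_p_scalar: "of_nat p = (0::'a)"
  using of_nat_CHAR[where 'a = 'a] char_p by simp

lemma of_nat_p: "of_nat p = (0::'b)"
proof -
  have "of_nat n = (of_nat n :: 'a) *s (1::'b)" for n
    by (induction n) (auto simp: scale_left_distrib)
  then show ?thesis using of_nat_p_scalar by simp
qed

lemmas scalar_power_p_add = power_p_add[OF prime_p of_nat_p_scalar mult.commute]
  and power_p_add' = power_p_add[OF prime_p of_nat_p]

lemma scale_power: "(c *s x) ^ n = c ^ n *s x ^ n"
  by (induction n) (auto simp: scale_mult_left scale_mult_right)

lemma power_p_sum:
  assumes "\<And>x y. x \<in> E \<Longrightarrow> y \<in> E \<Longrightarrow> x * y = y * x"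
  shows "(\<Sum>e\<in>E. c e *s e) ^ p = (\<Sum>e\<in>E. c e ^ p *s e ^ p)"
  using assms
proof (induction E rule: infinite_finite_induct)
  case (insert x E)
  have "(c x *s x) * (\<Sum>e\<in>E. c e *s e) = (\<Sum>e\<in>E. c e *s e) * (c x *s x)"
    unfolding sum_distrib_left sum_distrib_right using insert.prems
    by (intro sum.cong) (auto simp: scale_mult_left scale_mult_right mult.commute)
  then show ?case using insert by (simp add: power_p_add' scale_power)
qed (use p_gt_0 in \<open>auto simp: power_0_left\<close>)

lemma power_p_span:
  assumes E: "finite E" "span E = V" and comm: "\<And>x y. x \<in> V \<Longrightarrow> y \<in> V \<Longrightarrow> x * y = y * x"
  shows "span {x ^ p | x. x \<in> V} = span ((\<lambda>e. e ^ p) ` E)"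
proof -
  have EV: "E \<subseteq> V" using E(2) span_superset by auto
  have "x ^ p \<in> span ((\<lambda>e. e ^ p) ` E)" if x: "x \<in> V" for x
  proof -
    obtain c where "x = (\<Sum>e\<in>E. c e *s e)"
      using x E span_finite[OF E(1)] by auto
    then have "x ^ p = (\<Sum>e\<in>E. c e ^ p *s e ^ p)"
      using power_p_sum[of E c] comm EV by (simp add: subset_eq)
    moreover have "(\<Sum>e\<in>E. c e ^ p *s e ^ p) \<in> span ((\<lambda>e. e ^ p) ` E)"
      by (intro span_sum span_scale span_base imageI)
    ultimately show ?thesis by simp
  qed
  then have "span {x ^ p | x. x \<in> V} \<subseteq> span ((\<lambda>e. e ^ p) ` E)"
    by (intro span_minimal) auto
  moreover have "span ((\<lambda>e. e ^ p) ` E) \<subseteq> span {x ^ p | x. x \<in> V}"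
    using EV by (intro span_mono) auto
  ultimately show ?thesis by simp
qed

text \<open>The coefficients are indexed by \<open>E\<close> and not by the set of
  \<open>p\<close>-th powers, so the condition includes injectivity of
  \<open>e \<mapsto> e ^ p\<close> on \<open>E\<close>.\<close>

definition p_independent :: "'b set \<Rightarrow> bool"
  where "p_independent E \<longleftrightarrow> (\<forall>c. (\<Sum>e\<in>E. c e *s e ^ p) = 0 \<longrightarrow> (\<forall>e\<in>E. c e = 0))"

lemma p_independentI:
  assumes "finite E" "inj_on (\<lambda>e. e ^ p) E" "independent ((\<lambda>e. e ^ p) ` E)"
  shows "p_independent E"
  unfolding p_independent_def
proof (intro allI impI)
  fix c assume "(\<Sum>e\<in>E. c e *s e ^ p) = 0"
  then have "(\<Sum>x\<in>(\<lambda>e. e ^ p) ` E. c (inv_into E (\<lambda>e. e ^ p) x) *s x) = 0"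
    using assms(2) by (simp add: sum.reindex inv_into_f_f[OF assms(2)] cong: sum.cong)
  then have "c (inv_into E (\<lambda>e. e ^ p) x) = 0" if "x \<in> (\<lambda>e. e ^ p) ` E" for x
    using independentD[OF assms(3) finite_imageI[OF assms(1)] subset_refl,
        where u = "\<lambda>x. c (inv_into E (\<lambda>e. e ^ p) x)"] that by simp
  then show "\<forall>e\<in>E. c e = 0" using assms(2) by (metis imageI inv_into_f_f)
qed

lemma p_independent_imp:
  assumes E: "finite E" "p_independent E"
  shows "inj_on (\<lambda>e. e ^ p) E" "independent ((\<lambda>e. e ^ p) ` E)"
proof -
  show inj: "inj_on (\<lambda>e. e ^ p) E"
  proof (rule inj_onI, rule ccontr)
    fix x y assume xy: "x \<in> E" "y \<in> E" "x ^ p = y ^ p" "x \<noteq> y"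
    let ?c = "\<lambda>e. if e = x then 1 else if e = y then - 1 else 0 :: 'a"
    have "(\<Sum>e\<in>E. ?c e *s e ^ p) = (\<Sum>e\<in>{x, y}. ?c e *s e ^ p)"
      using xy E(1) by (intro sum.mono_neutral_right) auto
    also have "\<dots> = 0" using xy by simp
    finally have "\<forall>e\<in>E. ?c e = 0" using E(2)[unfolded p_independent_def, THEN spec[where x = ?c]] by (rule rev_mp)
    then show False using xy(1) by force
  qed
  show "independent ((\<lambda>e. e ^ p) ` E)"
  proof (rule independent_if_scalars_zero)
    fix f x assume f: "(\<Sum>x\<in>(\<lambda>e. e ^ p) ` E. f x *s x) = 0" "x \<in> (\<lambda>e. e ^ p) ` E"
    have "(\<Sum>e\<in>E. f (e ^ p) *s e ^ p) = 0" using f(1) by (simp add: sum.reindex[OF inj])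
    then have "\<forall>e\<in>E. f (e ^ p) = 0" using E(2)[unfolded p_independent_def, THEN spec[where x = "\<lambda>e. f (e ^ p)"]] by (rule rev_mp)
    then show "f x = 0" using f(2) by auto
  qed (use E(1) in simp)
qed

text \<open>The \<open>p\<close>-th power is semilinear on commuting elements, so the powers of a
  basis span all \<open>p\<close>-th powers of \<open>V\<close>. There are at most
  \<open>dim V\<close> of them, hence independence and spanning agree by counting.\<close>

lemma p_independent_basis_iff:
  assumes V: "subspace V" "\<And>x y. x \<in> V \<Longrightarrow> y \<in> V \<Longrightarrow> x * y = y * x" "\<And>x. x \<in> V \<Longrightarrow> x ^ p \<in> V"
    and E: "finite E" "independent E" "span E = V"
  shows "p_independent E \<longleftrightarrow> V = span {x ^ p | x. x \<in> V}"
proof -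
  let ?F = "(\<lambda>e. e ^ p) ` E"
  have FV: "?F \<subseteq> V" "finite ?F" using E V(3) span_superset by auto
  have card: "card E = dim V" using dim_span_eq_card_independent[OF E(2)] E(3) by simp
  have sp: "span ?F \<subseteq> V" using FV(1) V(1) span_minimal by blast
  have eq: "span {x ^ p | x. x \<in> V} = span ?F"
    by (rule power_p_span[OF E(1,3) V(2)])
  show ?thesis unfolding eq
  proof
    assume "p_independent E"
    from p_independent_imp[OF E(1) this] have "card ?F = dim V" "independent ?F"
      by (simp_all add: card card_image)
    then show "V = span ?F" using card_eq_dim[OF FV(1) _ FV(2)] sp by auto
  next
    assume V': "V = span ?F"
    have "dim V \<le> card ?F" using dim_le_card[of V ?F] V' FV(2) by simp
    then have c: "card ?F = card E" using card card_image_le[OF E(1), of "\<lambda>e. e ^ p"] by simp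
    then show "p_independent E"
      using card_eq_dim[OF FV(1) _ FV(2)] card V' eq_card_imp_inj_on[OF E(1)]
      by (intro p_independentI E) auto
  qed
qed

subsection \<open>The Frobenius map on tensors\<close>

lemma conv_power_words:
  assumes b: "\<Delta> b \<approx>\<^sub>2 (\<Sum>k\<in>I. fscale (c k) (gen k))" and I: "finite I"
    and "lf f" "lf g"
  shows "conv f g (b ^ n) = (\<Sum>w | set w \<subseteq> I \<and> length w = n.
    prod_list (map c w) * (f (prod_list (map fst w)) * g (prod_list (map snd w))))"
  using assms(3,4)
proof (induction n arbitrary: f g)
  case 0
  have "{w. set w \<subseteq> I \<and> length w = 0} = {[]}" by auto
  then show ?case using 0 by simp
next
  case (Suc n)
  let ?t = "\<lambda>f g w. prod_list (map c w) * (f (prod_list (map fst w)) * g (prod_list (map snd w)))"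
  let ?W = "{w. set w \<subseteq> I \<and> length w = n}"
  have "conv f g (b ^ Suc n) = (\<Sum>k\<in>I. c k * conv (\<lambda>z. f (fst k * z)) (\<lambda>z. g (snd k * z)) (b ^ n))"
    using conv_mult[OF b Suc.prems, of "b ^ n"]
    by (simp add: lin_ext_sum lin_ext_fscale vector_space_times case_prod_unfold)
  also have "\<dots> = (\<Sum>k\<in>I. \<Sum>w\<in>?W. ?t f g (k # w))"
    using Suc.IH[OF lf_mult(1)[OF Suc.prems(1)] lf_mult(1)[OF Suc.prems(2)]]
    by (simp add: sum_distrib_left mult_ac)
  also have "\<dots> = (\<Sum>(k, w)\<in>I \<times> ?W. ?t f g (k # w))"
    by (simp add: sum.cartesian_product)
  also have "\<dots> = (\<Sum>w | set w \<subseteq> I \<and> length w = Suc n. ?t f g w)"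
    by (rule sum.reindex_bij_witness[of _ "\<lambda>w. (hd w, tl w)" "\<lambda>(k, w). k # w"])
      (auto simp: length_Suc_conv)
  finally show ?case .
qed

lemma prod_list_rotate1:
  assumes "\<And>x y. x \<in> set w \<Longrightarrow> y \<in> set w \<Longrightarrow> h x * h y = (h y * h x :: 'c::monoid_mult)"
  shows "prod_list (map h (rotate1 w)) = prod_list (map h w)"
proof (cases w)
  case (Cons k v)
  have "prod_list (map h v) * h k = h k * prod_list (map h v)" if "set v \<subseteq> set w" for v
    using that
  proof (induction v)
    case (Cons y v)
    have "y \<in> set w" "k \<in> set w" using Cons.prems \<open>w = k # _\<close> by auto
    then show ?case using Cons assms[of y k] by (simp add: mult.assoc) (metis mult.assoc)
  qed simp
  then have "prod_list (map h v) * h k = h k * prod_list (map h v)" using Cons by auto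
  then show ?thesis using Cons by simp
qed simp

text \<open>Frobenius on \<open>A \<otimes> A\<close>. Rotating a word does not change its
  contribution since entries commute, so orbits of size \<open>p\<close> cancel and only constant
  words remain.\<close>

lemma conv_power_p:
  assumes b: "\<Delta> b \<approx>\<^sub>2 (\<Sum>k\<in>I. fscale (c k) (gen k))" and I: "finite I" "I \<subseteq> A \<times> A"
    and A: "\<And>x y. x \<in> A \<Longrightarrow> y \<in> A \<Longrightarrow> x * y = y * x" and fg: "lf f" "lf g"
  shows "conv f g (b ^ p) = (\<Sum>k\<in>I. c k ^ p * (f (fst k ^ p) * g (snd k ^ p)))"
proof -
  let ?t = "\<lambda>w. prod_list (map c w) * (f (prod_list (map fst w)) * g (prod_list (map snd w)))"
  let ?W = "{w. set w \<subseteq> I \<and> length w = p}"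
  have "conv f g (b ^ p) = sum ?t ?W" by (rule conv_power_words[OF b I(1) fg])
  also have "\<dots> = sum ?t {w\<in>?W. rotate1 w = w}"
  proof (rule sum_fixed_points[OF prime_p of_nat_p_scalar])
    show "finite ?W" by (rule finite_lists_length_eq[OF I(1)])
    fix w assume w: "w \<in> ?W"
    then show "rotate1 w \<in> ?W" by simp
    show "(rotate1 ^^ p) w = w" using w rotate_id[of p w] by (simp add: rotate_def)
    have "fst x * fst y = fst y * fst x" "snd x * snd y = snd y * snd x" if "x \<in> set w" "y \<in> set w" for x y
    proof -
      have "x \<in> A \<times> A" "y \<in> A \<times> A" using that w I(2) by blast+
      then show "fst x * fst y = fst y * fst x" "snd x * snd y = snd y * snd x"
        using A[of "fst x" "fst y"] A[of "snd x" "snd y"] by (simp_all add: mem_Times_iff)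
    qed
    then show "?t (rotate1 w) = ?t w"
      using prod_list_rotate1[of w fst] prod_list_rotate1[of w snd] prod_list_rotate1[of w c]
      by (simp add: mult.commute)
  qed
  also have "{w\<in>?W. rotate1 w = w} = replicate p ` I"
  proof (intro set_eqI iffI)
    fix w assume w: "w \<in> {w\<in>?W. rotate1 w = w}"
    then have "card (set w) = 1" using rotate1_fixpoint_card[of w] p_gt_0 by auto
    then obtain k where "set w = {k}" by (auto simp: card_1_singleton_iff)
    then have "w = replicate p k" "k \<in> I" using w replicate_eqI[of w p k] by auto
    then show "w \<in> replicate p ` I" by (rule image_eqI)
  qed (auto simp: p_gt_0 rotate1_replicate)
  also have "sum ?t \<dots> = (\<Sum>k\<in>I. c k ^ p * (f (fst k ^ p) * g (snd k ^ p)))"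
  proof (subst sum.reindex)
    show "inj_on (replicate p) I" using p_gt_0 by (auto simp: inj_on_def)
  qed (simp add: map_replicate prod_list_replicate)
  finally show ?thesis .
qed

lemma primitive_power_p:
  assumes x: "x \<in> primitives"
  shows "x ^ p \<in> primitives"
  unfolding primitive_iff
proof (intro allI impI)
  fix f g assume fg: "lf f" "lf g"
  \<comment> \<open>Otherwise the index pairs \<open>(x, 1)\<close> and \<open>(1, x)\<close> would
    coincide and the sum over the set would lose a term.\<close>
  have "x \<noteq> 1" using counit_primitive[OF x] counit_one by auto
  then have "\<Delta> x \<approx>\<^sub>2 (\<Sum>k\<in>{(x, 1), (1, x)}. fscale 1 (gen k))"
    using x by (simp add: primitives_def)
  from conv_power_p[OF this, of "{x, 1}" f g]
  have "conv f g (x ^ p) = (\<Sum>k\<in>{(x, 1), (1, x)}. 1 ^ p * (f (fst k ^ p) * g (snd k ^ p)))"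
    using fg by force
  then show "conv f g (x ^ p) = f (x ^ p) * g 1 + f 1 * g (x ^ p)"
    using \<open>x \<noteq> 1\<close> by simp
qed

end

section \<open>Abelian primitives spanned by \<open>p\<close>-th powers\<close>

text \<open>The derivation \<open>[x, _]\<close> obeys the ordinary power rule on \<open>y\<close>
  as soon as \<open>y\<close> commutes with \<open>[x, y]\<close>; at exponent \<open>p\<close> the
  factor vanishes.\<close>

lemma commute_power_commutator:
  fixes x y :: "'a::ring_1"
  assumes c: "y * (x * y - y * x) = (x * y - y * x) * y"
  shows "x * y ^ Suc n - y ^ Suc n * x = of_nat (Suc n) * (y ^ n * (x * y - y * x))"
proof (induction n)
  case (Suc n)
  let ?z = "x * y - y * x"
  have z: "?z * y ^ m = y ^ m * ?z" for m
    using power_commuting_commutes[OF c, of m] by simp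
  have "x * y ^ Suc (Suc n) - y ^ Suc (Suc n) * x = ?z * y ^ Suc n + y * (x * y ^ Suc n - y ^ Suc n * x)"
    by (simp add: algebra_simps)
  also have "\<dots> = y ^ Suc n * ?z + y * (of_nat (Suc n) * (y ^ n * ?z))"
    by (simp only: Suc.IH z)
  also have "y * (of_nat (Suc n) * (y ^ n * ?z)) = of_nat (Suc n) * (y ^ Suc n * ?z)"
    using mult_of_nat_commute[of "Suc n" y] by (metis mult.assoc power_Suc)
  finally show ?case by (simp add: distrib_right)
qed simp

context k_algebra
begin

lemma subspace_commutant: "subspace {z. x * z = z * x}"
  by (simp add: subspace_def distrib_left distrib_right scale_mult_left scale_mult_right)

lemma span_commute:
  assumes "\<And>z. z \<in> Z \<Longrightarrow> x * z = z * x" "y \<in> span Z"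
  shows "x * y = y * x"
  using span_minimal[OF _ subspace_commutant, of Z x] assms by auto

end

context finite_dimensional_hopf_algebra
begin

lemma dual_basis:
  assumes E: "finite E" "independent E"
  obtains d where "\<And>e. lf (d e)" "\<And>e e'. e' \<in> E \<Longrightarrow> d e e' = (if e' = e then 1 else 0)"
    "\<And>x. x \<in> span E \<Longrightarrow> (\<Sum>e\<in>E. d e x *s e) = x"
proof -
  have "\<forall>e. \<exists>f. lf f \<and> (\<forall>e'\<in>E. f e' = (if e' = e then 1 else 0))"
    by (intro allI lf_extend[OF E(2)])
  then obtain d where d: "\<And>e. lf (d e)" "\<And>e e'. e' \<in> E \<Longrightarrow> d e e' = (if e' = e then 1 else 0)"
    by metis
  have "(\<Sum>e\<in>E. d e x *s e) = x" if x: "x \<in> span E" for x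
  proof -
    obtain c where c: "x = (\<Sum>e\<in>E. c e *s e)" using x span_finite[OF E(1)] by auto
    have "d e x = c e" if "e \<in> E" for e
      using that E(1) by (simp add: c lf_sum[OF d(1)] lf_scale[OF d(1)] d(2) if_distrib sum.delta cong: if_cong)
    then show ?thesis by (simp add: c)
  qed
  then show thesis using that d by blast
qed

lemma pair_expand:
  assumes d: "\<And>x. x \<in> M \<Longrightarrow> (\<Sum>e\<in>E. d e x *s e) = x"
    and w: "Poly_Mapping.keys w \<subseteq> M \<times> M" and fg: "lf f" "lf g"
  shows "pair f g w = (\<Sum>k\<in>E \<times> E. pair (d (fst k)) (d (snd k)) w * (f (fst k) * g (snd k)))"
proof -
  have e: "h x = (\<Sum>e\<in>E. d e x * h e)" if "lf h" "x \<in> M" for h x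
    using arg_cong[OF d[OF that(2)], of h] that(1) by (simp add: lf_sum lf_scale)
  have "pair f g w = lin_ext (*) (\<lambda>(a, b). (\<Sum>e\<in>E. d e a * f e) * (\<Sum>e\<in>E. d e b * g e)) w"
    unfolding pair_def using e fg w by (intro lin_ext_cong) auto
  also have "\<dots> = lin_ext (*) (\<lambda>(a, b). \<Sum>k\<in>E \<times> E. d (fst k) a * d (snd k) b * (f (fst k) * g (snd k))) w"
    by (simp add: sum_product sum.cartesian_product case_prod_unfold mult_ac)
  also have "\<dots> = (\<Sum>k\<in>E \<times> E. pair (d (fst k)) (d (snd k)) w * (f (fst k) * g (snd k)))"
    by (simp add: pair_def lin_ext_def case_prod_unfold sum_distrib_left sum_distrib_right mult_ac)
      (rule sum.swap)
  finally show ?thesis .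
qed

lemma teq2_expand:
  assumes "\<And>x. x \<in> M \<Longrightarrow> (\<Sum>e\<in>E. d e x *s e) = x" "Poly_Mapping.keys w \<subseteq> M \<times> M"
  shows "w \<approx>\<^sub>2 (\<Sum>k\<in>E \<times> E. fscale (pair (d (fst k)) (d (snd k)) w) (gen k))"
proof -
  have "pair f g (gen k) = f (fst k) * g (snd k)" for f g and k :: "'h \<times> 'h"
    using pair_simps(1)[of f g "fst k" "snd k"] by simp
  then show ?thesis
    unfolding teq2_iff using pair_expand[OF assms] by (simp add: pair_sum pair_simps(4))
qed

lemma semisimple_imp_left_integral:
  assumes A: "subalgebra A" and ss: "semisimple A"
  shows "\<exists>t\<in>left_integrals \<epsilon> A. \<epsilon> t \<noteq> 0"
proof -
  have "\<exists>L. simple_left_ideal A L \<and> (\<exists>s\<in>L. \<epsilon> s \<noteq> 0)"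
  proof (rule ccontr)
    assume n: "\<not> ?thesis"
    have "1 \<in> span (\<Union>{L. simple_left_ideal A L})" using A ss by (simp add: semisimple_def subalgebra_def)
    from linear_zero_on_span[OF _ _ this, of "(*)" \<epsilon>] n have "\<epsilon> 1 = 0"
      using lf_counit unfolding lf_linear by blast
    then show False by (simp add: counit_one)
  qed
  then obtain L s where L: "simple_left_ideal A L" and s: "s \<in> L" "\<epsilon> s \<noteq> 0" by blast
  have L': "L \<subseteq> A" "subspace L" "\<And>a x. a \<in> A \<Longrightarrow> x \<in> L \<Longrightarrow> a * x \<in> L"
    using L by (auto simp: simple_left_ideal_def left_ideal_def)
  have "subspace {x \<in> L. \<epsilon> x = 0}"
    using L'(2) by (auto simp: subspace_def counit_add counit_scale lf_zero[OF lf_counit])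
  \<comment> \<open>It omits \<open>s\<close>, so by simplicity it is zero; and it contains every
    \<open>a * s - \<epsilon> a *s s\<close>.\<close>
  then have "left_ideal A {x \<in> L. \<epsilon> x = 0}"
    using L' by (auto simp: left_ideal_def counit_mult)
  then have "{x \<in> L. \<epsilon> x = 0} = {0} \<or> {x \<in> L. \<epsilon> x = 0} = L"
    using L unfolding simple_left_ideal_def by blast
  then have z: "{x \<in> L. \<epsilon> x = 0} = {0}" using s by auto
  have "a * s - \<epsilon> a *s s \<in> {x \<in> L. \<epsilon> x = 0}" if "a \<in> A" for a
    using that s(1) L' by (simp add: subspace_diff subspace_scale lf_diff[OF lf_counit] counit_mult counit_scale)
  then have "a * s = \<epsilon> a *s s" if "a \<in> A" for a using that z by fastforce
  then show ?thesis using s L'(1) by (auto simp: left_integrals_def)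
qed

text \<open>An idempotent of the socle with minimal annihilator is \<open>1\<close>.\<close>

lemma semisimple_if_reduced:
  assumes A: "subalgebra A" and comm: "\<And>x y. x \<in> A \<Longrightarrow> y \<in> A \<Longrightarrow> x * y = y * x"
    and red: "\<And>x. x \<in> A \<Longrightarrow> x * x = 0 \<Longrightarrow> x = 0"
  shows "semisimple A"
proof -
  have A': "subspace A" "1 \<in> A" "\<And>x y. x \<in> A \<Longrightarrow> y \<in> A \<Longrightarrow> x * y \<in> A"
    using A by (auto simp: subalgebra_def)
  let ?U = "\<Union>{L. simple_left_ideal A L}"
  define T where "T = span ?U"
  have UA: "?U \<subseteq> A" by (auto simp: simple_left_ideal_def left_ideal_def)
  have TA: "T \<subseteq> A" unfolding T_def by (rule span_minimal[OF UA A'(1)])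
  have T_ideal: "a * x \<in> T" if a: "a \<in> A" and x: "x \<in> T" for a x
    using x unfolding T_def
  proof (induction rule: span_induct_alt)
    case (step c y z)
    obtain L where L: "simple_left_ideal A L" "y \<in> L" using step(1) by blast
    then have "a * y \<in> L" using a by (simp add: simple_left_ideal_def left_ideal_def)
    then have "a * y \<in> ?U" using L(1) by blast
    then show ?case using step(2) by (simp add: distrib_left scale_mult_right span_add span_scale span_base)
  qed (simp add: span_zero)
  define N where "N e = {a \<in> A. a * e = 0}" for e
  have N_sub: "subspace (N e)" for e
    using A'(1) by (auto simp: N_def subspace_def distrib_right scale_mult_left)
  let ?P = "\<lambda>e. e \<in> T \<and> e * e = e"
  have "?P 0" by (simp add: T_def span_zero)
  from ex_has_least_nat[of ?P 0 "\<lambda>e. dim (N e)", OF this]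
  obtain e where e: "e \<in> T" "e * e = e" "\<And>e'. ?P e' \<Longrightarrow> dim (N e) \<le> dim (N e')" by blast
  have eA: "e \<in> A" using e(1) TA by auto
  have "N e = {0}"
  proof (rule ccontr)
    assume "N e \<noteq> {0}"
    have Nl: "left_ideal A (N e)"
      using N_sub A'(3) by (auto simp: left_ideal_def N_def mult.assoc)
    let ?Q = "\<lambda>L. left_ideal A L \<and> L \<noteq> {0} \<and> L \<subseteq> N e"
    have "?Q (N e)" using Nl \<open>N e \<noteq> {0}\<close> by simp
    from ex_has_least_nat[of ?Q "N e" dim, OF this]
    obtain L where L: "?Q L" "\<And>L'. ?Q L' \<Longrightarrow> dim L \<le> dim L'" by blast
    have L': "L \<subseteq> A" "subspace L" "\<And>a x. a \<in> A \<Longrightarrow> x \<in> L \<Longrightarrow> a * x \<in> L" "L \<subseteq> N e" "0 \<in> L"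
      using L(1) by (auto simp: left_ideal_def subspace_0)
    have min: "M = {0} \<or> M = L" if M: "left_ideal A M" "M \<subseteq> L" for M
    proof (cases "M = {0}")
      case False
      then have "?Q M" using M L(1) by auto
      then show ?thesis
        using subspace_dim_equal[of M L] M L'(2) L(2)[of M] by (simp add: left_ideal_def)
    qed simp
    then have simple: "simple_left_ideal A L"
      using L(1) by (auto simp: simple_left_ideal_def)
    obtain x where x: "x \<in> L" "x \<noteq> 0" using L(1) L'(5) by auto
    have xx: "x * x \<noteq> 0" using red[of x] x L'(1) by auto
    \<comment> \<open>As \<open>x * x \<noteq> 0\<close>, simplicity makes multiplication by
      \<open>x\<close> bijective on \<open>L\<close>; the preimage \<open>f\<close> of
      \<open>x\<close> is then idempotent.\<close>
    have "left_ideal A {l * x | l. l \<in> L}"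
      unfolding left_ideal_def subspace_def
    proof (intro conjI ballI allI)
      show "{l * x |l. l \<in> L} \<subseteq> A" using L'(1) x A'(3) by blast
      show "0 \<in> {l * x |l. l \<in> L}" using L'(5) by force
      fix u assume "u \<in> {l * x |l. l \<in> L}"
      then obtain l where l: "u = l * x" "l \<in> L" by blast
      show "c *s u \<in> {l * x |l. l \<in> L}" for c
        using l L'(2) by (auto simp: subspace_scale simp flip: scale_mult_left)
      show "a * u \<in> {l * x |l. l \<in> L}" if "a \<in> A" for a
        using l L'(3) that by (auto simp flip: mult.assoc)
      fix v assume "v \<in> {l * x |l. l \<in> L}"
      then obtain l' where "v = l' * x" "l' \<in> L" by blast
      then show "u + v \<in> {l * x |l. l \<in> L}"
        using l L'(2) by (auto simp: subspace_add simp flip: distrib_right)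
    qed
    moreover have "{l * x | l. l \<in> L} \<subseteq> L" using L'(1,3) x(1) by blast
    ultimately have "{l * x | l. l \<in> L} = L" using min[of "{l * x | l. l \<in> L}"] xx x(1) by blast
    then have "x \<in> {l * x | l. l \<in> L}" using x(1) by (rule ssubst)
    then obtain f where f: "f \<in> L" "f * x = x" by auto
    have "left_ideal A {l \<in> L. l * x = 0}"
      using L' by (auto simp: left_ideal_def subspace_def distrib_right scale_mult_left mult.assoc)
    then have ann: "{l \<in> L. l * x = 0} = {0}" using min[of "{l \<in> L. l * x = 0}"] x(1) xx by blast
    have "f * f - f \<in> {l \<in> L. l * x = 0}"
      using f L' by (auto simp: left_diff_distrib mult.assoc subspace_diff)
    then have ff: "f * f = f" using ann by auto
    have fe: "f * e = 0" "e * f = 0" using f(1) L'(4) comm[of f e] eA by (auto simp: N_def)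
    have "f \<in> T" unfolding T_def using simple f(1) by (intro span_base) auto
    \<comment> \<open>Adding the orthogonal idempotent \<open>f\<close> shrinks the annihilator
      strictly, as \<open>f\<close> itself drops out.\<close>
    then have "?P (e + f)"
      using e(1,2) ff fe by (simp add: T_def span_add algebra_simps)
    from e(3)[OF this] have d: "dim (N e) \<le> dim (N (e + f))" .
    have sub: "N (e + f) \<subseteq> N e"
    proof
      fix a assume a: "a \<in> N (e + f)"
      have "a * e = a * (e + f) * e" using e(2) fe by (simp add: mult.assoc distrib_right)
      then show "a \<in> N e" using a by (simp add: N_def)
    qed
    have "f \<in> N e" using f(1) L'(4) by auto
    moreover have "f \<notin> N (e + f)" using fe ff f x by (auto simp: N_def distrib_left)
    ultimately show False using subspace_dim_equal[OF N_sub N_sub sub d] by blast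
  qed
  moreover have "1 - e \<in> N e" using A' eA e(2) by (simp add: N_def subspace_diff left_diff_distrib)
  ultimately have "1 \<in> T" using e(1) by auto
  then have "T = A" using T_ideal[of _ 1] TA by auto
  then show ?thesis by (simp add: semisimple_def T_def)
qed

end

section \<open>Independence of \<open>p\<close>-th powers in commutative sub-bialgebras\<close>

context char_p_hopf_algebra
begin

lemma commute_power_p:
  fixes x y :: 'b
  assumes "y * (x * y - y * x) = (x * y - y * x) * y"
  shows "x * y ^ p = y ^ p * x"
  using commute_power_commutator[OF assms, of "p - 1"] p_gt_0 of_nat_p by simp

text \<open>The field is a vector space over itself along the Frobenius map; this is a linear functional on it.\<close>

lemma scalar_root_functional:
  "\<exists>r :: 'a \<Rightarrow> 'a. (\<forall>x y. r (x + y) = r x + r y) \<and> (\<forall>c x. r (c ^ p * x) = c * r x) \<and> r 1 = 1"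
proof -
  have vs: "vector_space (\<lambda>c x :: 'a. c ^ p * x)"
    by unfold_locales (auto simp: algebra_simps scalar_power_p_add power_mult_distrib)
  interpret vp: vector_space_pair "\<lambda>c x :: 'a. c ^ p * x" "(*) :: 'a \<Rightarrow> 'a \<Rightarrow> 'a"
    by (intro vector_space_pair.intro vs vector_space_times)
  have "\<not> vp.vs1.dependent {1 :: 'a}" by simp
  from vp.linear_independent_extend[OF this, of "\<lambda>_. 1"]
  obtain r where "Vector_Spaces.linear (\<lambda>c x :: 'a. c ^ p * x) (*) r" "r 1 = 1" by auto
  then show ?thesis by (intro exI[of _ r]) (simp add: Vector_Spaces.linear_iff)
qed

text \<open>\<open>d\<close> gives coordinates along \<open>E\<close>, and \<open>\<phi>\<close> is
  dual to the \<open>p\<close>-th powers of \<open>E\<close>. Frobenius on tensors therefore raises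
  the structure constants of \<open>\<Delta>\<close> to the \<open>p\<close>-th power.\<close>

lemma conv_frobenius:
  assumes M: "subcoalgebra M" "\<And>x y. x \<in> M \<Longrightarrow> y \<in> M \<Longrightarrow> x * y = y * x" and E: "finite E" "span E = M"
    and d: "\<And>x. x \<in> M \<Longrightarrow> (\<Sum>e\<in>E. d e x *s e) = x" "\<And>e. lf (d e)"
    and \<phi>: "\<And>e. lf (\<phi> e)" "\<And>e e'. e \<in> E \<Longrightarrow> e' \<in> E \<Longrightarrow> \<phi> e (e' ^ p) = (if e' = e then 1 else 0)"
    and m: "m \<in> M" and ij: "i \<in> E" "j \<in> E"
  shows "conv (\<phi> i) (\<phi> j) (m ^ p) = conv (d i) (d j) m ^ p"
proof -
  obtain u where u: "Poly_Mapping.keys u \<subseteq> M \<times> M" "\<Delta> m \<approx>\<^sub>2 u"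
    using M(1) m by (auto simp: subcoalgebra_def)
  have EM: "E \<subseteq> M" using E(2) span_superset by auto
  have "\<Delta> m \<approx>\<^sub>2 (\<Sum>k\<in>E \<times> E. fscale (pair (d (fst k)) (d (snd k)) u) (gen k))"
    using teq2_trans[OF u(2) teq2_expand[OF d(1) u(1)]] .
  from conv_power_p[OF this _ _ M(2) \<phi>(1)[of i] \<phi>(1)[of j]]
  have "conv (\<phi> i) (\<phi> j) (m ^ p) =
      (\<Sum>k\<in>E \<times> E. pair (d (fst k)) (d (snd k)) u ^ p * (\<phi> i (fst k ^ p) * \<phi> j (snd k ^ p)))"
    using E(1) EM by auto
  also have "\<dots> = (\<Sum>k\<in>E \<times> E. if k = (i, j) then pair (d i) (d j) u ^ p else 0)"
    using ij by (intro sum.cong) (auto simp: \<phi>(2))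
  also have "\<dots> = conv (d i) (d j) m ^ p"
    using E(1) ij by (simp add: sum.delta conv_eq[OF u(2) d(2) d(2)])
  finally show ?thesis .
qed

text \<open>
  If \<open>a^p\<close> depends on the \<open>p\<close>-th powers of a basis of \<open>M\<close>, then comparing coefficients in the
  comultiplication of \<open>a^p\<close> and taking \<open>p\<close>-th roots corrects \<open>a\<close> by an element of \<open>M\<close> to a primitive
  element. As the field need not be perfect, the roots are taken with \<open>r\<close>.
\<close>

lemma frobenius_dependent_imp_mem:
  assumes M: "subcoalgebra M" "1 \<in> M" "primitives \<subseteq> M"
    and comm: "\<And>x y. x \<in> insert a M \<Longrightarrow> y \<in> insert a M \<Longrightarrow> x * y = y * x"
    and E: "finite E" "independent E" "span E = M" "p_independent E"
    and v: "Poly_Mapping.keys v \<subseteq> M \<times> M" and a: "\<Delta> a \<approx>\<^sub>2 gen (a, 1) + gen (1, a) + v"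
    and dep: "a ^ p = (\<Sum>e\<in>E. c e *s e ^ p)"
  shows "a \<in> M"
proof (rule ccontr)
  assume aM: "a \<notin> M"
  have EM: "E \<subseteq> M" "subspace M" using E(3) span_superset M(1) by (auto simp: subcoalgebra_def)
  obtain d where d: "\<And>e. lf (d e)" "\<And>e e'. e' \<in> E \<Longrightarrow> d e e' = (if e' = e then 1 else 0)"
    "\<And>x. x \<in> M \<Longrightarrow> (\<Sum>e\<in>E. d e x *s e) = x"
    using dual_basis[OF E(1,2)] E(3) by blast
  note E' = p_independent_imp[OF E(1,4)]
  have "\<forall>e. \<exists>f. lf f \<and> (\<forall>e'\<in>E. e \<in> E \<longrightarrow> f (e' ^ p) = (if e' = e then 1 else 0))"
  proof
    fix e
    obtain f where "lf f" "\<forall>y\<in>(\<lambda>e. e ^ p) ` E. f y = (if y = e ^ p then 1 else 0)"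
      using lf_extend[OF E'(2), of "\<lambda>y. if y = e ^ p then 1 else 0"] by blast
    then show "\<exists>f. lf f \<and> (\<forall>e'\<in>E. e \<in> E \<longrightarrow> f (e' ^ p) = (if e' = e then 1 else 0))"
      using E'(1) by (intro exI[of _ f]) (auto dest: inj_onD)
  qed
  then obtain \<phi> where \<phi>: "\<And>e. lf (\<phi> e)" "\<And>e e'. e \<in> E \<Longrightarrow> e' \<in> E \<Longrightarrow> \<phi> e (e' ^ p) = (if e' = e then 1 else 0)"
    by metis
  have \<phi>s: "\<phi> j (\<Sum>e\<in>E. b e *s e ^ p) = b j" if "j \<in> E" for j b
    using that E(1) by (simp add: lf_sum[OF \<phi>(1)] lf_scale[OF \<phi>(1)] \<phi>(2) if_distrib sum.delta cong: if_cong)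
  have \<phi>1: "\<phi> j 1 = d j 1 ^ p" if "j \<in> E" for j
  proof -
    have "(1::'b) = (\<Sum>e\<in>E. d e 1 *s e) ^ p" by (simp add: d(3)[OF M(2)])
    also have "\<dots> = (\<Sum>e\<in>E. d e 1 ^ p *s e ^ p)"
      using EM(1) comm by (intro power_p_sum) auto
    finally show ?thesis using \<phi>s[OF that, of "\<lambda>e. d e 1 ^ p"] by simp
  qed
  obtain r :: "'a \<Rightarrow> 'a" where r: "\<And>x y. r (x + y) = r x + r y" "\<And>c x. r (c ^ p * x) = c * r x" "r 1 = 1"
    using scalar_root_functional by blast
  have r': "r (c ^ p) = c" "r (x * c ^ p) = c * r x" for c x
    using r(2)[of c 1] r(2)[of c x] r(3) by (simp_all add: mult.commute)
  have r0: "r 0 = 0" using r(2)[of 0 0] p_gt_0 by simp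
  have rs: "r (\<Sum>e\<in>X. h e) = (\<Sum>e\<in>X. r (h e))" for h and X :: "'b set"
    by (induction X rule: infinite_finite_induct) (auto simp: r0 r(1))
  \<comment> \<open>The candidate for a \<open>p\<close>-th root of the relation \<open>dep\<close>:
    over a perfect field its coefficients are the roots of the \<open>c e\<close>.\<close>
  define m where "m = (\<Sum>e\<in>E. r (c e) *s e)"
  have mM: "m \<in> M" unfolding m_def using EM by (intro subspace_sum subspace_scale) auto
  have dm: "d i m = r (c i)" if "i \<in> E" for i
    using that E(1) by (simp add: m_def lf_sum[OF d(1)] lf_scale[OF d(1)] d(2) if_distrib sum.delta cong: if_cong)
  \<comment> \<open>\<open>a \<notin> M\<close> keeps the two leading tensors apart from
    \<open>E \<times> E\<close> and from each other.\<close>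
  let ?I = "{(a, 1), (1, a)} \<union> E \<times> E"
  let ?c = "\<lambda>k. if k \<in> E \<times> E then pair (d (fst k)) (d (snd k)) v else 1"
  have disj: "a \<noteq> 1" "a \<notin> E" using aM M(2) EM(1) by auto
  have split: "(\<Sum>k\<in>?I. h k) = h (a, 1) + h (1, a) + (\<Sum>k\<in>E \<times> E. h k)"
    for h :: "'b \<times> 'b \<Rightarrow> 'z::comm_monoid_add"
    using disj E(1) by (subst sum.union_disjoint) auto
  have "\<Delta> a \<approx>\<^sub>2 gen (a, 1) + gen (1, a) + (\<Sum>k\<in>E \<times> E. fscale (pair (d (fst k)) (d (snd k)) v) (gen k))"
    using teq2_trans[OF a teq2_add[OF teq2_refl teq2_expand[OF d(3) v]]] .
  also have "\<dots> = (\<Sum>k\<in>?I. fscale (?c k) (gen k))"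
    unfolding split using disj by (simp cong: sum.cong)
  finally have a': "\<Delta> a \<approx>\<^sub>2 (\<Sum>k\<in>?I. fscale (?c k) (gen k))" .
  \<comment> \<open>The coefficient of \<open>\<Delta> (a ^ p)\<close> at \<open>(i, j)\<close> is
    computed from \<open>a'\<close> and again from \<open>dep\<close>; applying \<open>r\<close> to
    the two results removes all \<open>p\<close>-th powers.\<close>
  have eq: "pair (d i) (d j) v = conv (d i) (d j) m - d i m * d j 1 - d i 1 * d j m"
    if ij: "i \<in> E" "j \<in> E" for i j
  proof -
    have "conv (\<phi> i) (\<phi> j) (a ^ p) = (\<Sum>k\<in>?I. ?c k ^ p * (\<phi> i (fst k ^ p) * \<phi> j (snd k ^ p)))"
      using EM(1) M(2) E(1) by (intro conv_power_p[where A = "insert a M", OF a' _ _ comm \<phi>(1) \<phi>(1)]) auto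
    also have "\<dots> = \<phi> i (a ^ p) * \<phi> j 1 + \<phi> i 1 * \<phi> j (a ^ p) +
        (\<Sum>k\<in>E \<times> E. pair (d (fst k)) (d (snd k)) v ^ p * (\<phi> i (fst k ^ p) * \<phi> j (snd k ^ p)))"
      unfolding split using disj by (simp cong: sum.cong)
    also have "(\<Sum>k\<in>E \<times> E. pair (d (fst k)) (d (snd k)) v ^ p * (\<phi> i (fst k ^ p) * \<phi> j (snd k ^ p))) =
        (\<Sum>k\<in>E \<times> E. if k = (i, j) then pair (d i) (d j) v ^ p else 0)"
      using ij by (intro sum.cong) (auto simp: \<phi>(2))
    also have "\<dots> = pair (d i) (d j) v ^ p" using E(1) ij by (simp add: sum.delta)
    finally have 1: "conv (\<phi> i) (\<phi> j) (a ^ p) = c i * d j 1 ^ p + c j * d i 1 ^ p + pair (d i) (d j) v ^ p"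
      using ij by (simp add: dep \<phi>s \<phi>1)
    have "conv (\<phi> i) (\<phi> j) (a ^ p) = (\<Sum>e\<in>E. c e * conv (\<phi> i) (\<phi> j) (e ^ p))"
      unfolding dep using \<phi>(1) by (simp add: lf_sum[OF lf_conv] lf_scale[OF lf_conv])
    also have "\<dots> = (\<Sum>e\<in>E. c e * conv (d i) (d j) e ^ p)"
    proof (intro sum.cong refl)
      fix e assume "e \<in> E"
      then show "c e * conv (\<phi> i) (\<phi> j) (e ^ p) = c e * conv (d i) (d j) e ^ p"
        using conv_frobenius[OF M(1) _ E(1,3) d(3,1) \<phi> _ ij, of e] comm EM(1) by auto
    qed
    finally have "c i * d j 1 ^ p + c j * d i 1 ^ p + pair (d i) (d j) v ^ p = (\<Sum>e\<in>E. c e * conv (d i) (d j) e ^ p)"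
      using 1 by simp
    from arg_cong[OF this, of r]
    have "d j 1 * r (c i) + d i 1 * r (c j) + pair (d i) (d j) v = (\<Sum>e\<in>E. conv (d i) (d j) e * r (c e))"
      by (simp add: r(1) r' rs)
    also have "\<dots> = conv (d i) (d j) m"
      unfolding m_def using d(1) by (simp add: lf_sum[OF lf_conv] lf_scale[OF lf_conv] mult.commute)
    finally show ?thesis using dm ij by (simp add: algebra_simps)
  qed
  obtain u where u: "Poly_Mapping.keys u \<subseteq> M \<times> M" "\<Delta> m \<approx>\<^sub>2 u"
    using M(1) mM by (auto simp: subcoalgebra_def)
  \<comment> \<open>The reduced comultiplication of \<open>m\<close>. By \<open>eq\<close> it
    represents the same tensor as \<open>v\<close>, so the reduced parts cancel in
    \<open>a - m\<close>.\<close>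
  define w where "w = u - gen (m, 1) - gen (1, m)"
  have "gen (m, 1) \<in> {f. Poly_Mapping.keys f \<subseteq> M \<times> M}" "gen (1, m) \<in> {f. Poly_Mapping.keys f \<subseteq> M \<times> M}"
    "u \<in> {f. Poly_Mapping.keys f \<subseteq> M \<times> M}"
    using mM M(2) u(1) by auto
  then have "w \<in> {f. Poly_Mapping.keys f \<subseteq> M \<times> M}"
    unfolding w_def by (intro fs.subspace_diff[OF subspace_keys])
  then have wk: "Poly_Mapping.keys w \<subseteq> M \<times> M" by simp
  have pw: "pair f g w = conv f g m - f m * g 1 - f 1 * g m" if "lf f" "lf g" for f g
    using conv_eq[OF u(2) that] by (simp add: w_def pair_simps)
  have wv: "pair f g w = pair f g v" if "lf f" "lf g" for f g
  proof -
    have "pair f g w = (\<Sum>k\<in>E \<times> E. pair (d (fst k)) (d (snd k)) w * (f (fst k) * g (snd k)))"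
      by (rule pair_expand[OF d(3) wk that])
    also have "\<dots> = (\<Sum>k\<in>E \<times> E. pair (d (fst k)) (d (snd k)) v * (f (fst k) * g (snd k)))"
      using eq pw[OF d(1) d(1)] by (intro sum.cong) auto
    also have "\<dots> = pair f g v" by (rule pair_expand[OF d(3) v that, symmetric])
    finally show ?thesis .
  qed
  have "a - m \<in> primitives"
    unfolding primitive_iff
  proof (intro allI impI)
    fix f g assume fg: "lf f" "lf g"
    show "conv f g (a - m) = f (a - m) * g 1 + f 1 * g (a - m)"
      using wv[OF fg] pw[OF fg] conv_eq[OF a fg] fg
      by (simp add: lf_diff[OF lf_conv] lf_diff pair_simps algebra_simps)
  qed
  then have "a - m + m \<in> M" using M(3) mM EM(2) subspace_add by blast
  then show False using aM by simp
qed

text \<open>Starting from the span of \<open>1\<close> and the primitives, a subcoalgebra of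
  \<open>B\<close> grows one vector at a time while the \<open>p\<close>-th powers of a basis stay
  independent. The stages need not be closed under multiplication; by
  \<open>frobenius_dependent_imp_mem\<close> the growth ends only at \<open>B\<close>, where
  counting dimensions gives the claim.\<close>

lemma subbialgebra_eq_span_powers:
  assumes B: "subbialgebra B" and comm: "\<And>x y. x \<in> B \<Longrightarrow> y \<in> B \<Longrightarrow> x * y = y * x"
    and prim: "primitives \<subseteq> B" "primitives = span {x ^ p | x. x \<in> primitives}"
  shows "B = span {x ^ p | x. x \<in> B}"
proof -
  have B': "subspace B" "1 \<in> B" "\<And>x y. x \<in> B \<Longrightarrow> y \<in> B \<Longrightarrow> x * y \<in> B" "subcoalgebra B"
    using B by (auto simp: subbialgebra_def subalgebra_def)
  define P where "P M \<longleftrightarrow> subcoalgebra M \<and> 1 \<in> M \<and> primitives \<subseteq> M \<and> M \<subseteq> B \<and>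
    (\<exists>E. finite E \<and> independent E \<and> span E = M \<and> p_independent E)" for M
  have "P (span (insert 1 primitives))"
  proof -
    obtain E where E: "finite E" "independent E" "span E = primitives" "card E = dim primitives"
      by (rule basis_of_subspace[OF subspace_primitives])
    have "p_independent E"
      using p_independent_basis_iff[OF subspace_primitives _ primitive_power_p E(1-3)] prim comm by blast
    have E1: "1 \<notin> span E" using E(3) counit_primitive[of 1] counit_one by auto
    have "p_independent (insert 1 E)"
      unfolding p_independent_def
    proof (intro allI impI)
      fix c assume "(\<Sum>e\<in>insert 1 E. c e *s e ^ p) = 0"
      then have s: "c 1 *s 1 + (\<Sum>e\<in>E. c e *s e ^ p) = 0"
        using E(1) E1 span_base by (subst (asm) sum.insert) auto
      \<comment> \<open>The counit separates \<open>1\<close> from the \<open>p\<close>-th powers of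
        primitives, which are primitive.\<close>
      have "\<epsilon> (e ^ p) = 0" if "e \<in> E" for e
        using that E(3) span_base primitive_power_p counit_primitive by blast
      then have "c 1 = 0" using arg_cong[OF s, of \<epsilon>]
        by (simp add: lf_add[OF lf_counit] lf_sum[OF lf_counit] counit_scale counit_one lf_zero[OF lf_counit])
      moreover from this s have "\<forall>e\<in>E. c e = 0" using \<open>p_independent E\<close> by (simp add: p_independent_def)
      ultimately show "\<forall>e\<in>insert 1 E. c e = 0" by simp
    qed
    moreover have "span (insert 1 E) = span (insert 1 primitives)"
      using E(3) span_superset[of E] span_mono[of "insert 1 E" "insert 1 primitives"] span_mono[of E "insert 1 E"]
      by (intro antisym span_minimal) (auto intro: span_base)
    moreover have "independent (insert 1 E)" using E1 E(2) independent_insertI by blast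
    moreover have "subcoalgebra (span (insert 1 primitives))"
    proof (rule subcoalgebra_span)
      have i: "1 \<in> span (insert 1 primitives)" "\<And>x. x \<in> primitives \<Longrightarrow> x \<in> span (insert 1 primitives)"
        by (auto intro: span_base)
      show "lact f x \<in> span (insert 1 primitives)" "ract f x \<in> span (insert 1 primitives)"
        if "lf f" "x \<in> insert 1 primitives" for f x
        using that i by (auto simp: lact_one ract_one lact_primitive ract_primitive intro!: span_add span_scale)
    qed
    moreover have "span (insert 1 primitives) \<subseteq> B" using prim(1) B' by (intro span_minimal) auto
    ultimately show ?thesis unfolding P_def using E(1) by (auto intro: span_base)
  qed
  then obtain M where M: "P M" "\<And>M'. P M' \<Longrightarrow> M \<subseteq> M' \<Longrightarrow> M' = M"
    by (rule ex_maximal_subspace) (auto simp: P_def subcoalgebra_def)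
  obtain E where E: "finite E" "independent E" "span E = M" "p_independent E"
    and M': "subcoalgebra M" "1 \<in> M" "primitives \<subseteq> M" "M \<subseteq> B" "subspace M"
    using M(1) by (auto simp: P_def subcoalgebra_def)
  have "M = B"
  proof (rule ccontr)
    assume "M \<noteq> B"
    then have "M \<subset> B" using M'(4) by auto
    obtain a v where a: "a \<in> B" "a \<notin> M" and v: "Poly_Mapping.keys v \<subseteq> M \<times> M"
      and da: "\<Delta> a \<approx>\<^sub>2 gen (a, 1) + gen (1, a) + v"
      by (rule subcoalgebra_extension[OF M'(1,2) B'(4) \<open>M \<subset> B\<close>])
    have "subcoalgebra (span (insert a M))"
    proof (rule subcoalgebra_span)
      fix f x assume f: "lf f" and x: "x \<in> insert a M"
      have M_sub: "y \<in> span (insert a M)" if "y \<in> insert a M" for y using that by (rule span_base)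
      have "lin_ext scale (\<lambda>(a, b). f b *s a) v \<in> M" "lin_ext scale (\<lambda>(a, b). f a *s b) v \<in> M"
        using v M'(5) by (auto intro!: lin_ext_in_subspace subspace_scale)
      then have "lact f a \<in> span (insert a M)" "ract f a \<in> span (insert a M)"
        unfolding lact_eq[OF da f] ract_eq[OF da f] using M'(2) M_sub
        by (auto simp: lin_ext_add vector_space_scale intro!: span_add span_scale)
      moreover have "lact f x \<in> M \<and> ract f x \<in> M" if "x \<in> M"
        using M'(1) f that by (auto simp: subcoalgebra_iff right_coideal_def left_coideal_def)
      ultimately show "lact f x \<in> span (insert a M)" "ract f x \<in> span (insert a M)"
        using x M_sub by auto
    qed
    moreover have "span (insert a M) \<subseteq> B" using a M' B'(1) by (intro span_minimal) auto
    moreover have aE: "a \<notin> E" using a(2) E(3) span_base by auto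
    have "p_independent (insert a E)"
      unfolding p_independent_def
    proof (intro allI impI)
      fix c assume "(\<Sum>e\<in>insert a E. c e *s e ^ p) = 0"
      then have s: "c a *s a ^ p + (\<Sum>e\<in>E. c e *s e ^ p) = 0" using E(1) aE by simp
      have "c a = 0"
      proof (rule ccontr)
        assume ca: "c a \<noteq> 0"
        have "a ^ p = (- inverse (c a)) *s (\<Sum>e\<in>E. c e *s e ^ p)"
          using s ca by (simp add: eq_neg_iff_add_eq_0[symmetric] minus_equation_iff)
            (metis (no_types, lifting) add.inverse_inverse left_inverse scale_minus_right scale_one scale_scale)
        then have "a ^ p = (\<Sum>e\<in>E. (- inverse (c a) * c e) *s e ^ p)"
          by (simp add: scale_sum_right sum_negf)
        from frobenius_dependent_imp_mem[OF M'(1-3) _ E v da this] show False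
          using comm a M'(4) by (metis insertE subsetD)
      qed
      moreover from this s have "\<forall>e\<in>E. c e = 0" using E(4) by (simp add: p_independent_def)
      ultimately show "\<forall>e\<in>insert a E. c e = 0" by simp
    qed
    moreover have "span (insert a E) = span (insert a M)"
      using E(3) span_superset[of E] span_mono[of "insert a E" "insert a M"] span_mono[of E "insert a E"]
      by (intro antisym span_minimal) (auto intro: span_base)
    moreover have "independent (insert a E)" using a(2) E(2,3) independent_insertI by blast
    moreover have "M \<subseteq> span (insert a M)" by (auto intro: span_base)
    ultimately have "P (span (insert a M))" unfolding P_def using E(1) M'(2,3) by blast
    from M(2)[OF this] show False using a(2) span_base[of a "insert a M"] \<open>M \<subseteq> span (insert a M)\<close> by auto
  qed
  moreover have "x ^ p \<in> B" if "x \<in> B" for x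
  proof -
    have "x ^ n \<in> B" for n using that B' by (induction n) auto
    then show ?thesis .
  qed
  ultimately show ?thesis
    using p_independent_basis_iff[OF B'(1) comm _ E(1,2)] E(3,4) by blast
qed

end

context char_p_hopf_algebra
begin

lemma primitives_one:
  "x \<in> primitives \<Longrightarrow> \<Delta> x \<approx>\<^sub>2 gen (x, 1) + gen (1, x) + 0"
  by (simp add: primitives_def)

text \<open>
  A maximal commutative sub-bialgebra \<open>A\<close> containing the primitives is everything: otherwise take
  \<open>x\<close> outside with \<open>\<Delta> x - x \<otimes> 1 - 1 \<otimes> x\<close> in \<open>A \<otimes> A\<close>. The commutator with \<open>x\<close> maps suitable generators of \<open>A\<close>
  to primitives, so it kills \<open>p\<close>-th powers, and these span.
\<close>

lemma commutative:
  fixes x y :: 'b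
  assumes ab: "\<And>x y. x \<in> primitives \<Longrightarrow> y \<in> primitives \<Longrightarrow> x * y = y * x"
    and prim: "primitives = span {x ^ p | x. x \<in> primitives}"
  shows "x * y = y * x"
proof -
  let ?U = "alg primitives"
  have U: "subbialgebra ?U" "primitives \<subseteq> ?U" by (rule subbialgebra_alg_primitives, rule alg_superset)
  let ?P = "\<lambda>A. subbialgebra A \<and> primitives \<subseteq> A \<and> (\<forall>x\<in>A. \<forall>y\<in>A. x * y = y * x)"
  have "?P ?U" using U alg_commute[OF ab] by blast
  then obtain A where A: "?P A" "\<And>A'. ?P A' \<Longrightarrow> A \<subseteq> A' \<Longrightarrow> A' = A"
    by (rule ex_maximal_subspace) (auto simp: subbialgebra_def subalgebra_def)
  have A': "subalgebra A" "subcoalgebra A" "1 \<in> A" "primitives \<subseteq> A" "?U \<subseteq> A"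
    and Ac: "\<And>x y. x \<in> A \<Longrightarrow> y \<in> A \<Longrightarrow> x * y = y * x"
    using A(1) alg_minimal[of A primitives] by (auto simp: subbialgebra_def subalgebra_def)
  have "A = UNIV"
  proof (rule ccontr)
    assume "A \<noteq> UNIV"
    then have "A \<subset> UNIV" by auto
    obtain x u where x: "x \<in> UNIV" "x \<notin> A" and u: "Poly_Mapping.keys u \<subseteq> A \<times> A"
      and dx: "\<Delta> x \<approx>\<^sub>2 gen (x, 1) + gen (1, x) + u"
      by (rule subcoalgebra_extension[OF A'(2,3) subcoalgebra_UNIV \<open>A \<subset> UNIV\<close>])
    \<comment> \<open>\<open>[x, y]\<close> is primitive, hence commutes with \<open>y\<close>, so
      \<open>y ^ p\<close> commutes with \<open>x\<close>; such powers span the primitives.\<close>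
    have xp: "x * y ^ p = y ^ p * x" if y: "y \<in> primitives" for y
    proof (rule commute_power_p)
      have "x * y - y * x \<in> primitives"
        by (rule commutator_primitive[OF dx primitives_one[OF y] u, of "{}"]) (use y A'(4) Ac in auto)
      then show "y * (x * y - y * x) = (x * y - y * x) * y" using ab y by blast
    qed
    have xprim: "x * y = y * x" if "y \<in> primitives" for y
    proof (rule span_commute)
      show "y \<in> span {y ^ p | y. y \<in> primitives}" using that prim by blast
    qed (use xp in auto)
    \<comment> \<open>A second maximal choice, inside \<open>A\<close>:
      \<open>commutator_primitive\<close> applies to a new \<open>a\<close> once the entries of its
      \<open>v\<close> commute with \<open>x\<close>.\<close>
    let ?Q = "\<lambda>B. subbialgebra B \<and> primitives \<subseteq> B \<and> B \<subseteq> A \<and> (\<forall>b\<in>B. x * b = b * x)"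
    have "x * b = b * x" if "b \<in> ?U" for b
      using alg_commute[of "{x}" primitives x b] xprim that alg_superset[of "{x}"] by auto
    then have "?Q ?U" using U A'(5) by blast
    then obtain B where B: "?Q B" "\<And>B'. ?Q B' \<Longrightarrow> B \<subseteq> B' \<Longrightarrow> B' = B"
      by (rule ex_maximal_subspace) (auto simp: subbialgebra_def subalgebra_def)
    have B': "subcoalgebra B" "1 \<in> B" "primitives \<subseteq> B" "B \<subseteq> A" "\<And>b. b \<in> B \<Longrightarrow> x * b = b * x"
      using B(1) by (auto simp: subbialgebra_def subalgebra_def)
    have "B = A"
    proof (rule ccontr)
      assume "B \<noteq> A"
      then have "B \<subset> A" using B'(4) by auto
      obtain a v where a: "a \<in> A" "a \<notin> B" and v: "Poly_Mapping.keys v \<subseteq> B \<times> B"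
        and da: "\<Delta> a \<approx>\<^sub>2 gen (a, 1) + gen (1, a) + v"
        by (rule subcoalgebra_extension[OF B'(1,2) A'(2) \<open>B \<subset> A\<close>])
      have xa: "x * a - a * x \<in> primitives"
        by (rule commutator_primitive[OF dx da u v]) (use B' a(1) Ac in auto)
      define C where "C = alg (insert a B)"
      have C: "subbialgebra C" "insert a B \<subseteq> C" "C \<subseteq> A"
        unfolding C_def using subbialgebra_adjoin[OF _ v da] B(1) alg_superset alg_minimal[of A "insert a B"] A'(1) a(1) B'(4)
        by auto
      have C': "subspace C" "1 \<in> C" "\<And>x y. x \<in> C \<Longrightarrow> y \<in> C \<Longrightarrow> x * y \<in> C"
        using C(1) by (auto simp: subbialgebra_def subalgebra_def)
      \<comment> \<open>The derivation \<open>[x, _]\<close> preserves \<open>C\<close> because it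
        does so on generators; therefore \<open>[x, z]\<close> commutes with \<open>z\<close> for
        every \<open>z\<close> in \<open>C\<close>, as \<open>commute_power_p\<close>
        requires.\<close>
      have "subalgebra {z \<in> C. x * z - z * x \<in> C}"
        unfolding subalgebra_def subspace_def
      proof (intro conjI ballI allI; clarify)
        show "0 \<in> C \<and> x * 0 - 0 * x \<in> C" "1 \<in> C \<and> x * 1 - 1 * x \<in> C"
          using C' by (auto simp: subspace_0)
        fix y z assume yz: "y \<in> C" "z \<in> C" "x * y - y * x \<in> C" "x * z - z * x \<in> C"
        have "x * (y + z) - (y + z) * x = (x * y - y * x) + (x * z - z * x)"
          "x * (y * z) - y * z * x = (x * y - y * x) * z + y * (x * z - z * x)"
          by (simp_all add: algebra_simps)
        then show "y + z \<in> C \<and> x * (y + z) - (y + z) * x \<in> C" "y * z \<in> C \<and> x * (y * z) - y * z * x \<in> C"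
          using yz C' by (auto simp: subspace_add)
      next
        fix c y assume y: "y \<in> C" "x * y - y * x \<in> C"
        have "x * (c *s y) - (c *s y) * x = c *s (x * y - y * x)"
          by (simp add: scale_mult_left scale_mult_right scale_right_diff_distrib)
        then show "c *s y \<in> C \<and> x * (c *s y) - (c *s y) * x \<in> C"
          using y C' by (auto simp: subspace_scale)
      qed
      moreover have "insert a B \<subseteq> {z \<in> C. x * z - z * x \<in> C}"
        using C(2) xa B'(3,5) subspace_0[OF C'(1)] by auto
      ultimately have D: "C \<subseteq> {z \<in> C. x * z - z * x \<in> C}"
        using alg_minimal unfolding C_def by blast
      have xz: "x * z ^ p = z ^ p * x" if "z \<in> C" for z
        using that D C(3) by (intro commute_power_p Ac) auto
      have Cp: "C = span {z ^ p | z. z \<in> C}"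
      proof (rule subbialgebra_eq_span_powers[OF C(1) _ _ prim])
        show "y * z = z * y" if "y \<in> C" "z \<in> C" for y z using that C(3) Ac by blast
      qed (use C(2) B'(3) in auto)
      have "x * z = z * x" if "z \<in> C" for z
      proof (rule span_commute)
        show "z \<in> span {z ^ p | z. z \<in> C}" using that Cp by blast
      qed (use xz in auto)
      then have "C = B" using B(2)[of C] C B'(3) by auto
      then show False using a(2) C(2) by auto
    qed
    then have xA: "x * b = b * x" if "b \<in> A" for b using B'(5) that by simp
    have "subbialgebra (alg (insert x A))" using subbialgebra_adjoin[OF _ u dx] A(1) by blast
    moreover have "y * z = z * y" if "y \<in> alg (insert x A)" "z \<in> alg (insert x A)" for y z
    proof (rule alg_commute[OF _ that])
      show "b * c = c * b" if "b \<in> insert x A" "c \<in> insert x A" for b c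
        using that xA[of b] xA[of c] Ac[of b c] by auto
    qed
    moreover have "insert x A \<subseteq> alg (insert x A)" by (rule alg_superset)
    ultimately have "alg (insert x A) = A" using A(2)[of "alg (insert x A)"] A'(4) by auto
    then show False using x(2) alg_superset[of "insert x A"] by auto
  qed
  then show ?thesis using Ac by auto
qed

text \<open>A nonzero \<open>x\<close> belongs to a basis whose \<open>p\<close>-th powers are
  independent, so \<open>x ^ p \<noteq> 0\<close>; but \<open>x * x = 0\<close> would give
  \<open>x ^ p = 0\<close> because \<open>p \<ge> 2\<close>. So \<open>B\<close> is reduced.\<close>

lemma semisimple_subbialgebra:
  assumes B: "subbialgebra B" "primitives \<subseteq> B" and comm: "\<And>x y :: 'b. x * y = y * x"
    and prim: "primitives = span {x ^ p | x. x \<in> primitives}"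
  shows "semisimple B"
proof (rule semisimple_if_reduced)
  show "subalgebra B" using B(1) by (simp add: subbialgebra_def)
  then have B': "subspace B" "1 \<in> B" "\<And>x y. x \<in> B \<Longrightarrow> y \<in> B \<Longrightarrow> x * y \<in> B"
    by (auto simp: subalgebra_def)
  have pow: "x ^ p \<in> B" if "x \<in> B" for x
  proof -
    have "x ^ n \<in> B" for n using that B' by (induction n) auto
    then show ?thesis .
  qed
  fix x assume x: "x \<in> B" "x * x = 0"
  show "x = 0"
  proof (rule ccontr)
    assume "x \<noteq> 0"
    have i: "{x} \<subseteq> B" "independent {x}" using x \<open>x \<noteq> 0\<close> by auto
    obtain E where E: "{x} \<subseteq> E" "E \<subseteq> B" "independent E" "B \<subseteq> span E"
      by (rule maximal_independent_subset_extend[OF i])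
    have fin: "finite E" using finiteI_independent[OF E(3)] .
    have "span E = B" using E(2,4) B'(1) span_subspace by blast
    then have pE: "p_independent E"
      using p_independent_basis_iff[OF B'(1) comm pow fin E(3)] subbialgebra_eq_span_powers[OF B(1) comm B(2) prim]
      by blast
    have "p = 2 + (p - 2)" using prime_ge_2_nat[OF prime_p] by simp
    then have "x ^ p = x * x * x ^ (p - 2)" by (metis power_add power2_eq_square)
    then have "(\<Sum>e\<in>E. (if e = x then 1 else 0) *s e ^ p) = 0"
      using x(2) by (intro sum.neutral) auto
    then have "\<forall>e\<in>E. (if e = x then 1 else 0 :: 'a) = 0"
      using pE[unfolded p_independent_def, THEN spec[where x = "\<lambda>e. if e = x then 1 else 0"]] by (rule rev_mp)
    then show False using E(1) by auto
  qed
qed (rule comm)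

section \<open>Descending integrals to the subalgebra generated by the primitives\<close>

text \<open>Modulo \<open>M\<close>, the vector \<open>a\<close> behaves under the action like
  \<open>1\<close>. As \<open>M\<close> is stable under \<open>U\<close>, right multiplication by
  \<open>a\<close> is compatible with \<open>lact\<close> modulo \<open>M\<close>.\<close>

lemma lact_mult_diff:
  assumes U: "subcoalgebra U" "b \<in> U" and M: "subspace M" "\<And>c m. c \<in> U \<Longrightarrow> m \<in> M \<Longrightarrow> c * m \<in> M"
    and a: "\<And>f. lf f \<Longrightarrow> lact f a - f 1 *s a \<in> M" and f: "lf f"
  shows "lact f (b * a) - lact f b * a \<in> M"
proof -
  obtain u where u: "Poly_Mapping.keys u \<subseteq> U \<times> U" "\<Delta> b \<approx>\<^sub>2 u"
    using U by (auto simp: subcoalgebra_def)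
  let ?r = "\<lambda>(c, d). c * (lact (\<lambda>z. f (d * z)) a - f d *s a)"
  have "lact f b * a = lin_ext scale (\<lambda>(c, d). (f d *s c) * a) u"
    unfolding lact_eq[OF u(2) f]
    by (subst linear_lin_ext[of scale scale "\<lambda>y. y * a"])
      (simp_all add: Vector_Spaces.linear_iff vector_space_scale distrib_right scale_mult_left case_prod_unfold)
  moreover have "lact f (b * a) = lin_ext scale (\<lambda>k. (case k of (c, d) \<Rightarrow> (f d *s c) * a) + ?r k) u"
    unfolding lact_mult[OF u(2) f]
    by (intro lin_ext_cong) (auto simp: algebra_simps scale_mult_left scale_mult_right)
  ultimately have "lact f (b * a) - lact f b * a = lin_ext scale ?r u"
    by (simp add: lin_ext_add_right vector_space_scale)
  moreover have "lin_ext scale ?r u \<in> M"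
  proof (rule lin_ext_in_subspace[OF M(1)])
    fix k assume "k \<in> Poly_Mapping.keys u"
    then obtain c d where "k = (c, d)" "c \<in> U" using u(1) by auto
    then show "?r k \<in> M" using M(2) a[OF lf_mult(1)[OF f], of d] by simp
  qed
  ultimately show ?thesis by simp
qed

text \<open>
  The whole algebra is a free left module over \<open>U = alg primitives\<close>, built up through
  a chain of right coideals; an element killed by the primitives has coordinates killed by them.
\<close>

lemma invariant_descent:
  assumes \<Lambda>: "\<And>x. x \<in> primitives \<Longrightarrow> x * \<Lambda> = 0" "\<epsilon> \<Lambda> \<noteq> 0"
  shows "\<exists>t\<in>alg primitives. (\<forall>x\<in>primitives. x * t = 0) \<and> \<epsilon> t \<noteq> 0"
proof -
  define U where "U = alg primitives"
  have U: "subspace U" "1 \<in> U" "\<And>x y. x \<in> U \<Longrightarrow> y \<in> U \<Longrightarrow> x * y \<in> U" "subcoalgebra U" "primitives \<subseteq> U" "right_coideal U"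
    using subbialgebra_alg_primitives alg_superset[of primitives]
    by (auto simp: U_def subbialgebra_def subalgebra_def subcoalgebra_iff)
  define Q where "Q = {b \<in> U. \<forall>x\<in>primitives. x * b = 0}"
  define QH where "QH = span {q * h | q h. q \<in> Q}"
  \<comment> \<open>Asking that the invariants of \<open>M\<close> lie in \<open>QH\<close> passes
    through extensions without naming a basis of the free module.\<close>
  define P where "P M \<longleftrightarrow> right_coideal M \<and> (\<forall>b\<in>U. \<forall>m\<in>M. b * m \<in> M) \<and>
    (\<forall>m\<in>M. (\<forall>x\<in>primitives. x * m = 0) \<longrightarrow> m \<in> QH)" for M
  have "P {0}" using right_coideal_zero by (auto simp: P_def QH_def span_zero)
  then obtain M where M: "P M" "\<And>M'. P M' \<Longrightarrow> M \<subseteq> M' \<Longrightarrow> M' = M"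
    by (rule ex_maximal_subspace) (auto simp: P_def right_coideal_def)
  have M': "right_coideal M" "subspace M" "\<And>b m. b \<in> U \<Longrightarrow> m \<in> M \<Longrightarrow> b * m \<in> M"
    "\<And>m. m \<in> M \<Longrightarrow> (\<And>x. x \<in> primitives \<Longrightarrow> x * m = 0) \<Longrightarrow> m \<in> QH"
    using M(1) by (auto simp: P_def right_coideal_def)
  have "M = UNIV"
  proof (rule ccontr)
    assume "M \<noteq> UNIV"
    then obtain a where a: "a \<notin> M" "\<And>f. lf f \<Longrightarrow> lact f a - f 1 *s a \<in> M"
      using right_coideal_extension[OF M'(1) right_coideal_UNIV] by auto
    have diff: "lact f (b * a) - lact f b * a \<in> M" if "b \<in> U" "lf f" for b f
      using lact_mult_diff[OF U(4) that(1) M'(2,3) a(2) that(2)] .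
    define N where "N = {b \<in> U. b * a \<in> M}"
    have "right_coideal N"
      unfolding right_coideal_def
    proof (intro conjI allI impI)
      show "subspace N" using U(1) M'(2)
        by (auto simp: N_def subspace_def distrib_right scale_mult_left)
      fix f b assume f: "lf f" and b: "b \<in> N"
      have "lact f (b * a) \<in> M" "lact f b \<in> U" using b f M'(1) U(6) by (auto simp: N_def right_coideal_def)
      moreover have "lact f b * a = lact f (b * a) - (lact f (b * a) - lact f b * a)" by simp
      ultimately show "lact f b \<in> N"
        using diff[of b f] b f subspace_diff[OF M'(2)] unfolding N_def by (metis (no_types, lifting) mem_Collect_eq)
    qed
    \<comment> \<open>A nonzero right coideal contains a nonzero multiple of \<open>1\<close>, which
      would put \<open>a\<close> in \<open>M\<close>. So \<open>b \<mapsto> b * a\<close> is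
      injective modulo \<open>M\<close>, which is the freeness.\<close>
    have "N = {0}"
    proof (rule ccontr)
      assume "N \<noteq> {0}"
      then have "{0} \<subset> N" using \<open>right_coideal N\<close> by (auto simp: right_coideal_def subspace_0)
      then obtain n where n: "n \<in> N" "n \<noteq> 0" "\<And>f. lf f \<Longrightarrow> lact f n = f 1 *s n"
        using right_coideal_extension[OF right_coideal_zero \<open>right_coideal N\<close>] by auto
      have "n = \<epsilon> n *s 1"
      proof (rule lf_eqI)
        fix f assume f: "lf f"
        have "f n = \<epsilon> (lact f n)" using f by (simp add: lf_lact)
        then show "f n = f (\<epsilon> n *s 1)" using f n(3)[OF f] by (simp add: counit_scale lf_scale mult.commute)
      qed
      then have "n * a = \<epsilon> n *s a" "\<epsilon> n \<noteq> 0" using n(2) by (metis mult_1 scale_mult_left, auto)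
      then have "a = inverse (\<epsilon> n) *s (n * a)" by simp
      then show False using n(1) a(1) M'(2) by (metis (no_types, lifting) N_def mem_Collect_eq subspace_scale)
    qed
    then have inj: "b = 0" if "b \<in> U" "b * a \<in> M" for b using that by (auto simp: N_def)
    define M1 where "M1 = {b * a + m | b m. b \<in> U \<and> m \<in> M}"
    have M1I: "b * a + m \<in> M1" if "b \<in> U" "m \<in> M" for b m using that by (auto simp: M1_def)
    have "P M1"
      unfolding P_def right_coideal_def
    proof (intro conjI ballI allI impI)
      show "subspace M1"
      proof (rule subspaceI)
        show "0 \<in> M1" using M1I[of 0 0] U(1) M'(2) by (simp add: subspace_0)
        fix x assume "x \<in> M1"
        then obtain b m where x: "x = b * a + m" "b \<in> U" "m \<in> M" by (auto simp: M1_def)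
        have "c *s x = (c *s b) * a + c *s m" for c by (simp add: x scale_right_distrib scale_mult_left)
        then show "c *s x \<in> M1" for c using x U(1) M'(2) by (metis M1I subspace_scale)
        fix y assume "y \<in> M1"
        then obtain b' m' where y: "y = b' * a + m'" "b' \<in> U" "m' \<in> M" by (auto simp: M1_def)
        have "x + y = (b + b') * a + (m + m')" by (simp add: x y algebra_simps)
        then show "x + y \<in> M1" using x y U(1) M'(2) by (metis M1I subspace_add)
      qed
      fix x assume "x \<in> M1"
      then obtain b m where x: "x = b * a + m" "b \<in> U" "m \<in> M" by (auto simp: M1_def)
      show "lact f x \<in> M1" if f: "lf f" for f
      proof -
        have "lact f x = lact f b * a + ((lact f (b * a) - lact f b * a) + lact f m)"
          using f by (simp add: x lact_add)
        moreover have "lact f b \<in> U" "lact f m \<in> M" using f x U(6) M'(1) by (auto simp: right_coideal_def)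
        ultimately show ?thesis using M1I diff[OF x(2) f] subspace_add[OF M'(2)] by metis
      qed
      show "c * x \<in> M1" if "c \<in> U" for c
        using M1I[of "c * b" "c * m"] U(3) M'(3) that x by (simp add: distrib_left mult.assoc)
      assume inv: "\<forall>y\<in>primitives. y * x = 0"
      \<comment> \<open>Modulo \<open>M\<close> the invariance of \<open>x\<close> reads
        \<open>y * b * a = 0\<close>, and injectivity passes this on to
        \<open>y * b\<close>.\<close>
      have yb: "y * b = 0" if y: "y \<in> primitives" for y
      proof (rule inj)
        have "y \<in> U" using y U(5) by auto
        then show "y * b \<in> U" using U(3) x(2) by blast
        have "y * (b * a + m) = 0" using inv y x(1) by blast
        then have "(y * b) * a = - (y * m)" by (simp add: distrib_left mult.assoc eq_neg_iff_add_eq_0)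
        then show "y * b * a \<in> M" using M'(3)[OF \<open>y \<in> U\<close> x(3)] subspace_neg[OF M'(2)] by simp
      qed
      then have "b * a \<in> QH" unfolding QH_def Q_def using x(2) by (intro span_base) auto
      moreover have "m \<in> QH"
      proof (rule M'(4)[OF x(3)])
        fix y assume y: "y \<in> primitives"
        have "y * (b * a + m) = 0" using inv y x(1) by blast
        then show "y * m = 0" using yb[OF y] by (simp add: distrib_left flip: mult.assoc)
      qed
      ultimately show "x \<in> QH" unfolding x(1) QH_def by (rule span_add)
    qed
    moreover have "M \<subseteq> M1" using M1I[of 0] U(1) by (auto simp: subspace_0)
    ultimately have "M1 = M" by (rule M(2))
    then show False using M1I[OF U(2), of 0] M'(2) a(1) by (simp add: subspace_0)
  qed
  then have "\<Lambda> \<in> QH" using M'(4) \<Lambda>(1) by auto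
  \<comment> \<open>\<open>\<epsilon>\<close> is multiplicative, so it would vanish on all of
    \<open>QH\<close> if it vanished on \<open>Q\<close>.\<close>
  have "\<exists>q\<in>Q. \<epsilon> q \<noteq> 0"
  proof (rule ccontr)
    assume "\<not> ?thesis"
    then have "\<epsilon> x = 0" if "x \<in> {q * h | q h. q \<in> Q}" for x using that by (auto simp: counit_mult)
    then have "\<epsilon> \<Lambda> = 0"
      using linear_zero_on_span[of scale "(*)" \<epsilon> "{q * h | q h. q \<in> Q}" \<Lambda>] \<open>\<Lambda> \<in> QH\<close> lf_counit
      unfolding lf_linear QH_def by blast
    then show False using \<Lambda>(2) by simp
  qed
  then show ?thesis by (auto simp: Q_def U_def)
qed

end

section \<open>Integrals force abelian primitives spanned by \<open>p\<close>-th powers\<close>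

context finite_dimensional_hopf_algebra
begin

lemma alg_primitives_induct [consumes 1, case_names subspace one mult]:
  assumes y: "y \<in> alg primitives" and P: "subspace {y. P y}" "P 1"
    and mult: "\<And>x y. x \<in> primitives \<Longrightarrow> y \<in> alg primitives \<Longrightarrow> P y \<Longrightarrow> P (x * y)"
  shows "P y"
proof -
  have l: "P (prod_list xs) \<and> prod_list xs \<in> alg primitives" if "set xs \<subseteq> primitives" for xs
    using that
  proof (induction xs)
    case Nil then show ?case using P(2) subalgebra_alg[of primitives] by (simp add: subalgebra_def)
  next
    case (Cons x xs)
    then show ?case
      using mult[of x "prod_list xs"] subalgebra_alg[of primitives] alg_superset[of primitives]
      by (auto simp: subalgebra_def)
  qed
  then have "alg primitives \<subseteq> {y. P y}"
    unfolding alg_def using P(1) by (intro span_minimal) auto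
  then show ?thesis using y by auto
qed

text \<open>\<open>U\<close> is cocommutative because its generators are. The Leibniz rule carries
  the symmetry from \<open>y\<close> to \<open>x * y\<close>; it changes the functionals, so the
  induction treats all of them at once.\<close>

lemma conv_commute:
  assumes "a \<in> alg primitives" "lf f" "lf g"
  shows "conv f g a = conv g f a"
proof -
  have "\<forall>f g. lf f \<longrightarrow> lf g \<longrightarrow> conv f g a = conv g f a" using assms(1)
  proof (induction rule: alg_primitives_induct)
    case subspace
    show ?case
      by (auto simp: subspace_def lf_add[OF lf_conv] lf_scale[OF lf_conv] lf_zero[OF lf_conv])
  next
    case (mult x y)
    then show ?case by (auto simp: conv_primitive_mult lf_mult)
  qed auto
  then show ?thesis using assms by blast
qed

primrec convs :: "('h \<Rightarrow> 'k) list \<Rightarrow> 'h \<Rightarrow> 'k"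
  where "convs [] = \<epsilon>" | "convs (f # fs) = conv f (convs fs)"

lemma lf_convs [simp]: "(\<And>f. f \<in> set fs \<Longrightarrow> lf f) \<Longrightarrow> lf (convs fs)"
  by (induction fs) auto

lemma convs_append:
  assumes "\<And>f. f \<in> set (fs @ gs) \<Longrightarrow> lf f"
  shows "convs (fs @ gs) = conv (convs fs) (convs gs)"
  using assms
proof (induction fs)
  case (Cons f fs)
  have l: "lf f" "lf (convs fs)" "lf (convs gs)" using Cons.prems by auto
  have "convs ((f # fs) @ gs) = conv f (conv (convs fs) (convs gs))" using Cons by simp
  also have "\<dots> = conv (conv f (convs fs)) (convs gs)" by (rule ext) (simp add: conv_assoc l)
  finally show ?case by simp
qed simp

lemma convs_append_commute:
  assumes "a \<in> alg primitives" "\<And>f. f \<in> set (fs @ gs) \<Longrightarrow> lf f"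
  shows "convs (fs @ gs) a = convs (gs @ fs) a"
proof -
  have "convs (fs @ gs) a = conv (convs fs) (convs gs) a" using assms(2) by (subst convs_append) auto
  also have "\<dots> = conv (convs gs) (convs fs) a" using assms(2) by (intro conv_commute[OF assms(1)]) auto
  also have "\<dots> = convs (gs @ fs) a" using assms(2) by (subst convs_append) auto
  finally show ?thesis .
qed

lemma convs_one: "(\<And>f. f \<in> set fs \<Longrightarrow> lf f) \<Longrightarrow> convs fs 1 = prod_list (map (\<lambda>f. f 1) fs)"
  by (induction fs) (auto simp: counit_one)

lemma convs_primitive_mult:
  assumes x: "x \<in> primitives" and "\<And>f. f \<in> set fs \<Longrightarrow> lf f"
  shows "convs fs (x * a) = (\<Sum>j<length fs. convs (fs[j := (\<lambda>z. (fs ! j) (x * z))]) a)"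
  using assms(2)
proof (induction fs arbitrary: a)
  case Nil
  then show ?case using counit_primitive[OF x] by (simp add: counit_mult)
next
  case (Cons f fs)
  have "convs (f # fs) (x * a) = conv (\<lambda>z. f (x * z)) (convs fs) a + conv f (\<lambda>z. convs fs (x * z)) a"
    using Cons.prems by (simp add: conv_primitive_mult[OF x])
  also have "(\<lambda>z. convs fs (x * z)) = (\<lambda>z. \<Sum>j<length fs. convs (fs[j := (\<lambda>z. (fs ! j) (x * z))]) z)"
    using Cons by (auto simp: fun_eq_iff)
  finally show ?case
    by (simp add: conv_sum sum.lessThan_Suc_shift del: sum.lessThan_Suc)
qed

text \<open>The power rule \<open>D (f^n) = n (D f) f^{n-1}\<close> for the derivation given by
  \<open>x\<close>. Commutativity brings the differentiated factor to the front.\<close>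

lemma convs_replicate_primitive_mult:
  assumes x: "x \<in> primitives" and f: "lf f" and a: "a \<in> alg primitives"
  shows "convs (replicate n f) (x * a) = of_nat n * convs ((\<lambda>z. f (x * z)) # replicate (n - 1) f) a"
proof -
  have "convs ((replicate n f)[j := g]) a = convs (g # replicate (n - 1) f) a" if j: "j < n" and g: "lf g" for j g
  proof -
    have "(replicate n f)[j := g] = replicate j f @ (g # replicate (n - 1 - j) f)"
      using j by (intro nth_equalityI) (auto simp: nth_append nth_Cons' nth_list_update)
    then have "convs ((replicate n f)[j := g]) a = convs ((g # replicate (n - 1 - j) f) @ replicate j f) a"
      using convs_append_commute[OF a, of "replicate j f" "g # replicate (n - 1 - j) f"] f g by auto
    also have "replicate (n - 1 - j) f @ replicate j f = replicate (n - 1) f"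
      using j by (simp flip: replicate_add)
    then have "(g # replicate (n - 1 - j) f) @ replicate j f = g # replicate (n - 1) f" by simp
    finally show ?thesis .
  qed
  then have "(\<Sum>j<n. convs ((replicate n f)[j := (\<lambda>z. (replicate n f ! j) (x * z))]) a) =
      (\<Sum>j<n. convs ((\<lambda>z. f (x * z)) # replicate (n - 1) f) a)"
    using f by (intro sum.cong) (simp_all add: lf_mult)
  then show ?thesis using convs_primitive_mult[OF x, of "replicate n f" a] f by simp
qed

end

context char_p_hopf_algebra
begin

text \<open>Frobenius on the dual of \<open>U\<close>: by the power rule all primitives kill a
  \<open>p\<close>-th power, so it is a multiple of the counit.\<close>

lemma convs_replicate_p:
  assumes a: "a \<in> alg primitives" and f: "lf f"
  shows "convs (replicate p f) a = f 1 ^ p * \<epsilon> a"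
  using a
proof (induction rule: alg_primitives_induct)
  case subspace
  have l: "lf (convs (replicate p f))" using f by (intro lf_convs) auto
  show ?case
    by (auto simp: subspace_def lf_add[OF l] lf_scale[OF l] lf_zero[OF l] counit_add counit_scale lf_zero[OF lf_counit] algebra_simps)
next
  case one
  show ?case using f by (subst convs_one) (auto simp: counit_one prod_list_replicate)
next
  case (mult x y)
  then show ?case
    using convs_replicate_primitive_mult[OF mult(1) f mult(2), of p] counit_primitive[OF mult(1)] of_nat_p_scalar
    by (simp add: counit_mult)
qed

text \<open>The Leibniz rule for \<open>x ^ n\<close> on a product of \<open>p\<close> derivatives
  of \<open>z\<close>: a letter \<open>j\<close> of the word says that the corresponding copy of
  \<open>x\<close> hits factor \<open>j\<close>. Letters are integers since they will be subtracted
  modulo \<open>p\<close>.\<close>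

lemma convs_power_words:
  assumes x: "x \<in> primitives" and z: "lf z"
  defines "C \<equiv> \<lambda>m. convs (map (\<lambda>i y. z (x ^ m i * y)) [0..<p])"
  shows "C m (x ^ n * a) = (\<Sum>w | set w \<subseteq> {0..<int p} \<and> length w = n. C (\<lambda>i. m i + count_list w (int i)) a)"
proof (induction n arbitrary: m)
  case 0
  have "{w. set w \<subseteq> {0..<int p} \<and> length w = 0} = {[]}" by auto
  then show ?case by simp
next
  case (Suc n)
  let ?W = "{w. set w \<subseteq> {0..<int p} \<and> length w = n}"
  have step: "C m (x * b) = (\<Sum>j<p. C (m(j := Suc (m j))) b)" for m b
  proof -
    let ?l = "map (\<lambda>i y. z (x ^ m i * y)) [0..<p]"
    have "C m (x * b) = (\<Sum>j<p. convs (?l[j := (\<lambda>y. (?l ! j) (x * y))]) b)"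
      unfolding C_def using z by (subst convs_primitive_mult[OF x]) (auto simp: lf_mult)
    also have "\<dots> = (\<Sum>j<p. C (m(j := Suc (m j))) b)"
    proof (rule sum.cong[OF refl])
      fix j assume j: "j \<in> {..<p}"
      have "x ^ m j * (x * y) = x ^ Suc (m j) * y" for y
        by (metis mult.assoc power_Suc2)
      then have "?l[j := (\<lambda>y. (?l ! j) (x * y))] = map (\<lambda>i y. z (x ^ (m(j := Suc (m j))) i * y)) [0..<p]"
        using j by (intro nth_equalityI) (auto simp: nth_list_update fun_eq_iff)
      then show "convs (?l[j := (\<lambda>y. (?l ! j) (x * y))]) b = C (m(j := Suc (m j))) b"
        by (simp add: C_def)
    qed
    finally show ?thesis .
  qed
  have m: "(\<lambda>i. (m(j := Suc (m j))) i + count_list w (int i)) = (\<lambda>i. m i + count_list (int j # w) (int i))" for j w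
    by (auto simp: fun_eq_iff)
  have "C m (x ^ Suc n * a) = C m (x * (x ^ n * a))" by (simp add: mult.assoc)
  also have "\<dots> = (\<Sum>j<p. \<Sum>w\<in>?W. C (\<lambda>i. m i + count_list (int j # w) (int i)) a)"
    unfolding step Suc.IH m ..
  also have "\<dots> = (\<Sum>j\<in>{0..<int p}. \<Sum>w\<in>?W. C (\<lambda>i. m i + count_list (j # w) (int i)) a)"
    by (rule sum.reindex_bij_witness[of _ nat int]) auto
  also have "\<dots> = (\<Sum>(j, w)\<in>{0..<int p} \<times> ?W. C (\<lambda>i. m i + count_list (j # w) (int i)) a)"
    by (simp add: sum.cartesian_product)
  also have "\<dots> = (\<Sum>w | set w \<subseteq> {0..<int p} \<and> length w = Suc n. C (\<lambda>i. m i + count_list w (int i)) a)"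
    by (rule sum.reindex_bij_witness[of _ "\<lambda>w. (hd w, tl w)" "\<lambda>(k, w). k # w"])
      (auto simp: length_Suc_conv)
  finally show ?case .
qed

text \<open>
  Expand \<open>x^{p-1}\<close> acting on \<open>(x z) * z * \<dots> * z\<close> by the Leibniz rule as a sum over words
  \<open>w : \<int>/p \<rightarrow> \<int>/p\<close> with \<open>w 0 = 0\<close>. The cyclic group acts by \<open>w \<mapsto> w (_ + k) - w k\<close> without changing
  the summands, and the fixed words are \<open>w i = c i\<close>: the word \<open>0\<close> contributes
  \<open>(x^p z) * z * \<dots> * z\<close>, the \<open>p - 1\<close> others contribute \<open>(x z) * \<dots> * (x z)\<close> each.
\<close>

lemma convs_power_p_primitive:
  assumes x: "x \<in> primitives" and z: "lf z" and t: "t \<in> alg primitives" "x * t = 0"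
  shows "conv (\<lambda>y. z (x ^ p * y)) (convs (replicate (p - 1) z)) t = z x ^ p * \<epsilon> t"
proof -
  define C where "C m = convs (map (\<lambda>i y. z (x ^ m i * y)) [0..<p])" for m
  have p2: "p \<ge> 2" using prime_ge_2_nat[OF prime_p] .
  let ?P = "int p"
  \<comment> \<open>The leading letter \<open>0\<close> records the derivative already present in
    the factor \<open>x z\<close>; the other \<open>p - 1\<close> letters come from
    \<open>x ^ (p - 1)\<close>.\<close>
  define X where "X = {w. set w \<subseteq> {0..<?P} \<and> length w = p \<and> w ! 0 = 0}"
  define F where "F w = C (\<lambda>i. count_list w (int i)) t" for w
  have Cz: "C m 0 = 0" for m unfolding C_def using z by (intro lf_zero lf_convs) (auto simp: lf_mult)
  have xt: "x ^ (p - 1) * t = 0"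
  proof -
    have "p - 1 = Suc (p - 2)" using p2 by simp
    then have "x ^ (p - 1) = x ^ (p - 2) * x" by (simp only: power_Suc2)
    then show ?thesis using t(2) by (simp add: mult.assoc)
  qed
  have "0 = (\<Sum>w | set w \<subseteq> {0..<?P} \<and> length w = p - 1. C (\<lambda>i. (if i = 0 then 1 else 0) + count_list w (int i)) t)"
    using convs_power_words[OF x z, of "\<lambda>i. if i = 0 then 1 else 0" "p - 1" t] xt Cz by (simp add: C_def)
  also have "\<dots> = sum F X"
  proof (rule sum.reindex_bij_witness[of _ tl "\<lambda>w. 0 # w"])
    fix w assume w: "w \<in> X"
    then obtain a v where v: "w = a # v" using p2 by (cases w) (auto simp: X_def)
    with w p2 show "0 # tl w = w" "tl w \<in> {w. set w \<subseteq> {0..<?P} \<and> length w = p - 1}"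
      by (auto simp: X_def)
  next
    fix w assume "w \<in> {w. set w \<subseteq> {0..<?P} \<and> length w = p - 1}"
    then show "0 # w \<in> X" using p2 by (auto simp: X_def)
    have "(\<lambda>i. (if i = 0 then 1 else 0) + count_list w (int i)) = (\<lambda>i. count_list (0 # w) (int i))"
      by (auto simp: fun_eq_iff)
    then show "F (0 # w) = C (\<lambda>i. (if i = 0 then 1 else 0) + count_list w (int i)) t"
      by (simp add: F_def)
  qed auto
  \<comment> \<open>The map shifts the argument by one and then subtracts what is needed to restore
    \<open>w ! 0 = 0\<close>.\<close>
  also have "sum F X = sum F {w \<in> X. map (\<lambda>j. (j - w ! 1) mod ?P) (rotate1 w) = w}"
  proof (rule sum_fixed_points[OF prime_p of_nat_p_scalar, where \<sigma> = "\<lambda>w. map (\<lambda>j. (j - w ! 1) mod ?P) (rotate1 w)"])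
    show "finite X" unfolding X_def
      by (rule finite_subset[OF _ finite_lists_length_eq[of "{0..<?P}" p]]) auto
    let ?\<sigma> = "\<lambda>w. map (\<lambda>j. (j - w ! 1) mod ?P) (rotate1 w)"
    fix w assume w: "w \<in> X"
    have len: "length w = p" using w by (simp add: X_def)
    have rng: "0 \<le> w ! i" "w ! i < ?P" if "i < p" for i
    proof -
      have "w ! i \<in> set w" "set w \<subseteq> {0..<?P}" using that w by (auto simp: X_def)
      then show "0 \<le> w ! i" "w ! i < ?P" by auto
    qed
    have "set (?\<sigma> w) \<subseteq> {0..<?P}" using p_gt_0 by (auto simp del: set_rotate1)
    moreover have "?\<sigma> w ! 0 = 0" using len p2 by (simp add: nth_rotate1)
    ultimately show "?\<sigma> w \<in> X" using len by (simp add: X_def)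
    have "(?\<sigma> ^^ k) w = map (\<lambda>i. (w ! ((i + k) mod p) - w ! (k mod p)) mod ?P) [0..<p]" for k
    proof (induction k)
      case 0
      have "w ! 0 = 0" using w by (simp add: X_def)
      then show ?case using rng len by (intro nth_equalityI) auto
    next
      case (Suc k)
      show ?case
        unfolding funpow.simps o_apply Suc.IH using p2
        by (intro nth_equalityI) (simp_all add: nth_rotate1 mod_simps)
    qed
    from this[of p] show "(?\<sigma> ^^ p) w = w"
      using w rng len p2 by (intro nth_equalityI) (auto simp: X_def)
    define c where "c = nat (w ! 1)"
    have c: "int c = w ! 1" using rng[of 1] p2 by (simp add: c_def)
    \<comment> \<open>Subtracting \<open>c\<close> from the letters rotates the letter counts, so
      the factors of the product are rotated and \<open>convs_append_commute\<close>
      applies.\<close>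
    have count: "count_list (?\<sigma> w) (int i) = count_list w (int ((i + c) mod p))" if "i < p" for i
    proof -
      have iff: "int i = (j - w ! 1) mod ?P \<longleftrightarrow> int ((i + c) mod p) = j" if j: "0 \<le> j" "j < ?P" for j
      proof
        assume "int i = (j - w ! 1) mod ?P"
        then have "(int i + w ! 1) mod ?P = ((j - w ! 1) mod ?P + w ! 1) mod ?P" by simp
        then show "int ((i + c) mod p) = j" using j by (simp add: zmod_int c mod_simps)
      next
        assume "int ((i + c) mod p) = j"
        then have "(j - w ! 1) mod ?P = ((int i + w ! 1) mod ?P - w ! 1) mod ?P" by (simp add: zmod_int c)
        then show "int i = (j - w ! 1) mod ?P" using \<open>i < p\<close> by (simp add: mod_simps)
      qed
      have "count_list (?\<sigma> w) (int i) = length (filter (\<lambda>j. int i = (j - w ! 1) mod ?P) (rotate1 w))"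
        by (simp add: count_list_eq_length_filter filter_map o_def)
      also have "filter (\<lambda>j. int i = (j - w ! 1) mod ?P) (rotate1 w) = filter ((=) (int ((i + c) mod p))) (rotate1 w)"
      proof (rule filter_cong[OF refl])
        fix j assume "j \<in> set (rotate1 w)"
        then have "0 \<le> j" "j < ?P" using w by (auto simp: X_def)
        then show "int i = (j - w ! 1) mod ?P \<longleftrightarrow> int ((i + c) mod p) = j" by (rule iff)
      qed
      also have "length \<dots> = count_list (rotate1 w) (int ((i + c) mod p))"
        by (simp add: count_list_eq_length_filter)
      also have "\<dots> = count_list w (int ((i + c) mod p))"
        by (cases w) simp_all
      finally show ?thesis .
    qed
    let ?l = "map (\<lambda>i y. z (x ^ count_list w (int i) * y)) [0..<p]"
    have "map (\<lambda>i y. z (x ^ count_list (?\<sigma> w) (int i) * y)) [0..<p] = rotate c ?l"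
      by (intro nth_equalityI) (auto simp: count[unfolded One_nat_def] nth_rotate add.commute)
    also have "\<dots> = drop (c mod p) ?l @ take (c mod p) ?l" by (simp add: rotate_drop_take)
    finally have "F (?\<sigma> w) = convs (drop (c mod p) ?l @ take (c mod p) ?l) t" by (simp add: F_def C_def)
    also have "\<dots> = convs (take (c mod p) ?l @ drop (c mod p) ?l) t"
    proof (rule convs_append_commute[OF t(1)])
      fix f assume "f \<in> set (drop (c mod p) ?l @ take (c mod p) ?l)"
      then have "f \<in> set ?l" by (metis Un_iff in_set_dropD in_set_takeD set_append)
      then show "lf f" using z by (auto simp: lf_mult)
    qed
    finally show "F (?\<sigma> w) = F w" by (simp add: F_def C_def)
  qed
  also have "{w \<in> X. map (\<lambda>j. (j - w ! 1) mod ?P) (rotate1 w) = w} =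
      (\<lambda>c. map (\<lambda>i. (int i * c) mod ?P) [0..<p]) ` {0..<?P}"
  proof (intro set_eqI iffI)
    fix w assume w: "w \<in> {w \<in> X. map (\<lambda>j. (j - w ! 1) mod ?P) (rotate1 w) = w}"
    then have len: "length w = p" "w ! 0 = 0" by (auto simp: X_def)
    have rng: "0 \<le> w ! i" "w ! i < ?P" if "i < p" for i
    proof -
      have "w ! i \<in> set w" "set w \<subseteq> {0..<?P}" using that w by (auto simp: X_def)
      then show "0 \<le> w ! i" "w ! i < ?P" by auto
    qed
    have "w ! i = (int i * w ! 1) mod ?P" if "i < p" for i
      using that
    proof (induction i)
      case (Suc i)
      have "w ! i = map (\<lambda>j. (j - w ! 1) mod ?P) (rotate1 w) ! i" using w by simp
      also have "\<dots> = (w ! Suc i - w ! 1) mod ?P" using Suc.prems len by (simp add: nth_rotate1)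
      finally have "(w ! i + w ! 1) mod ?P = ((w ! Suc i - w ! 1) mod ?P + w ! 1) mod ?P" by simp
      then have "w ! Suc i = (w ! i + w ! 1) mod ?P" using rng[OF Suc.prems] by (simp add: mod_simps)
      also have "\<dots> = ((int i * w ! 1) mod ?P + w ! 1) mod ?P" using Suc by simp
      finally show ?case by (simp add: mod_simps algebra_simps)
    qed (use len in simp)
    then have "w = map (\<lambda>i. (int i * (w ! 1)) mod ?P) [0..<p]" using len by (intro nth_equalityI) auto
    moreover have "w ! 1 \<in> {0..<?P}" using rng[of 1] p2 by auto
    ultimately show "w \<in> (\<lambda>c. map (\<lambda>i. (int i * c) mod ?P) [0..<p]) ` {0..<?P}" by (rule image_eqI)
  next
    fix w assume "w \<in> (\<lambda>c. map (\<lambda>i. (int i * c) mod ?P) [0..<p]) ` {0..<?P}"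
    then obtain c where c: "w = map (\<lambda>i. (int i * c) mod ?P) [0..<p]" by (rule imageE)
    have nw: "w ! i = (int i * c) mod ?P" if "i < p" for i using that by (simp add: c)
    have "map (\<lambda>j. (j - w ! 1) mod ?P) (rotate1 w) ! i = w ! i" if "i < p" for i
    proof -
      have "map (\<lambda>j. (j - w ! 1) mod ?P) (rotate1 w) ! i = (w ! (Suc i mod p) - w ! 1) mod ?P"
        using that by (simp add: c nth_rotate1)
      also have "\<dots> = (int (Suc i) * c - c) mod ?P"
        using p2 by (simp add: nw zmod_int mod_simps)
      finally show ?thesis using that by (simp add: nw algebra_simps)
    qed
    then have "map (\<lambda>j. (j - w ! 1) mod ?P) (rotate1 w) = w" by (intro nth_equalityI) (simp_all add: c)
    moreover have "set w \<subseteq> {0..<?P}" "w ! 0 = 0" "length w = p" using p2 by (auto simp: c)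
    ultimately have "map (\<lambda>j. (j - w ! 1) mod ?P) (rotate1 w) = w" "w \<in> X" by (simp_all add: X_def)
    then show "w \<in> {w \<in> X. map (\<lambda>j. (j - w ! 1) mod ?P) (rotate1 w) = w}" by simp
  qed
  also have "sum F \<dots> = (\<Sum>c\<in>{0..<?P}. F (map (\<lambda>i. (int i * c) mod ?P) [0..<p]))"
  proof (rule sum.reindex[unfolded o_def], rule inj_onI)
    fix c c' assume c: "c \<in> {0..<?P}" "c' \<in> {0..<?P}"
      and e: "map (\<lambda>i. (int i * c) mod ?P) [0..<p] = map (\<lambda>i. (int i * c') mod ?P) [0..<p]"
    from arg_cong[OF e, of "\<lambda>w. w ! 1"] show "c = c'" using c p2 by simp
  qed
  also have "\<dots> = F (map (\<lambda>i. 0) [0..<p]) + (\<Sum>c\<in>{0<..<?P}. F (map (\<lambda>i. (int i * c) mod ?P) [0..<p]))"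
  proof -
    have "{0..<?P} = insert 0 {0<..<?P}" using p2 by auto
    then show ?thesis by simp
  qed
  \<comment> \<open>For a nonzero slope \<open>c\<close> the word is a permutation of the residues,
    so each factor is differentiated exactly once.\<close>
  also have "(\<Sum>c\<in>{0<..<?P}. F (map (\<lambda>i. (int i * c) mod ?P) [0..<p])) = (\<Sum>c\<in>{0<..<?P}. C (\<lambda>_. 1) t)"
  proof (rule sum.cong[OF refl])
    fix c assume c: "c \<in> {0<..<?P}"
    let ?w = "map (\<lambda>i. (int i * c) mod ?P) [0..<p]"
    have inj: "inj_on (\<lambda>i. (int i * c) mod ?P) {0..<p}"
    proof (rule inj_onI)
      fix i j assume ij: "i \<in> {0..<p}" "j \<in> {0..<p}" "(int i * c) mod ?P = (int j * c) mod ?P"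
      then have "?P dvd (int i - int j) * c" by (simp add: mod_eq_dvd_iff left_diff_distrib)
      moreover have "prime ?P" using prime_p by simp
      moreover have "\<not> ?P dvd c" using c zdvd_not_zless by auto
      ultimately have "?P dvd int i - int j" using prime_dvd_mult_iff by blast
      then have "int i mod ?P = int j mod ?P" by (simp add: mod_eq_dvd_iff)
      then show "i = j" using ij(1,2) by simp
    qed
    then have d: "distinct ?w" by (simp add: distinct_map)
    have "set ?w \<subseteq> {0..<?P}" using p2 by auto
    moreover have "card (set ?w) = card {0..<?P}" using distinct_card[OF d] by simp
    ultimately have s: "set ?w = {0..<?P}" by (intro card_subset_eq) auto
    have "count_list v y = 1" if "distinct v" "y \<in> set v" for v and y :: int
      using that by (induction v) (auto simp: count_notin)
    from this[OF d] have "count_list ?w (int i) = 1" if "i < p" for i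
      using s that by auto
    then have "map (\<lambda>i y. z (x ^ count_list ?w (int i) * y)) [0..<p] = map (\<lambda>i y. z (x ^ 1 * y)) [0..<p]"
      by (intro map_cong) auto
    then show "F ?w = C (\<lambda>_. 1) t" by (simp only: F_def C_def)
  qed
  \<comment> \<open>There are \<open>p - 1\<close> nonzero slopes, and \<open>p - 1 = -1\<close> in
    the field.\<close>
  also have "\<dots> = - C (\<lambda>_. 1) t"
  proof -
    have "card {0<..<?P} = p - 1" using p2 by (simp add: nat_diff_distrib)
    moreover have "of_nat (p - 1) = (- 1 :: 'a)" using of_nat_p_scalar p2 by (simp add: of_nat_diff)
    ultimately show ?thesis by simp
  qed
  finally have "F (map (\<lambda>i. 0) [0..<p]) = C (\<lambda>_. 1) t" by simp
  also have "C (\<lambda>_. 1) t = convs (replicate p (\<lambda>y. z (x * y))) t"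
    by (simp add: C_def map_replicate_const)
  also have "\<dots> = z x ^ p * \<epsilon> t"
    using convs_replicate_p[OF t(1) lf_mult(1)[OF z], of x] by simp
  also have "F (map (\<lambda>i. 0) [0..<p]) = conv (\<lambda>y. z (x ^ p * y)) (convs (replicate (p - 1) z)) t"
  proof -
    have "count_list (map (\<lambda>i. 0) [0..<p]) (int i) = (if i = 0 then p else 0)" for i
      by (simp add: count_list_eq_length_filter filter_map o_def)
    moreover have "[0..<p] = 0 # [1..<p]" using p2 by (simp add: upt_conv_Cons)
    then have "map (\<lambda>i y. z (x ^ (if i = 0 then p else 0) * y)) [0..<p] = (\<lambda>y. z (x ^ p * y)) # map (\<lambda>i. z) [1..<p]"
      by (simp cong: map_cong)
    ultimately show ?thesis by (simp add: F_def C_def map_replicate_const)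
  qed
  finally show ?thesis .
qed

text \<open>Apply \<open>y\<close> as a derivation to \<open>(x z) * z^{p-1}\<close> and evaluate at
  \<open>t\<close>: the total is \<open>0\<close>, one term is the left side, and the other is
  \<open>(p - 1) (x z) * (y z) * z^{p-2}\<close>, which is symmetric in \<open>x\<close> and
  \<open>y\<close>.\<close>

lemma conv_commutator_primitive:
  assumes xy: "x \<in> primitives" "y \<in> primitives" and z: "lf z"
    and t: "t \<in> alg primitives" "x * t = 0" "y * t = 0"
  shows "conv (\<lambda>w. z (x * (y * w))) (convs (replicate (p - 1) z)) t =
    conv (\<lambda>w. z (y * (x * w))) (convs (replicate (p - 1) z)) t"
proof -
  let ?c = "convs (replicate (p - 1) z)" and ?r = "convs (replicate (p - 2) z)"
  have U: "subcoalgebra (alg primitives)" using subbialgebra_alg_primitives by (simp add: subbialgebra_def)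
  have lc: "lf ?c" "lf ?r" using z by (intro lf_convs; auto)+
  have *: "conv (\<lambda>w. z (x * (y * w))) ?c t = - (of_nat (p - 1) * conv (conv (\<lambda>w. z (x * w)) (\<lambda>w. z (y * w))) ?r t)"
    if xy: "x \<in> primitives" "y \<in> primitives" and "y * t = 0" for x y
  proof -
    have "0 = conv (\<lambda>w. z (x * w)) ?c (y * t)"
      using that z lc by (simp add: lf_zero[OF lf_conv] lf_mult)
    also have "\<dots> = conv (\<lambda>w. z (x * (y * w))) ?c t + conv (\<lambda>w. z (x * w)) (\<lambda>w. ?c (y * w)) t"
      using z lc by (simp add: conv_primitive_mult[OF xy(2)] lf_mult)
    also have "conv (\<lambda>w. z (x * w)) (\<lambda>w. ?c (y * w)) t =
        conv (\<lambda>w. z (x * w)) (\<lambda>w. of_nat (p - 1) * conv (\<lambda>w. z (y * w)) ?r w) t"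
      using z lc convs_replicate_primitive_mult[OF xy(2) z, of _ "p - 1"]
      by (intro conv_cong_on[OF U t(1)]) (auto simp: lf_mult lf_lin numeral_2_eq_2)
    also have "\<dots> = of_nat (p - 1) * conv (conv (\<lambda>w. z (x * w)) (\<lambda>w. z (y * w))) ?r t"
      using z lc by (simp add: conv_lin conv_assoc lf_mult)
    finally show ?thesis by (simp add: eq_neg_iff_add_eq_0)
  qed
  have "conv (conv (\<lambda>w. z (x * w)) (\<lambda>w. z (y * w))) ?r t = conv (conv (\<lambda>w. z (y * w)) (\<lambda>w. z (x * w))) ?r t"
    using z lc conv_commute by (intro conv_cong_on[OF U t(1)]) (auto simp: lf_mult)
  then show ?thesis using *[OF xy t(3)] *[OF xy(2,1) t(2)] by simp
qed

text \<open>
  For a linear functional \<open>z\<close>, \<open>F x = ((x z) * z^{p-1}) t\<close> is linear in \<open>x\<close>, kills commutators and satisfies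
  \<open>F (x^p) = z(x)^p \<epsilon> t\<close>. Letting \<open>z\<close> run through a dual basis, the \<open>p\<close>-th powers of a basis are
  linearly independent modulo commutators.
\<close>

lemma abelian_if_invariant:
  assumes t: "t \<in> alg primitives" "\<And>x. x \<in> primitives \<Longrightarrow> x * t = 0" "\<epsilon> t \<noteq> 0"
  shows "\<forall>x\<in>primitives. \<forall>y\<in>primitives. x * y - y * x = 0"
    and "primitives = span {x ^ p | x. x \<in> primitives}"
proof -
  obtain E where E: "finite E" "independent E" "span E = primitives" "card E = dim primitives"
    by (rule basis_of_subspace[OF subspace_primitives])
  have EP: "E \<subseteq> primitives" using E(3) span_superset by auto
  obtain d where d: "\<And>e. lf (d e)" "\<And>e e'. e' \<in> E \<Longrightarrow> d e e' = (if e' = e then 1 else 0)"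
    using dual_basis[OF E(1,2)] by metis
  define F where "F e x = conv (\<lambda>w. d e (x * w)) (convs (replicate (p - 1) (d e))) t" for e x
  have lF: "lf (F e)" for e
    unfolding F_def using d(1)[of e]
    by (intro lfI) (simp_all add: conv_lin distrib_right scale_mult_left lf_add lf_scale)
  have Fp: "F e (e' ^ p) = (if e' = e then \<epsilon> t else 0)" if "e' \<in> E" for e e'
    unfolding F_def using that EP t(2) p_gt_0
    by (subst convs_power_p_primitive[OF _ d(1) t(1)]) (auto simp: d(2))
  have Fs: "F e (\<Sum>e'\<in>E. c e' *s e' ^ p) = c e * \<epsilon> t" if "e \<in> E" for c e
    using that E(1) by (simp add: lf_sum[OF lF] lf_scale[OF lF] Fp if_distrib sum.delta cong: if_cong)
  have pE: "p_independent E"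
    unfolding p_independent_def
  proof (intro allI impI ballI)
    fix c e assume "(\<Sum>e\<in>E. c e *s e ^ p) = 0" "e \<in> E"
    then show "c e = 0" using Fs[of e c] t(3) lf_zero[OF lF] by simp
  qed
  note pE' = p_independent_imp[OF E(1) pE]
  have sub: "(\<lambda>e. e ^ p) ` E \<subseteq> primitives" using EP primitive_power_p by auto
  have sp: "primitives \<subseteq> span ((\<lambda>e. e ^ p) ` E)"
    using card_eq_dim[OF sub] pE' E(1,4) by (simp add: card_image)
  show "\<forall>x\<in>primitives. \<forall>y\<in>primitives. x * y - y * x = 0"
  proof (intro ballI)
    fix x y assume xy: "x \<in> primitives" "y \<in> primitives"
    have "x * y - y * x \<in> primitives"
      by (rule commutator_primitive[OF _ _ , of x 0 y 0 "{}" "{}"]) (use xy in \<open>auto simp: primitives_def\<close>)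
    then have "x * y - y * x \<in> span ((\<lambda>e. e ^ p) ` E)" using sp by blast
    then obtain b where "x * y - y * x = (\<Sum>v\<in>(\<lambda>e. e ^ p) ` E. b v *s v)"
      using span_finite[of "(\<lambda>e. e ^ p) ` E"] E(1) by auto
    then have eq: "x * y - y * x = (\<Sum>e\<in>E. b (e ^ p) *s e ^ p)"
      by (simp add: sum.reindex[OF pE'(1)])
    have "F e (x * y) = F e (y * x)" for e
      unfolding F_def using conv_commutator_primitive[OF xy d(1)[of e] t(1)] t(2) xy by (simp add: mult.assoc)
    then have "F e (x * y - y * x) = 0" for e by (simp add: lf_diff[OF lF])
    then have "b (e ^ p) = 0" if "e \<in> E" for e using Fs[OF that, of "\<lambda>e. b (e ^ p)"] eq t(3) by simp
    then show "x * y - y * x = 0" unfolding eq by simp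
  qed
  show "primitives = span {x ^ p | x. x \<in> primitives}"
  proof
    show "primitives \<subseteq> span {x ^ p | x. x \<in> primitives}"
      using sp span_mono[of "(\<lambda>e. e ^ p) ` E" "{x ^ p | x. x \<in> primitives}"] EP by blast
    show "span {x ^ p | x. x \<in> primitives} \<subseteq> primitives"
      using primitive_power_p subspace_primitives by (intro span_minimal) auto
  qed
qed

end

section \<open>The equivalences for one sub-bialgebra, and the two instances\<close>

context char_p_hopf_algebra
begin

text \<open>Everything is compared with \<open>T\<close>, which does not mention \<open>A\<close>;
  the instances \<open>H\<close> and \<open>K\<close> are thereby linked without comparing them
  directly.\<close>

lemma subbialgebra_equivalences:
  assumes A: "subbialgebra A" "primitives \<subseteq> A"
  defines "T \<equiv> (\<forall>x\<in>primitives. \<forall>y\<in>primitives. x * y - y * x = 0) \<and> primitives = span {x ^ p | x. x \<in> primitives}"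
  shows "semisimple A \<longleftrightarrow> T" "(\<exists>t\<in>left_integrals \<epsilon> A. \<epsilon> t \<noteq> 0) \<longleftrightarrow> T" "(\<exists>t\<in>right_integrals \<epsilon> A. \<epsilon> t \<noteq> 0) \<longleftrightarrow> T"
proof -
  have inv: T if "\<And>x. x \<in> primitives \<Longrightarrow> x * \<Lambda> = 0" "\<epsilon> \<Lambda> \<noteq> 0" for \<Lambda>
  proof -
    from invariant_descent[OF that]
    obtain t where "t \<in> alg primitives" "\<And>x. x \<in> primitives \<Longrightarrow> x * t = 0" "\<epsilon> t \<noteq> 0"
      by blast
    from abelian_if_invariant[OF this] show T unfolding T_def by blast
  qed
  have ss: "semisimple A \<Longrightarrow> \<exists>t\<in>left_integrals \<epsilon> A. \<epsilon> t \<noteq> 0"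
    using semisimple_imp_left_integral A(1) by (simp add: subbialgebra_def)
  have left: T if "t \<in> left_integrals \<epsilon> A" "\<epsilon> t \<noteq> 0" for t
  proof (rule inv[OF _ that(2)])
    show "x * t = 0" if "x \<in> primitives" for x
      using \<open>t \<in> left_integrals \<epsilon> A\<close> that A(2) counit_primitive[OF that] by (auto simp: left_integrals_def)
  qed
  have right: T if "t \<in> right_integrals \<epsilon> A" "\<epsilon> t \<noteq> 0" for t
  proof (rule inv[of "S t"])
    show "\<epsilon> (S t) \<noteq> 0" using that(2) by (simp add: counit_antipode)
    show "x * S t = 0" if x: "x \<in> primitives" for x
    proof -
      have "t * x = 0"
        using \<open>t \<in> right_integrals \<epsilon> A\<close> x A(2) counit_primitive[OF x] by (auto simp: right_integrals_def)
      then show ?thesis using antipode_mult_primitive[OF x, of t] antipode_scale[of 0 0] by simp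
    qed
  qed
  \<comment> \<open>\<open>commutative\<close> covers the whole algebra, so left and right integrals
    of \<open>A\<close> coincide.\<close>
  have T: "semisimple A" "left_integrals \<epsilon> A = right_integrals \<epsilon> A" if T
  proof -
    have ab: "x * y = y * x" if "x \<in> primitives" "y \<in> primitives" for x y
      using \<open>T\<close> that by (simp add: T_def)
    have prim: "primitives = span {x ^ p | x. x \<in> primitives}" using \<open>T\<close> unfolding T_def by blast
    have comm: "x * y = y * x" for x y :: 'b by (rule commutative[OF ab prim])
    show "semisimple A" by (rule semisimple_subbialgebra[OF A comm prim])
    show "left_integrals \<epsilon> A = right_integrals \<epsilon> A"
      unfolding left_integrals_def right_integrals_def using comm by metis
  qed
  show "semisimple A \<longleftrightarrow> T" "(\<exists>t\<in>left_integrals \<epsilon> A. \<epsilon> t \<noteq> 0) \<longleftrightarrow> T" "(\<exists>t\<in>right_integrals \<epsilon> A. \<epsilon> t \<noteq> 0) \<longleftrightarrow> T"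
    using ss left right T by blast+
qed

end

theorem corollary4p3:
  fixes p :: nat
    and scale :: "'k::field \<Rightarrow> 'h::ring_1 \<Rightarrow> 'h"
    and \<Delta> :: "'h \<Rightarrow> ('h \<times> 'h \<Rightarrow>\<^sub>0 'k)"
    and \<epsilon> :: "'h \<Rightarrow> 'k"
    and S :: "'h \<Rightarrow> 'h"
    and H \<gg> K :: "'h set"
  assumes "prime p"
    and "CHAR('k) = p"
    and "hopf_algebra scale \<Delta> \<epsilon> S"
    and "k_algebra.finite_dimensional scale"
    and "hopf_algebra.connected scale \<Delta>"
    and "H = UNIV"
    and "\<gg> = hopf_algebra.primitives scale \<Delta>"
    and "K = hopf_algebra.generated_hopf_subalgebra scale \<Delta> S \<gg>"
  shows "let P1 = k_algebra.semisimple scale H;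
             P2 = (\<exists>t \<in> k_algebra.right_integrals scale \<epsilon> H. \<epsilon> t \<noteq> 0);
             P3 = (\<exists>t \<in> k_algebra.left_integrals scale \<epsilon> H. \<epsilon> t \<noteq> 0);
             P4 = k_algebra.semisimple scale K;
             P5 = ((\<forall>x\<in>\<gg>. \<forall>y\<in>\<gg>. x * y - y * x = 0) \<and>
                   \<gg> = module.span scale {x ^ p | x. x \<in> \<gg>});
             P6 = (\<exists>t \<in> k_algebra.right_integrals scale \<epsilon> K. \<epsilon> t \<noteq> 0);
             P7 = (\<exists>t \<in> k_algebra.left_integrals scale \<epsilon> K. \<epsilon> t \<noteq> 0)
         in (P1 \<longleftrightarrow> P2) \<and> (P2 \<longleftrightarrow> P3) \<and> (P3 \<longleftrightarrow> P4) \<and>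
            (P4 \<longleftrightarrow> P5) \<and> (P5 \<longleftrightarrow> P6) \<and> (P6 \<longleftrightarrow> P7)"
proof -
  interpret hopf_algebra scale \<Delta> \<epsilon> S by fact
  from assms(4) obtain X where X: "finite X" "span X = UNIV"
    unfolding finite_dimensional_def by blast
  obtain Basis where "Basis \<subseteq> X" "independent Basis" "X \<subseteq> span Basis"
    by (rule maximal_independent_subset)
  then have "finite Basis" "span Basis = UNIV"
    using X finite_subset span_minimal[of X "span Basis"] by auto
  with \<open>independent Basis\<close> interpret char_p_hopf_algebra scale \<Delta> \<epsilon> S Basis p
    by unfold_locales (use assms in auto)
  have H: "subbialgebra H" "primitives \<subseteq> H"
    using assms(6) subcoalgebra_UNIV by (auto simp: subbialgebra_def subalgebra_def)
  have K: "subbialgebra K" "primitives \<subseteq> K"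
    using subbialgebra_alg_primitives alg_superset
    by (auto simp: assms(7,8) generated_hopf_subalgebra_primitives)
  show ?thesis
    unfolding Let_def assms(7) subbialgebra_equivalences[OF H] subbialgebra_equivalences[OF K]
    by (intro conjI refl)
qed

end
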